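(* Let $\Omega$ be a bounded Lipschitz domain and $1<p<\infty$. There is $C>0$ independent of $\varepsilon$ such that for every $u\in W^{1,p}_{\phi_\varepsilon}(\Omega_\varepsilon)$, $$\|u\|_{L^p(\Omega_\varepsilon)}\le C\varepsilon\|\phi_\varepsilon\nabla u\|_{L^p(\Omega_\varepsilon)}+C\|\phi_\varepsilon u\|_{L^p(\Omega_\varepsilon)}$$ and $$\inf_{L\in\mathbb R}\|u-L\|_{L^p(\Omega_\varepsilon)}\le C\|\phi_\varepsilon\nabla u\|_{L^p(\Omega_\varepsilon)}.$$
   Context: Let $Y=(-1/2,1/2)^d$ and $\tau_1,\dots,\tau_m\subset Y$ mutually disjoint open sets with smooth connected boundaries, $\mathrm{dist}(\tau_i,\partial Y)\ge c_0$, $\mathrm{dist}(\tau_i,\tau_j)\ge c_0$; $T=\bigcup_i\overline{\tau_i}$, $T_\varepsilon=\bigcup_{z\in\mathbb Z^d}\varepsilon(z+T)$, $\Omega_\varepsilon=\Omega\setminus T_\varepsilon$ ($0<\varepsilon<1$), with $\mathrm{dist}(\partial\Omega,\partial T_\varepsilon)\ge c_0\varepsilon$. Extended holes: smooth open $\tau_i'\supset\tau_i$ with $\mathrm{dist}(\tau_i',\tau_j')\ge c_0/4$, $\mathrm{dist}(\tau_i',\partial Y)\ge c_0/4$, $\mathrm{dist}(\partial\tau_i',\tau_i)\ge c_0/4$; $T'=\bigcup_i\overline{\tau_i'}$; it is assumed that the sets $\varepsilon(z+T')$, $z\in\mathbb Z^d$, do not intersect $\partial\Omega$. The weight $\phi>0$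 is $\mathbb Z^d$-periodic on $\mathbb R^d\setminus\bigcup_z(z+T)$ with $c\,\mathrm{dist}(y,T)\le\phi(y)\le C\,\mathrm{dist}(y,T)$ on $Y$, $\phi\in C^{1,\alpha}(\overline{Y\setminus T})$; $\phi_\varepsilon(x)=\phi(x/\varepsilon)$. $W^{1,p}_{\phi_\varepsilon}(\Omega_\varepsilon)=\{v\in L^1_{loc}(\Omega_\varepsilon):\phi_\varepsilon v\in L^p,\ \phi_\varepsilon\nabla v\in L^p\}$. *)

theory Defs
  imports "HOL-Analysis.Analysis"
begin

fun iter_dd :: "'a::euclidean_space list \<Rightarrow> ('a \<Rightarrow> real) \<Rightarrow> 'a \<Rightarrow> real" where
  "iter_dd [] f = f"
| "iter_dd (v # vs) f = (\<lambda>x. frechet_derivative (iter_dd vs f) (at x) v)"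

definition smooth_on :: "'a::euclidean_space set \<Rightarrow> ('a \<Rightarrow> real) \<Rightarrow> bool" where
  "smooth_on S f \<longleftrightarrow>
     (\<forall>vs. (\<forall>x\<in>S. iter_dd vs f differentiable (at x)) \<and> continuous_on S (iter_dd vs f))"

definition lipschitz_boundary :: "'a::euclidean_space set \<Rightarrow> bool" where
  "lipschitz_boundary U \<longleftrightarrow>
     (\<forall>x\<in>frontier U. \<exists>r>0. \<exists>\<nu> g L. norm \<nu> = 1 \<and> L-lipschitz_on UNIV g \<and>
        U \<inter> ball x r = {y\<in>ball x r. y \<bullet> \<nu> < g (y - (y \<bullet> \<nu>) *\<^sub>R \<nu>)})"

definition smooth_boundary :: "'a::euclidean_space set \<Rightarrow> bool" where
  "smooth_boundary U \<longleftrightarrow>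
     (\<forall>x\<in>frontier U. \<exists>r>0. \<exists>\<nu> g. norm \<nu> = 1 \<and> smooth_on UNIV g \<and>
        U \<inter> ball x r = {y\<in>ball x r. y \<bullet> \<nu> < g (y - (y \<bullet> \<nu>) *\<^sub>R \<nu>)})"

text \<open>\<open>f \<in> C^{1,\<alpha>}(closure U)\<close> for open bounded U: f differentiable on U, f and Df
  bounded, Df uniformly \<alpha>-Hoelder on U.\<close>
definition C1_alpha_closure :: "real \<Rightarrow> 'a::euclidean_space set \<Rightarrow> ('a \<Rightarrow> real) \<Rightarrow> bool" where
  "C1_alpha_closure \<alpha> U f \<longleftrightarrow>
     (\<exists>D. (\<forall>x\<in>U. (f has_derivative D x) (at x)) \<and>
          bounded (f ` U) \<and> bounded ((\<lambda>x. onorm (D x)) ` U) \<and>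
          (\<exists>H. \<forall>x\<in>U. \<forall>y\<in>U. onorm (\<lambda>v. D x v - D y v) \<le> H * dist x y powr \<alpha>))"

definition test_fun :: "'a::euclidean_space set \<Rightarrow> ('a \<Rightarrow> real) \<Rightarrow> bool" where
  "test_fun U \<psi> \<longleftrightarrow> smooth_on UNIV \<psi> \<and>
     compact (closure {x. \<psi> x \<noteq> 0}) \<and> closure {x. \<psi> x \<noteq> 0} \<subseteq> U"

definition L1loc :: "'a::euclidean_space set \<Rightarrow> ('a \<Rightarrow> 'b::euclidean_space) \<Rightarrow> bool" where
  "L1loc U f \<longleftrightarrow> (\<forall>K. compact K \<and> K \<subseteq> U \<longrightarrow> integrable (lebesgue_on K) f)"

definition weak_grad :: "'a::euclidean_space set \<Rightarrow> ('a \<Rightarrow> real) \<Rightarrow> ('a \<Rightarrow> 'a) \<Rightarrow> bool" where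
  "weak_grad U u G \<longleftrightarrow> L1loc U G \<and>
     (\<forall>\<psi> v. test_fun U \<psi> \<longrightarrow>
        integral\<^sup>L (lebesgue_on U) (\<lambda>x. u x * frechet_derivative \<psi> (at x) v)
        = - integral\<^sup>L (lebesgue_on U) (\<lambda>x. \<psi> x * (G x \<bullet> v)))"

definition in_Lp :: "real \<Rightarrow> 'a::euclidean_space set \<Rightarrow> ('a \<Rightarrow> 'b::euclidean_space) \<Rightarrow> bool" where
  "in_Lp p U f \<longleftrightarrow> f \<in> borel_measurable (lebesgue_on U) \<and>
     integrable (lebesgue_on U) (\<lambda>x. norm (f x) powr p)"

definition Lp_norm :: "real \<Rightarrow> 'a::euclidean_space set \<Rightarrow> ('a \<Rightarrow> 'b::euclidean_space) \<Rightarrow> real" where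
  "Lp_norm p U f = (integral\<^sup>L (lebesgue_on U) (\<lambda>x. norm (f x) powr p)) powr (1 / p)"

definition weighted_W1p :: "real \<Rightarrow> ('a::euclidean_space \<Rightarrow> real) \<Rightarrow> 'a set \<Rightarrow> ('a \<Rightarrow> real) \<Rightarrow> ('a \<Rightarrow> 'a) \<Rightarrow> bool" where
  "weighted_W1p p w U u G \<longleftrightarrow> L1loc U u \<and> weak_grad U u G \<and>
     in_Lp p U (\<lambda>x. w x * u x) \<and> in_Lp p U (\<lambda>x. w x *\<^sub>R G x)"

definition int_lattice :: "(real^'n) set" where
  "int_lattice = {z. \<forall>i. z $ i \<in> \<int>}"

definition unit_cell :: "(real^'n) set" where
  "unit_cell = {y. \<forall>i. - 1/2 < y $ i \<and> y $ i < 1/2}"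

definition perf_set :: "real \<Rightarrow> (real^'n) set \<Rightarrow> (real^'n) set" where
  "perf_set \<epsilon> T = (\<Union>z\<in>int_lattice. (\<lambda>t. \<epsilon> *\<^sub>R (z + t)) ` T)"

end

(* No Sobolev theory is needed: everything is expressed through shifts. Testing the weak gradient G
   against smooth functions shows that for every h and almost every x whose segment [x, x + h] stays
   in the domain, |u(x + h) - u(x)| is at most the integral of |G| |h| along the segment.

   Integrating this over x bounds shifts of u in L^p. A shift that moves a boundary layer of a hole
   away from the hole satisfies, by a Schur test, a Hardy inequality with weight dist^p. The double
   integral of |u(x) - u(y)|^p over two sets is chained along overlapping balls, which is a Poincare
   inequality on any connected set whose boundary layers can be shifted inside. Applied to a thin
   collar of a single hole (connected because the boundary of the hole is), this controls u near the
   hole by u away from the hole, where the weight is bounded below; this is the first inequality.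

   For the second one, u is filled into each hole by a constant. The result is not weakly
   differentiable, but its shifts by vectors of length about epsilon are of size epsilon in L^p.
   Adding up 1/epsilon of them bounds all shifts of length one independently of epsilon, and the
   same chaining argument in the Lipschitz domain yields the Poincare inequality. *)

theory Submission
  imports Defs
begin

section \<open>Smooth cutoff functions\<close>

text \<open>Near a hole only dist * |grad u| is controlled, so \<open>u\<close> need not be Sobolev
  up to the hole and could a priori fail to be p-integrable there. Uniformity in \<epsilon> is
  obtained by working at period 1 with a countable family of holes that share all their constants,
  because they are lattice translates of finitely many shapes; \<epsilon> enters only through
  dilation. The extended holes serve to show that the neighbourhood of a hole is never cut by the
  boundary of \<Omega>. In the second inequality dilation turns the energy into \<epsilon>^p times
  the wanted one, while N equal short shifts cost N^p times a single one, by convexity; with N of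
  order 1/\<epsilon> the two powers cancel.\<close>

definition bump_tower :: "nat \<Rightarrow> real poly" where
  "bump_tower n = ((\<lambda>q. [:0, 0, 1:] * (q - pderiv q)) ^^ n) 1"

text \<open>With y = 1/x, the derivative of q(y) exp(-y) in x is y^2 (q(y) - q'(y)) exp(-y); hence
  the recursion in \<open>bump_tower\<close>, and \<open>bump n\<close> is the n-th derivative of
  the classical flat function exp(-1/x).\<close>

definition bump :: "nat \<Rightarrow> real \<Rightarrow> real" where
  "bump n x = (if x > 0 then poly (bump_tower n) (inverse x) * exp (- inverse x) else 0)"

lemma poly_exp_tendsto_0: "((\<lambda>x::real. poly q x * exp (- x)) \<longlongrightarrow> 0) at_top"
proof -
  have "(\<lambda>x::real. poly q x * exp (- x)) = (\<lambda>x. \<Sum>i\<le>degree q. coeff q i * (x ^ i / exp x))"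
    by (auto simp: poly_altdef sum_distrib_right exp_minus field_simps sum_divide_distrib)
  moreover have "((\<lambda>x::real. \<Sum>i\<le>degree q. coeff q i * (x ^ i / exp x)) \<longlongrightarrow> (\<Sum>i\<le>degree q. coeff q i * 0)) at_top"
    by (intro tendsto_intros tendsto_power_div_exp_0)
  ultimately show ?thesis by simp
qed

lemma poly_exp_at_right_0:
  "((\<lambda>x::real. poly q (inverse x) * exp (- inverse x)) \<longlongrightarrow> 0) (at_right 0)"
  by (rule filterlim_compose[OF poly_exp_tendsto_0 filterlim_inverse_at_top_right])

lemma bump_deriv: "(bump n has_real_derivative bump (Suc n) x) (at x)"
proof -
  consider "x > 0" | "x < 0" | "x = 0" by linarith
  then show ?thesis
  proof cases
    case 1
    have "((\<lambda>x. poly (bump_tower n) (inverse x) * exp (- inverse x)) has_real_derivative bump (Suc n) x) (at x)"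
      using 1
      by (auto intro!: derivative_eq_intros simp: bump_def bump_tower_def field_simps power2_eq_square)
    then show ?thesis
      by (rule has_field_derivative_transform_within_open[where S="{0<..}"]) (use 1 in \<open>auto simp: bump_def\<close>)
  next
    case 2
    have "((\<lambda>x. 0) has_real_derivative bump (Suc n) x) (at x)"
      using 2 by (simp add: bump_def)
    then show ?thesis
      by (rule has_field_derivative_transform_within_open[where S="{..<0}"]) (use 2 in \<open>auto simp: bump_def\<close>)
  next
    case 3
    \<comment> \<open>At 0 the difference quotient has the same form, with the polynomial multiplied
      by its variable, so the exponential still wins.\<close>
    have "((\<lambda>y. bump n y / y) \<longlongrightarrow> 0) (at_right 0)"
      by (rule tendsto_cong[THEN iffD1, OF _ poly_exp_at_right_0[of "[:0,1:] * bump_tower n"]])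
         (auto simp: eventually_at_right_field bump_def field_simps intro!: exI[of _ 1])
    moreover have "((\<lambda>y. bump n y / y) \<longlongrightarrow> 0) (at_left 0)"
      by (rule tendsto_cong[THEN iffD1, OF _ tendsto_const[of 0]])
         (auto simp: eventually_at_left_field bump_def intro!: exI[of _ "-1"])
    ultimately have "((\<lambda>y. bump n y / y) \<longlongrightarrow> 0) (at 0)"
      by (simp add: filterlim_split_at)
    then show ?thesis
      using 3 by (simp add: has_field_derivative_iff bump_def)
  qed
qed

lemma bump_0: "bump 0 x = (if x > 0 then exp (- inverse x) else 0)"
  by (simp add: bump_def bump_tower_def)

lemma bump_0_bounds: "0 \<le> bump 0 x" "bump 0 x \<le> 1"
  by (auto simp: bump_0)

text \<open>Membership in \<open>smooth_on\<close> involves all iterated directional derivatives.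
  This class is closed under taking one of them, so induction on the list of directions gives
  smoothness at once. The ridge clause carries a whole sequence \<open>d\<close> of successive
  derivatives so that differentiating a ridge function merely advances the index.\<close>

inductive_set smooth_funs :: "('a::euclidean_space \<Rightarrow> real) set" where
  smooth_funs_ridge: "(\<And>n t. (d n has_real_derivative d (Suc n) t) (at t)) \<Longrightarrow>
    (\<lambda>x. d n (x \<bullet> a + c)) \<in> smooth_funs"
| smooth_funs_const: "(\<lambda>x. c) \<in> smooth_funs"
| smooth_funs_add: "f \<in> smooth_funs \<Longrightarrow> g \<in> smooth_funs \<Longrightarrow> (\<lambda>x. f x + g x) \<in> smooth_funs"
| smooth_funs_mult: "f \<in> smooth_funs \<Longrightarrow> g \<in> smooth_funs \<Longrightarrow> (\<lambda>x. f x * g x) \<in> smooth_funs"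

lemma smooth_funs_deriv:
  assumes "f \<in> smooth_funs"
  shows "f differentiable (at x) \<and> (\<lambda>x. frechet_derivative f (at x) v) \<in> smooth_funs"
  using assms
proof (induction arbitrary: x)
  case (smooth_funs_ridge d n a c)
  have D: "((\<lambda>x. d n (x \<bullet> a + c)) has_derivative (\<lambda>v. d (Suc n) (x \<bullet> a + c) * (v \<bullet> a))) (at x)" for x
  proof -
    have "((\<lambda>x. x \<bullet> a + c) has_derivative (\<lambda>v. v \<bullet> a)) (at x)"
      by (auto intro!: derivative_eq_intros)
    from has_derivative_compose[OF this smooth_funs_ridge[unfolded has_field_derivative_def, of n "x \<bullet> a + c"]]
    show ?thesis by simp
  qed
  have "(\<lambda>x. d (Suc n) (x \<bullet> a + c) * (v \<bullet> a)) \<in> smooth_funs"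
    by (intro smooth_funs.smooth_funs_mult smooth_funs.smooth_funs_const smooth_funs.smooth_funs_ridge smooth_funs_ridge)
  then show ?case using D
    unfolding frechet_derivative_at[OF D, symmetric] by (auto simp: differentiable_def)
next
  case (smooth_funs_const c)
  then show ?case by (auto intro: smooth_funs.smooth_funs_const simp: frechet_derivative_const)
next
  case (smooth_funs_add f g)
  then have D: "((\<lambda>x. f x + g x) has_derivative (\<lambda>v. frechet_derivative f (at x) v + frechet_derivative g (at x) v)) (at x)" for x
    by (auto intro!: derivative_eq_intros frechet_derivative_works[THEN iffD1])
  then show ?case using smooth_funs_add smooth_funs.smooth_funs_add[of "\<lambda>x. frechet_derivative f (at x) v" "\<lambda>x. frechet_derivative g (at x) v"]
    unfolding frechet_derivative_at[OF D, symmetric] using D by (auto simp: differentiable_def)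
next
  case (smooth_funs_mult f g)
  then have D: "((\<lambda>x. f x * g x) has_derivative (\<lambda>v. f x * frechet_derivative g (at x) v + frechet_derivative f (at x) v * g x)) (at x)" for x
    by (intro has_derivative_mult frechet_derivative_works[THEN iffD1]) auto
  moreover have "(\<lambda>x. f x * frechet_derivative g (at x) v + frechet_derivative f (at x) v * g x) \<in> smooth_funs"
    using smooth_funs_mult by (intro smooth_funs.smooth_funs_add smooth_funs.smooth_funs_mult) auto
  ultimately show ?case
    unfolding frechet_derivative_at[OF D, symmetric] using D by (auto simp: differentiable_def)
qed

lemma smooth_funs_iter_dd: "f \<in> smooth_funs \<Longrightarrow> iter_dd vs f \<in> smooth_funs"
  by (induction vs) (auto dest: smooth_funs_deriv)

lemma smooth_funs_smooth_on: "f \<in> smooth_funs \<Longrightarrow> smooth_on UNIV f"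
  unfolding smooth_on_def
  by (meson smooth_funs_iter_dd smooth_funs_deriv differentiable_at_withinI
      differentiable_imp_continuous_on differentiable_on_def)

lemma smooth_funs_prod:
  "finite I \<Longrightarrow> (\<And>i. i \<in> I \<Longrightarrow> f i \<in> smooth_funs) \<Longrightarrow> (\<lambda>x. \<Prod>i\<in>I. f i x) \<in> smooth_funs"
  by (induction rule: finite_induct) (auto intro: smooth_funs_mult smooth_funs_const)

lemma smooth_funs_translate: "f \<in> smooth_funs \<Longrightarrow> (\<lambda>x. f (x - h)) \<in> smooth_funs"
proof (induction rule: smooth_funs.induct)
  case (smooth_funs_ridge d n a c)
  from smooth_funs.smooth_funs_ridge[of d n a "c - h \<bullet> a", OF smooth_funs_ridge]
  show ?case by (simp add: algebra_simps)
qed (auto intro: smooth_funs_mult smooth_funs_const smooth_funs_add)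

text \<open>Since exp(-1/s) tends to 1 as s grows, the factor \<open>Suc n\<close> makes each factor
  tend to 1 inside the box, while outside some factor is 0. The result is a sequence of cutoffs
  converging pointwise to the indicator of the open box, with values in [0, 1] as dominated
  convergence requires.\<close>

definition box_fun :: "'a::euclidean_space \<Rightarrow> 'a \<Rightarrow> nat \<Rightarrow> 'a \<Rightarrow> real" where
  "box_fun a b n x =
     (\<Prod>i\<in>Basis. bump 0 (real (Suc n) * (x \<bullet> i - a \<bullet> i)) * bump 0 (real (Suc n) * (b \<bullet> i - x \<bullet> i)))"

lemma box_fun_smooth: "box_fun a b n \<in> smooth_funs"
proof -
  \<comment> \<open>The k-th derivative of \<open>bump 0 (s * t)\<close> in t; the sign of
    \<open>s\<close> selects the lower or the upper face of the box.\<close>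
  let ?d = "\<lambda>s k t. s ^ k * bump k (s * t)"
  have d: "(?d s k has_real_derivative ?d s (Suc k) t) (at t)" for s k t
    using DERIV_cmult[OF DERIV_chain'[of "(*) s" s t UNIV "bump k" "bump (Suc k) (s * t)"], of "s ^ k"] bump_deriv[of k "s * t"]
    by (auto intro!: derivative_eq_intros simp: mult_ac)
  have "(\<lambda>x. bump 0 (s * (x \<bullet> i + c))) \<in> smooth_funs" for s c and i :: 'a
    using smooth_funs_ridge[of "?d s" 0 i c, OF d] by simp
  from this[of "real (Suc n)" _ "- (a \<bullet> _)"] this[of "- real (Suc n)" _ "- (b \<bullet> _)"]
  have "(\<lambda>x. bump 0 (real (Suc n) * (x \<bullet> i - a \<bullet> i))) \<in> smooth_funs"
       "(\<lambda>x. bump 0 (real (Suc n) * (b \<bullet> i - x \<bullet> i))) \<in> smooth_funs" for i :: 'a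
    by (auto simp: algebra_simps)
  then show ?thesis
    unfolding box_fun_def[abs_def] by (intro smooth_funs_prod smooth_funs_mult) auto
qed

lemma box_fun_bounds: "0 \<le> box_fun a b n x" "box_fun a b n x \<le> 1"
  unfolding box_fun_def by (auto intro!: prod_nonneg prod_le_1 mult_le_one bump_0_bounds mult_nonneg_nonneg)

lemma box_fun_support: "{x. box_fun a b n x \<noteq> 0} \<subseteq> box a b"
  by (auto simp: box_fun_def mem_box bump_0 zero_less_mult_iff split: if_splits)

lemma box_fun_tendsto: "(\<lambda>n. box_fun a b n x) \<longlonglongrightarrow> indicator (box a b) x"
proof (cases "x \<in> box a b")
  case True
  have "(\<lambda>n. bump 0 (real (Suc n) * s)) \<longlonglongrightarrow> 1" if "s > 0" for s
  proof -
    have "(\<lambda>n. exp (- (inverse (real (Suc n)) * inverse s))) \<longlonglongrightarrow> exp (- (0 * inverse s))"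
      by (intro tendsto_intros LIMSEQ_inverse_real_of_nat)
    then show ?thesis using that by (simp add: bump_0 zero_less_mult_iff inverse_mult_distrib)
  qed
  then have "(\<lambda>n. box_fun a b n x) \<longlonglongrightarrow> (\<Prod>i\<in>(Basis::'a set). 1 * 1)"
    unfolding box_fun_def using True
    by (intro tendsto_prod tendsto_mult) (auto simp: mem_box)
  then show ?thesis using True by simp
next
  case False
  then have "box_fun a b n x = 0" for n using box_fun_support[of a b n] by auto
  then show ?thesis using False by simp
qed

section \<open>Weak gradients as upper gradients along segments\<close>

lemma nn_integral_lborel_translate:
  fixes h :: "'a::euclidean_space"
  assumes [measurable]: "f \<in> borel_measurable borel"
  shows "(\<integral>\<^sup>+x. f (x + h) \<partial>lborel) = (\<integral>\<^sup>+x. f x \<partial>lborel)"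
proof -
  have "(\<integral>\<^sup>+x. f x \<partial>lborel) = (\<integral>\<^sup>+x. f x \<partial>distr lborel borel ((+) h))"
    by (simp add: lborel_distr_plus)
  then show ?thesis by (simp add: nn_integral_distr add.commute)
qed

lemma integral_lborel_translate:
  fixes h :: "'a::euclidean_space" and f :: "'a \<Rightarrow> 'b::{banach, second_countable_topology}"
  assumes [measurable]: "f \<in> borel_measurable borel"
  shows "(\<integral>x. f (x + h) \<partial>lborel) = (\<integral>x. f x \<partial>lborel)"
proof -
  have "(\<integral>x. f x \<partial>lborel) = (\<integral>x. f x \<partial>distr lborel borel ((+) h))"
    by (simp add: lborel_distr_plus)
  then show ?thesis by (simp add: integral_distr add.commute)
qed

lemma integrable_lborel_translate:
  fixes h :: "'a::euclidean_space" and f :: "'a \<Rightarrow> 'b::{banach, second_countable_topology}"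
  assumes "integrable lborel f"
  shows "integrable lborel (\<lambda>x. f (x + h))"
proof -
  have "integrable (distr lborel borel ((+) h)) f"
    using assms by (simp add: lborel_distr_plus)
  then show ?thesis using assms by (simp add: integrable_distr_eq add.commute)
qed

text \<open>Open boxes are closed under intersection and generate the Borel sets, and the sets over
  which the integral vanishes form a Dynkin system. So the integral vanishes over every Borel set,
  which forces the integrand to vanish almost everywhere.\<close>

lemma zero_on_boxes_AE:
  fixes f :: "'a::euclidean_space \<Rightarrow> real"
  assumes int: "integrable lborel (\<lambda>x. indicator (box a b) x * f x)"
    and zero: "\<And>c d. box c d \<subseteq> box a b \<Longrightarrow> (\<integral>x. indicator (box c d) x * f x \<partial>lborel) = 0"
  shows "AE x in lborel. x \<in> box a b \<longrightarrow> f x = 0"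
proof -
  let ?f = "\<lambda>x. indicator (box a b) x * f x"
  have int_A: "integrable lborel (\<lambda>x. indicator A x * ?f x)" if "A \<in> sets borel" for A
    using integrable_mult_indicator[OF _ int, of A] that by simp
  have "set_lebesgue_integral lborel A ?f = 0" if "A \<in> sets lborel" for A
  proof -
    have sig: "A \<in> sigma_sets UNIV (range (\<lambda>(a, b). box a b :: 'a set))"
      using that unfolding sets_lborel borel_eq_box by simp
    have "Int_stable (range (\<lambda>(a, b). box a b :: 'a set))"
      by (auto simp: Int_stable_def box_Int_box)
    moreover have "range (\<lambda>(a, b). box a b :: 'a set) \<subseteq> Pow UNIV" by simp
    moreover note sig
    ultimately have "(\<integral>x. indicator A x * ?f x \<partial>lborel) = 0"
    proof (induction rule: sigma_sets_induct_disjoint)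
      case (basic A)
      then obtain c d where A: "A = box c d" by auto
      obtain c' d' where cd: "box c d \<inter> box a b = box c' d'"
        by (auto simp: box_Int_box)
      have "(\<lambda>x. indicator A x * ?f x) = (\<lambda>x. indicator (box c' d') x * f x)"
        by (auto simp: A fun_eq_iff cd[symmetric] indicator_inter_arith)
      then show ?case using zero[of c' d'] cd by auto
    next
      case empty then show ?case by simp
    next
      case (compl A)
      then have A: "A \<in> sets borel" by (simp add: borel_eq_box)
      have "(\<lambda>x. indicator (UNIV - A) x * ?f x) = (\<lambda>x. ?f x - indicator A x * ?f x)"
        by (auto simp: fun_eq_iff indicator_def)
      then show ?case
        using compl int_A[OF A] int zero[of a b] by simp
    next
      case (union A)
      then have A: "\<And>i. A i \<in> sets borel" by (auto simp: borel_eq_box)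
      then have UA: "(\<Union>i. A i) \<in> sets borel" by auto
      have "(LINT x:(\<Union>i. A i)|lborel. ?f x) = (\<Sum>i. (LINT x:(A i)|lborel. ?f x))"
        using A int_A[OF UA] union(1)
        by (intro lebesgue_integral_countable_add) (auto simp: set_integrable_def disjoint_family_on_def)
      then show ?case using union by (simp add: set_lebesgue_integral_def)
    qed
    then show ?thesis by (simp add: set_lebesgue_integral_def)
  qed
  then have "AE x in lborel. ?f x = 0"
    by (intro sigma_finite_measure.density_zero[OF sigma_finite_lborel int]) auto
  then   show ?thesis by eventually_elim auto
qed

text \<open>The functions of the theorem are only Lebesgue measurable, while Fubini and translation
  are used for \<open>lborel\<close>. Exhausting \<open>U\<close> by compact sets makes the cut-off
  function measurable; a Borel version is then chosen for each coordinate and set to 0 outside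
  \<open>U\<close>, so that it can be integrated over the whole space.\<close>

lemma borel_representative:
  fixes f :: "'a::euclidean_space \<Rightarrow> 'b::euclidean_space"
  assumes "open U" "L1loc U f"
  obtains f0 where "f0 \<in> borel_measurable borel" "AE x in lborel. x \<in> U \<longrightarrow> f x = f0 x"
    "\<And>x. x \<notin> U \<Longrightarrow> f0 x = 0"
    "\<And>K. compact K \<Longrightarrow> K \<subseteq> U \<Longrightarrow> integrable lborel (\<lambda>x. indicator K x *\<^sub>R f0 x)"
    "(\<lambda>x. indicator U x *\<^sub>R f x) \<in> borel_measurable lebesgue"
proof -
  obtain K where K: "\<And>n. compact (K n)" "\<And>n. K n \<subseteq> U" "\<And>n. K n \<subseteq> K (Suc n)" "\<Union>(range K) = U"
    using open_Union_compact_subsets[OF assms(1)] by (smt (verit, ccfv_threshold) interior_subset subset_trans)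
  have mono: "K n \<subseteq> K m" if "n \<le> m" for n m using lift_Suc_mono_le[of K, OF K(3) that] .
  have Kf: "integrable lebesgue (\<lambda>x. indicator L x *\<^sub>R f x)" if "compact L" "L \<subseteq> U" for L
    using assms(2) that unfolding L1loc_def
    by (subst integrable_restrict_space[symmetric]) (auto simp: compact_imp_closed)
  have Uf: "(\<lambda>x. indicator U x *\<^sub>R f x) \<in> borel_measurable lebesgue"
  proof (rule borel_measurable_LIMSEQ_metric)
    show "(\<lambda>x. indicator (K n) x *\<^sub>R f x) \<in> borel_measurable lebesgue" for n
      using Kf[OF K(1,2)] by auto
    show "(\<lambda>n. indicator (K n) x *\<^sub>R f x) \<longlonglongrightarrow> indicator U x *\<^sub>R f x" for x
    proof (cases "x \<in> U")
      case True
      then obtain N where "x \<in> K N" using K(4) by auto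
      then have "\<forall>n\<ge>N. x \<in> K n" using mono by auto
      then show ?thesis using True
        by (intro tendsto_eventually) (auto simp: eventually_sequentially intro!: exI[of _ N])
    next
      case False
      then have "x \<notin> K n" for n using K(2) by auto
      then show ?thesis using False by simp
    qed
  qed
  have "\<forall>b. \<exists>g. g \<in> borel_measurable lborel \<and> (AE x in lborel. (indicator U x *\<^sub>R f x) \<bullet> b = g x)"
    unfolding Bex_def[symmetric]
    by (intro allI completion_ex_borel_measurable_real borel_measurable_inner Uf borel_measurable_const)
  from choice[OF this] obtain g where g[measurable]: "\<And>b. g b \<in> borel_measurable borel"
    and gae: "\<And>b. AE x in lborel. (indicator U x *\<^sub>R f x) \<bullet> b = g b x"
    by auto
  define f0 where "f0 x = indicator U x *\<^sub>R (\<Sum>b\<in>Basis. g b x *\<^sub>R b)" for x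
  have [measurable]: "U \<in> sets borel" using assms(1) by auto
  have m: "f0 \<in> borel_measurable borel" unfolding f0_def by measurable
  have "AE x in lborel. \<forall>b\<in>Basis. (indicator U x *\<^sub>R f x) \<bullet> b = g b x"
    by (intro AE_finite_allI gae) auto
  then have ae: "AE x in lborel. x \<in> U \<longrightarrow> f x = f0 x"
  proof eventually_elim
    case (elim x)
    have "f x = (\<Sum>b\<in>Basis. (f x \<bullet> b) *\<^sub>R b)" by (simp add: euclidean_representation)
    also have "x \<in> U \<Longrightarrow> \<dots> = f0 x"
      unfolding f0_def using elim by (auto intro!: sum.cong)
    finally show ?case by simp
  qed
  show ?thesis
  proof (rule that[OF m ae _ _ Uf])
    show "f0 x = 0" if "x \<notin> U" for x using that by (simp add: f0_def)
    fix L assume L: "compact L" "L \<subseteq> U"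
    then have [measurable]: "L \<in> sets borel" by (auto simp: compact_imp_closed)
    have ae': "AE x in lebesgue. indicator L x *\<^sub>R f x = indicator L x *\<^sub>R f0 x"
      using AE_completion[OF ae] by eventually_elim (use L in \<open>auto simp: indicator_def\<close>)
    have "integrable lebesgue (\<lambda>x. indicator L x *\<^sub>R f0 x)"
      by (rule integrable_cong_AE_imp[OF Kf[OF L] _ AE_mp[OF ae' AE_I2]])
        (use m in \<open>auto intro!: measurable_completion\<close>)
    then show "integrable lborel (\<lambda>x. indicator L x *\<^sub>R f0 x)"
      by (subst (asm) integrable_completion) (use m in simp_all)
  qed
qed

section \<open>Testing the weak gradient against translated cutoffs\<close>

lemma smooth_funs_continuous: "f \<in> smooth_funs \<Longrightarrow> continuous_on S f"
  using smooth_funs_deriv by (metis differentiable_at_withinI differentiable_imp_continuous_on differentiable_on_def)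

lemma smooth_funs_FTC:
  assumes f: "f \<in> smooth_funs"
  shows "f y - f (y - h) = (\<integral>t. indicator {0..1} t * frechet_derivative f (at (y - t *\<^sub>R h)) h \<partial>lborel)"
proof -
  let ?D = "\<lambda>x. frechet_derivative f (at x) h"
  have "continuous_on UNIV ?D" using smooth_funs_deriv[OF f] smooth_funs_continuous by blast
  then have cD: "continuous_on UNIV (\<lambda>t. ?D (y - t *\<^sub>R h))"
    by (rule continuous_on_compose2) (auto intro!: continuous_intros)
  have "((\<lambda>t. - f (y - t *\<^sub>R h)) has_real_derivative ?D (y - t *\<^sub>R h)) (at t)" for t
  proof -
    have 1: "((\<lambda>t. y - t *\<^sub>R h) has_derivative (\<lambda>s. - (s *\<^sub>R h))) (at t)"
      by (auto intro!: derivative_eq_intros)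
    have 2: "(f has_derivative frechet_derivative f (at (y - t *\<^sub>R h))) (at (y - t *\<^sub>R h))"
      using smooth_funs_deriv[OF f] frechet_derivative_works by blast
    from has_derivative_minus[OF has_derivative_compose[OF 1 2]] linear_frechet_derivative[of f "at (y - t *\<^sub>R h)"]
    show ?thesis using smooth_funs_deriv[OF f]
      by (simp add: has_field_derivative_def linear_cmul linear_neg mult.commute[of _ "?D _"])
  qed
  from integral_FTC_Icc_real[of 0 1, OF _ this]
  have "(\<integral>t. ?D (y - t *\<^sub>R h) * indicator {0..1} t \<partial>lborel) = f y - f (y - h)"
    using cD by (simp add: continuous_on_eq_continuous_at)
  then show ?thesis by (simp add: mult.commute)
qed

lemma integrable_pair_unit_interval:
  fixes F :: "real \<times> 'a::euclidean_space \<Rightarrow> real"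
  assumes [measurable]: "F \<in> borel_measurable (lborel \<Otimes>\<^sub>M lborel)"
    and C: "\<And>t. (\<integral>\<^sup>+x. ennreal \<bar>F (t, x)\<bar> \<partial>lborel) \<le> indicator {0..1} t * ennreal C"
  shows "integrable (lborel \<Otimes>\<^sub>M lborel) F"
proof (rule integrableI_bounded)
  have "(\<integral>\<^sup>+ p. norm (F p) \<partial>(lborel \<Otimes>\<^sub>M lborel)) = (\<integral>\<^sup>+ t. (\<integral>\<^sup>+ x. norm (F (t, x)) \<partial>lborel) \<partial>lborel)"
    by (simp add: lborel.nn_integral_fst [symmetric])
  also have "\<dots> \<le> (\<integral>\<^sup>+ t. indicator {0..1} t * ennreal C \<partial>(lborel :: real measure))"
    using C by (intro nn_integral_mono) simp
  also have "\<dots> < \<infinity>" by (simp add: nn_integral_multc ennreal_mult_less_top)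
  finally show "(\<integral>\<^sup>+ p. norm (F p) \<partial>(lborel \<Otimes>\<^sub>M lborel)) < \<infinity>" .
qed fact

text \<open>Prepares the interchange of the integrals over t and over space on both sides of the
  shift identity. For fixed t the two integrands are translates of each other, and both are
  dominated by \<open>M\<close> times an integrable function on \<open>K\<close>, because points of
  the support \<open>Q\<close> stay in \<open>K\<close> along the whole segment.\<close>

lemma
  fixes w A :: "'a::euclidean_space \<Rightarrow> real"
  assumes [measurable]: "w \<in> borel_measurable borel" "A \<in> borel_measurable borel" "K \<in> sets borel"
    and w: "integrable lborel (\<lambda>x. indicator K x * w x)"
    and A: "\<And>x. \<bar>A x\<bar> \<le> M" "\<And>x. A x \<noteq> 0 \<Longrightarrow> x \<in> Q"
    and K: "\<And>x t. x \<in> Q \<Longrightarrow> 0 \<le> t \<Longrightarrow> t \<le> 1 \<Longrightarrow> x + t *\<^sub>R h \<in> K"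
  shows integrable_pair_shift1:
     "integrable (lborel \<Otimes>\<^sub>M lborel) (\<lambda>(t, y). indicator {0..1} t * (w y * A (y - t *\<^sub>R h)))"
   and integrable_pair_shift2:
     "integrable (lborel \<Otimes>\<^sub>M lborel) (\<lambda>(t, x). indicator {0..1} t * (A x * w (x + t *\<^sub>R h)))"
proof -
  have M: "M \<ge> 0" using A(1)[of undefined] by linarith
  define C where "C = M * (\<integral>x. \<bar>indicator K x * w x\<bar> \<partial>lborel)"
  have C: "(\<integral>\<^sup>+ y. ennreal M * ennreal \<bar>indicator K y * w y\<bar> \<partial>lborel) = ennreal C"
    unfolding C_def
    by (subst nn_integral_cmult; (subst nn_integral_eq_integral)?)
       (use w M in \<open>auto simp: ennreal_mult intro!: integrable_abs\<close>)
  have b: "\<bar>A x * w (x + t *\<^sub>R h)\<bar> \<le> M * \<bar>indicator K (x + t *\<^sub>R h) * w (x + t *\<^sub>R h)\<bar>"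
    if "0 \<le> t" "t \<le> 1" for t x
  proof (cases "x \<in> Q")
    case True
    then show ?thesis using K[OF True that] A(1)[of x] by (auto simp: abs_mult intro: mult_right_mono)
  next
    case False
    then have "A x = 0" using A(2)[of x] by auto
    then show ?thesis using M by simp
  qed
  have *: "(\<integral>\<^sup>+y. ennreal \<bar>indicator {0..1} t * (w y * A (y - t *\<^sub>R h))\<bar> \<partial>lborel) \<le> indicator {0..1} t * ennreal C" for t
  proof (cases "t \<in> {0..1}")
    case True
    have "(\<integral>\<^sup>+y. ennreal \<bar>indicator {0..1} t * (w y * A (y - t *\<^sub>R h))\<bar> \<partial>lborel) \<le>
       (\<integral>\<^sup>+ y. ennreal M * ennreal \<bar>indicator K y * w y\<bar> \<partial>lborel)"
      using b[of t "_ - t *\<^sub>R h"] True M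
      by (intro nn_integral_mono) (auto simp: ennreal_mult'[symmetric] mult.commute intro!: ennreal_leI)
    then show ?thesis using C True by simp
  qed auto
  show "integrable (lborel \<Otimes>\<^sub>M lborel) (\<lambda>(t, y). indicator {0..1} t * (w y * A (y - t *\<^sub>R h)))"
    by (rule integrable_pair_unit_interval) (use * in auto)
  have "(\<integral>\<^sup>+x. ennreal \<bar>indicator {0..1} t * (A x * w (x + t *\<^sub>R h))\<bar> \<partial>lborel) =
     (\<integral>\<^sup>+y. ennreal \<bar>indicator {0..1} t * (w y * A (y - t *\<^sub>R h))\<bar> \<partial>lborel)" for t
    by (subst nn_integral_lborel_translate[of _ "t *\<^sub>R h", symmetric]) (auto simp: mult.commute)
  then show "integrable (lborel \<Otimes>\<^sub>M lborel) (\<lambda>(t, x). indicator {0..1} t * (A x * w (x + t *\<^sub>R h)))"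
    by (intro integrable_pair_unit_interval) (use * in auto)
qed

lemma frechet_derivative_translate:
  assumes "f \<in> smooth_funs"
  shows "frechet_derivative (\<lambda>x. f (x - c)) (at y) = frechet_derivative f (at (y - c))"
proof (rule frechet_derivative_at[symmetric])
  have 1: "((\<lambda>y. y - c) has_derivative (\<lambda>s. s)) (at y)" by (auto intro!: derivative_eq_intros)
  have 2: "(f has_derivative frechet_derivative f (at (y - c))) (at (y - c))"
    using smooth_funs_deriv[OF assms] frechet_derivative_works by blast
  show "((\<lambda>x. f (x - c)) has_derivative frechet_derivative f (at (y - c))) (at y)"
    using has_derivative_compose[OF 1 2] by simp
qed

lemma frechet_derivative_support:
  assumes "{x. f x \<noteq> 0} \<subseteq> Q" "closed Q" "x \<notin> Q"
  shows "frechet_derivative f (at x) v = (0::real)"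
proof -
  have "((\<lambda>x. 0) has_derivative (\<lambda>v. 0)) (at x)" by simp
  then have "(f has_derivative (\<lambda>v. 0)) (at x)"
    by (rule has_derivative_transform_within_open[OF _ open_Compl[OF assms(2)]]) (use assms in auto)
  then show ?thesis by (simp add: frechet_derivative_at[symmetric])
qed

text \<open>Moves the shift from \<open>u\<close> to the test function: f(y) - f(y - h) is the
  integral over t of the derivative along h of a translate of \<open>f\<close>. Each translate is an
  admissible test function, because its support moves along segments that stay in \<open>U\<close>.
  Integrating by parts and translating back leaves the integral of G . h along the segment.\<close>

lemma weak_shift_identity:
  fixes u :: "'a::euclidean_space \<Rightarrow> real" and G :: "'a \<Rightarrow> 'a"
  assumes [measurable]: "u \<in> borel_measurable borel" "G \<in> borel_measurable borel"
    and int_u: "\<And>K. compact K \<Longrightarrow> K \<subseteq> U \<Longrightarrow> integrable lborel (\<lambda>x. indicator K x *\<^sub>R u x)"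
    and int_G: "\<And>K. compact K \<Longrightarrow> K \<subseteq> U \<Longrightarrow> integrable lborel (\<lambda>x. indicator K x *\<^sub>R G x)"
    and weak: "\<And>\<psi> v. test_fun U \<psi> \<Longrightarrow>
       (\<integral>x. u x * frechet_derivative \<psi> (at x) v \<partial>lborel) = - (\<integral>x. \<psi> x * (G x \<bullet> v) \<partial>lborel)"
    and f: "f \<in> smooth_funs" "{x. f x \<noteq> 0} \<subseteq> Q" and Q: "compact Q"
    and QU: "\<And>x t. x \<in> Q \<Longrightarrow> 0 \<le> t \<Longrightarrow> t \<le> 1 \<Longrightarrow> x + t *\<^sub>R h \<in> U"
  shows "(\<integral>x. f x * (u (x + h) - u x) \<partial>lborel) =
      (\<integral>x. f x * (\<integral>t. indicator {0..1} t * (G (x + t *\<^sub>R h) \<bullet> h) \<partial>lborel) \<partial>lborel)"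
proof -
  let ?D = "\<lambda>x. frechet_derivative f (at x) h"
  define K where "K = (\<lambda>(t, x). x + t *\<^sub>R h) ` ({0..1} \<times> Q)"
  have K: "compact K" unfolding K_def split_def
    by (intro compact_continuous_image compact_Times Q) (auto intro!: continuous_intros)
  have KU: "K \<subseteq> U" unfolding K_def using QU by auto
  have QK: "x + t *\<^sub>R h \<in> K" if "x \<in> Q" "0 \<le> t" "t \<le> 1" for x t
    using that unfolding K_def by force
  have [measurable]: "K \<in> sets borel" "Q \<in> sets borel" using K Q by (auto simp: compact_imp_closed)
  have cf: "continuous_on UNIV f" and cD: "continuous_on UNIV ?D"
    using smooth_funs_deriv[OF f(1)] smooth_funs_continuous f(1) by blast+
  then have [measurable]: "f \<in> borel_measurable borel" "?D \<in> borel_measurable borel"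
    by (auto intro: borel_measurable_continuous_onI)
  have supp: "x \<in> Q" if "f x \<noteq> 0" for x using f that by auto
  have suppD: "x \<in> Q" if "?D x \<noteq> 0" for x
    using frechet_derivative_support[OF f(2) compact_imp_closed[OF Q]] that by blast
  have bd: "\<exists>M. \<forall>x. \<bar>g x\<bar> \<le> M" if "continuous_on UNIV g" "\<And>x. g x \<noteq> 0 \<Longrightarrow> x \<in> Q" for g :: "'a \<Rightarrow> real"
  proof -
    have "bounded (g ` Q)" using Q that(1)
      by (meson compact_continuous_image compact_imp_bounded continuous_on_subset subset_UNIV)
    then obtain M where "\<And>x. x \<in> Q \<Longrightarrow> \<bar>g x\<bar> \<le> M" unfolding bounded_iff by auto
    then have "\<bar>g x\<bar> \<le> max M 0" for x using that(2)[of x] by (cases "g x = 0") (auto simp: le_max_iff_disj)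
    then show ?thesis by blast
  qed
  obtain M1 where M1: "\<And>x. \<bar>f x\<bar> \<le> M1" using bd[OF cf supp] by blast
  obtain M2 where M2: "\<And>x. \<bar>?D x\<bar> \<le> M2" using bd[OF cD suppD] by blast
  have iu: "integrable lborel (\<lambda>x. indicator K x * u x)" using int_u[OF K KU] by simp
  have iG: "integrable lborel (\<lambda>x. indicator K x * (G x \<bullet> h))"
    using integrable_inner_left[OF int_G[OF K KU], of h] by simp
  have int1: "integrable lborel (\<lambda>x. f x * u (x + t *\<^sub>R h))" if t: "0 \<le> t" "t \<le> 1" for t
  proof -
    have "integrable lborel (\<lambda>x. M1 * \<bar>indicator K (x + t *\<^sub>R h) * u (x + t *\<^sub>R h)\<bar>)"
      using integrable_lborel_translate[OF iu] by (intro integrable_mult_right integrable_abs)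
    then show ?thesis
    proof (rule Bochner_Integration.integrable_bound)
      have "\<bar>f x * u (x + t *\<^sub>R h)\<bar> \<le> M1 * \<bar>indicator K (x + t *\<^sub>R h) * u (x + t *\<^sub>R h)\<bar>" for x
        using M1[of x] QK[of x t] supp[of x] t by (cases "f x = 0") (auto simp: abs_mult intro!: mult_right_mono mult_nonneg_nonneg)
      then show "AE x in lborel. norm (f x * u (x + t *\<^sub>R h)) \<le> norm (M1 * \<bar>indicator K (x + t *\<^sub>R h) * u (x + t *\<^sub>R h)\<bar>)"
        using abs_ge_self order_trans by (fastforce intro!: AE_I2)
    qed simp
  qed
  have "(\<integral>x. f x * (u (x + h) - u x) \<partial>lborel) = (\<integral>x. f x * u (x + h) \<partial>lborel) - (\<integral>x. f x * u x \<partial>lborel)"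
    using int1[of 0] int1[of 1] by (simp add: right_diff_distrib)
  also have "(\<integral>x. f x * u (x + h) \<partial>lborel) = (\<integral>x. f (x - h) * u x \<partial>lborel)"
    by (subst integral_lborel_translate[of _ "h", symmetric]) auto
  also have "\<dots> - (\<integral>x. f x * u x \<partial>lborel) = (\<integral>x. f (x - h) * u x - f x * u x \<partial>lborel)"
    using int1[of 0] integrable_lborel_translate[OF int1[of 1], of "-h"]
    by (subst Bochner_Integration.integral_diff) auto
  also have "\<dots> = - (\<integral>y. u y * (f y - f (y - h)) \<partial>lborel)"
    by (subst Bochner_Integration.integral_minus[symmetric]) (auto simp: algebra_simps intro!: Bochner_Integration.integral_cong)
  also have "(\<integral>y. u y * (f y - f (y - h)) \<partial>lborel) =
     (\<integral>y. (\<integral>t. indicator {0..1} t * (u y * ?D (y - t *\<^sub>R h)) \<partial>lborel) \<partial>lborel)"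
    unfolding smooth_funs_FTC[OF f(1)]
    by (subst integral_mult_right_zero[symmetric]) (auto simp: mult_ac intro!: Bochner_Integration.integral_cong)
  also have "\<dots> = (\<integral>t. (\<integral>y. indicator {0..1} t * (u y * ?D (y - t *\<^sub>R h)) \<partial>lborel) \<partial>lborel)"
    by (rule lborel_pair.Fubini_integral) (rule integrable_pair_shift1[where A="?D" and K=K and M=M2 and Q=Q]; use iu M2 suppD QK in simp)
  also have "- \<dots> = (\<integral>t. (\<integral>x. indicator {0..1} t * (f x * (G (x + t *\<^sub>R h) \<bullet> h)) \<partial>lborel) \<partial>lborel)"
  proof (subst Bochner_Integration.integral_minus[symmetric], rule Bochner_Integration.integral_cong[OF refl])
    fix t :: real
    show "- (\<integral>y. indicator {0..1} t * (u y * ?D (y - t *\<^sub>R h)) \<partial>lborel) =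
       (\<integral>x. indicator {0..1} t * (f x * (G (x + t *\<^sub>R h) \<bullet> h)) \<partial>lborel)"
    proof (cases "t \<in> {0..1}")
      case True
      let ?\<psi> = "\<lambda>y. f (y - t *\<^sub>R h)"
      have "{y. ?\<psi> y \<noteq> 0} \<subseteq> (\<lambda>x. x + t *\<^sub>R h) ` Q"
        using supp by (force simp: image_iff)
      moreover have cQ: "compact ((\<lambda>x. x + t *\<^sub>R h) ` Q)"
        by (intro compact_continuous_image Q continuous_intros)
      ultimately have cl: "closure {y. ?\<psi> y \<noteq> 0} \<subseteq> (\<lambda>x. x + t *\<^sub>R h) ` Q"
        by (simp add: closure_minimal compact_imp_closed)
      have "test_fun U ?\<psi>"
        unfolding test_fun_def
        using smooth_funs_smooth_on[OF smooth_funs_translate[OF f(1)]] compact_Int_closed[OF cQ closed_closure, of "{y. ?\<psi> y \<noteq> 0}"] cl QU True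
        by (auto simp: Int_absorb1)
      from weak[OF this, of h] have "- (\<integral>y. u y * ?D (y - t *\<^sub>R h) \<partial>lborel) = (\<integral>y. ?\<psi> y * (G y \<bullet> h) \<partial>lborel)"
        by (simp add: frechet_derivative_translate[OF f(1)])
      also have "\<dots> = (\<integral>x. f x * (G (x + t *\<^sub>R h) \<bullet> h) \<partial>lborel)"
        by (subst integral_lborel_translate[of _ "t *\<^sub>R h", symmetric]) auto
      finally show ?thesis using True by simp
    qed simp
  qed
  also have "\<dots> = (\<integral>x. (\<integral>t. indicator {0..1} t * (f x * (G (x + t *\<^sub>R h) \<bullet> h)) \<partial>lborel) \<partial>lborel)"
    by (rule lborel_pair.Fubini_integral[symmetric])
       (use integrable_pair_shift2[OF _ _ _ iG M1 supp QK] in simp)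
  also have "\<dots> = (\<integral>x. f x * (\<integral>t. indicator {0..1} t * (G (x + t *\<^sub>R h) \<bullet> h) \<partial>lborel) \<partial>lborel)"
    by (subst integral_mult_right_zero[symmetric]) (auto simp: mult_ac intro!: Bochner_Integration.integral_cong)
  finally show ?thesis .
qed

text \<open>The exceptional null set may depend on \<open>h\<close>, which suffices because
  integrals over x are always taken for a fixed shift. The right side is a nonnegative integral and
  may be infinite, so integrability along segments is not part of the notion.\<close>

definition upper_gradient :: "'a::euclidean_space set \<Rightarrow> ('a \<Rightarrow> real) \<Rightarrow> ('a \<Rightarrow> real) \<Rightarrow> bool" where
  "upper_gradient U u g \<longleftrightarrow> u \<in> borel_measurable borel \<and> g \<in> borel_measurable borel \<and> (\<forall>x. 0 \<le> g x) \<and>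
     (\<forall>h. AE x in lborel. (\<forall>t\<in>{0..1}. x + t *\<^sub>R h \<in> U) \<longrightarrow>
        ennreal \<bar>u (x + h) - u x\<bar> \<le> (\<integral>\<^sup>+t\<in>{0..1}. ennreal (norm h * g (x + t *\<^sub>R h)) \<partial>lborel))"

text \<open>The complement is the sum of the closed set \<open>- U\<close> and the compact segment
  of the points - t h, hence closed.\<close>

lemma open_segment_set:
  fixes U :: "'a::euclidean_space set"
  assumes "open U"
  shows "open {x. \<forall>t\<in>{0..1}. x + t *\<^sub>R h \<in> U}"
proof -
  have "- {x. \<forall>t\<in>{0..1}. x + t *\<^sub>R h \<in> U} = (\<Union>y\<in>-U. \<Union>s\<in>(\<lambda>t. - (t *\<^sub>R h)) ` {0..1}. {y + s})"
    (is "?L = ?R")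
  proof (intro set_eqI iffI)
    fix x assume "x \<in> ?L"
    then obtain t where "t \<in> {0..1}" "x + t *\<^sub>R h \<in> - U" by auto
    then show "x \<in> ?R" by (intro UN_I[of "x + t *\<^sub>R h"] UN_I[of "- (t *\<^sub>R h)"]) auto
  qed (auto intro: bexI[rotated])
  moreover have "closed ?R"
    using assms by (intro closed_compact_sums compact_continuous_image continuous_intros) auto
  ultimately show ?thesis by (simp add: open_closed)
qed

lemma norm_mult_le_indicator:
  fixes w y :: real
  assumes "0 \<le> w" "w \<le> 1" "w \<noteq> 0 \<Longrightarrow> x \<in> Q"
  shows "norm (w * y) \<le> norm (indicator Q x * y)"
proof (cases "x \<in> Q")
  case True
  then show ?thesis using assms(1,2) by (simp add: abs_mult mult_left_le_one_le)
next
  case False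
  then show ?thesis using assms(3) by auto
qed

text \<open>The identity holds against the cutoffs of every small box and, by dominated convergence,
  against its indicator, so the difference of the two sides vanishes almost everywhere there.
  Countably many boxes cover the open set of admissible x.\<close>

lemma weak_shift_AE:
  fixes u :: "'a::euclidean_space \<Rightarrow> real" and G :: "'a \<Rightarrow> 'a"
  assumes U: "open U" and [measurable]: "u \<in> borel_measurable borel" "G \<in> borel_measurable borel"
    and int_u: "\<And>K. compact K \<Longrightarrow> K \<subseteq> U \<Longrightarrow> integrable lborel (\<lambda>x. indicator K x *\<^sub>R u x)"
    and int_G: "\<And>K. compact K \<Longrightarrow> K \<subseteq> U \<Longrightarrow> integrable lborel (\<lambda>x. indicator K x *\<^sub>R G x)"
    and weak: "\<And>\<psi> v. test_fun U \<psi> \<Longrightarrow>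
       (\<integral>x. u x * frechet_derivative \<psi> (at x) v \<partial>lborel) = - (\<integral>x. \<psi> x * (G x \<bullet> v) \<partial>lborel)"
  shows "AE x in lborel. (\<forall>t\<in>{0..1}. x + t *\<^sub>R h \<in> U) \<longrightarrow>
     u (x + h) - u x = (\<integral>t. indicator {0..1} t * (G (x + t *\<^sub>R h) \<bullet> h) \<partial>lborel)"
proof -
  define V where "V = {x. \<forall>t\<in>{0..1}. x + t *\<^sub>R h \<in> U}"
  have V: "open V" unfolding V_def by (rule open_segment_set[OF U])
  define F where "F x = (\<integral>t. indicator {0..1} t * (G (x + t *\<^sub>R h) \<bullet> h) \<partial>lborel)" for x
  have [measurable]: "F \<in> borel_measurable borel" unfolding F_def by measurable
  define f where "f x = (u (x + h) - u x) - F x" for x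
  have [measurable]: "f \<in> borel_measurable borel" unfolding f_def by measurable
  have main: "AE x in lborel. x \<in> box a b \<longrightarrow> f x = 0" if ab: "cbox a b \<subseteq> V" for a b
  proof -
    define Q where "Q = cbox a b"
    define K where "K = (\<lambda>(t, x). x + t *\<^sub>R h) ` ({0..1} \<times> Q)"
    have Q: "compact Q" by (simp add: Q_def)
    have K: "compact K" unfolding K_def split_def
      by (intro compact_continuous_image compact_Times Q) (auto intro!: continuous_intros)
    have QU: "x + t *\<^sub>R h \<in> U" if "x \<in> Q" "0 \<le> t" "t \<le> 1" for x t
      using that ab unfolding Q_def V_def by auto
    then have KU: "K \<subseteq> U" unfolding K_def by auto
    have QK: "x + t *\<^sub>R h \<in> K" if "x \<in> Q" "0 \<le> t" "t \<le> 1" for x t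
      using that unfolding K_def by force
    have KQ[measurable]: "K \<in> sets borel" "Q \<in> sets borel" using K Q by (auto simp: compact_imp_closed)
    have iu: "integrable lborel (\<lambda>x. indicator K x * u x)" using int_u[OF K KU] by simp
    have iG: "integrable lborel (\<lambda>x. indicator K x * (G x \<bullet> h))"
      using integrable_inner_left[OF int_G[OF K KU], of h] by simp
    have iu': "integrable lborel (\<lambda>x. indicator Q x * u (x + t *\<^sub>R h))" if t: "0 \<le> t" "t \<le> 1" for t
    proof (rule Bochner_Integration.integrable_bound[OF integrable_lborel_translate[OF iu, of "t *\<^sub>R h"]])
      show "AE x in lborel. norm (indicator Q x * u (x + t *\<^sub>R h)) \<le> norm (indicator K (x + t *\<^sub>R h) * u (x + t *\<^sub>R h))"
        using QK t by (intro AE_I2) (auto simp: indicator_def)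
    qed simp
    have iF: "integrable lborel (\<lambda>x. indicator Q x * F x)"
    proof -
      have "integrable (lborel \<Otimes>\<^sub>M lborel) (\<lambda>(t, x). indicator {0..1} t * (indicator Q x * (G (x + t *\<^sub>R h) \<bullet> h)))"
        by (rule integrable_pair_shift2[where w="\<lambda>x. G x \<bullet> h" and h=h and A="indicator Q" and K=K and M=1 and Q=Q]; (use iG QK KQ in \<open>simp add: indicator_def\<close>)?; measurable?)
      from lborel_pair.integrable_snd[OF this]
      show ?thesis unfolding F_def
        by (subst integral_mult_right_zero[symmetric]) (simp add: mult_ac)
    qed
    have iQ: "integrable lborel (\<lambda>x. indicator Q x * f x)"
    proof -
      have "integrable lborel (\<lambda>x. indicator Q x * u (x + 1 *\<^sub>R h) - indicator Q x * u (x + 0 *\<^sub>R h) - indicator Q x * F x)"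
        by (intro Bochner_Integration.integrable_diff iF iu') auto
      then show ?thesis by (simp add: f_def algebra_simps)
    qed
    have sub: "integrable lborel (\<lambda>x. w x * f x)"
      if "\<And>x. 0 \<le> w x" "\<And>x. w x \<le> 1" "\<And>x. w x \<noteq> 0 \<Longrightarrow> x \<in> Q" "w \<in> borel_measurable borel" for w
    proof (rule Bochner_Integration.integrable_bound[OF iQ])
      show "AE x in lborel. norm (w x * f x) \<le> norm (indicator Q x * f x)"
      proof (intro AE_I2)
        fix x show "norm (w x * f x) \<le> norm (indicator Q x * f x)"
          by (rule norm_mult_le_indicator[OF that(1-3)])
      qed
    qed (use that in simp)
    show ?thesis
    proof (rule zero_on_boxes_AE)
      show "integrable lborel (\<lambda>x. indicator (box a b) x * f x)"
        by (rule sub) (use box_subset_cbox in \<open>auto simp: Q_def indicator_def split: if_splits\<close>)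
      fix c d assume cd: "box c d \<subseteq> box a b"
      have zero: "(\<integral>x. box_fun c d n x * f x \<partial>lborel) = 0" for n
      proof -
        let ?f = "box_fun c d n"
        have supp: "{x. ?f x \<noteq> 0} \<subseteq> Q"
          using box_fun_support[of c d n] cd box_subset_cbox[of a b] by (auto simp: Q_def)
        have [measurable]: "?f \<in> borel_measurable borel"
          by (intro borel_measurable_continuous_onI smooth_funs_continuous box_fun_smooth)
        have i1: "integrable lborel (\<lambda>x. ?f x * f x)"
          by (rule sub) (use supp box_fun_bounds in auto)
        have i2: "integrable lborel (\<lambda>x. ?f x * F x)"
        proof (rule Bochner_Integration.integrable_bound[OF iF])
          show "AE x in lborel. norm (?f x * F x) \<le> norm (indicator Q x * F x)"
          proof (intro AE_I2)
            fix x show "norm (?f x * F x) \<le> norm (indicator Q x * F x)"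
              by (rule norm_mult_le_indicator[OF box_fun_bounds]) (use supp in blast)
          qed
        qed simp
        have "(\<integral>x. ?f x * F x \<partial>lborel) = (\<integral>x. ?f x * (u (x + h) - u x) \<partial>lborel)"
          unfolding F_def
          by (rule weak_shift_identity[symmetric, OF _ _ int_u int_G weak box_fun_smooth supp Q QU]) auto
        also have "\<dots> = (\<integral>x. ?f x * f x + ?f x * F x \<partial>lborel)"
          by (simp add: f_def algebra_simps)
        also have "\<dots> = (\<integral>x. ?f x * f x \<partial>lborel) + (\<integral>x. ?f x * F x \<partial>lborel)"
          by (rule Bochner_Integration.integral_add[OF i1 i2])
        finally show ?thesis by simp
      qed
      have "(\<lambda>n. \<integral>x. box_fun c d n x * f x \<partial>lborel) \<longlonglongrightarrow> (\<integral>x. indicator (box c d) x * f x \<partial>lborel)"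
      proof (rule integral_dominated_convergence)
        show "integrable lborel (\<lambda>x. \<bar>indicator Q x * f x\<bar>)" using iQ by (rule integrable_abs)
        show "AE x in lborel. (\<lambda>n. box_fun c d n x * f x) \<longlonglongrightarrow> indicator (box c d) x * f x"
          by (intro AE_I2 tendsto_mult box_fun_tendsto tendsto_const)
        show "(\<lambda>x. box_fun c d n x * f x) \<in> borel_measurable lborel" for n
          using borel_measurable_continuous_onI[OF smooth_funs_continuous[OF box_fun_smooth, of UNIV c d n]] by simp
        have supp: "{x. box_fun c d n x \<noteq> 0} \<subseteq> Q" for n
          using box_fun_support[of c d n] cd box_subset_cbox[of a b] by (auto simp: Q_def)
        have "norm (box_fun c d n x * f x) \<le> norm (indicator Q x * f x)" for n x
          by (rule norm_mult_le_indicator[OF box_fun_bounds]) (use supp[of n] in blast)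
        then show "AE x in lborel. norm (box_fun c d n x * f x) \<le> \<bar>indicator Q x * f x\<bar>" for n
          unfolding real_norm_def by (intro AE_I2)
      qed simp
      then show "(\<integral>x. indicator (box c d) x * f x \<partial>lborel) = 0"
        by (simp add: zero LIMSEQ_const_iff)
    qed
  qed
  \<comment> \<open>Boxes whose closure lies in \<open>V\<close> keep the cutoffs compactly
    supported in \<open>V\<close>; a countable subfamily keeps the union of the exceptional sets
    null.\<close>
  define B where "B = {box a b | a b. cbox a b \<subseteq> V}"
  have "\<exists>X\<in>B. x \<in> X" if xV: "x \<in> V" for x
  proof -
    obtain e where e: "e > 0" "ball x e \<subseteq> V" using V xV open_contains_ball by metis
    obtain a b where ab: "x \<in> box a b" "box a b \<subseteq> ball x (e / 2)"
      using rational_boxes[of "e / 2" x] e(1) by auto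
    have "cbox a b = closure (box a b)" by (rule closure_box[symmetric]) (use ab(1) in auto)
    also have "\<dots> \<subseteq> closure (ball x (e / 2))" by (rule closure_mono[OF ab(2)])
    also have "\<dots> \<subseteq> ball x e" using e(1) by auto
    also note e(2)
    finally have "box a b \<in> B" unfolding B_def by auto
    then show ?thesis using ab(1) by auto
  qed
  then have VB: "V \<subseteq> \<Union>B" by auto
  have "open X" if "X \<in> B" for X using that by (auto simp: B_def)
  then obtain D where D: "D \<subseteq> B" "countable D" "\<Union>D = \<Union>B"
    using Lindelof[of B] by metis
  have "AE x in lborel. \<forall>X\<in>D. x \<in> X \<longrightarrow> f x = 0"
    unfolding AE_ball_countable[OF D(2)]
  proof
    fix X assume "X \<in> D"
    then obtain a b where "X = box a b" "cbox a b \<subseteq> V" using D(1) unfolding B_def by blast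
    then show "AE x in lborel. x \<in> X \<longrightarrow> f x = 0" using main by simp
  qed
  then show ?thesis
  proof eventually_elim
    case (elim x)
    then have "x \<in> V \<Longrightarrow> f x = 0" using VB D(3) by blast
    then show ?case by (simp add: V_def f_def F_def)
  qed
qed

lemma weak_grad_upper_gradient:
  fixes u :: "'a::euclidean_space \<Rightarrow> real"
  assumes U: "open U" and u: "L1loc U u" and uG: "weak_grad U u G"
  obtains u0 g where "upper_gradient U u0 g" "AE x in lborel. x \<in> U \<longrightarrow> u x = u0 x \<and> norm (G x) = g x"
proof -
  have G: "L1loc U G" using uG by (simp add: weak_grad_def)
  obtain u0 where [measurable]: "u0 \<in> borel_measurable borel" and u0: "AE x in lborel. x \<in> U \<longrightarrow> u x = u0 x"
    "\<And>x. x \<notin> U \<Longrightarrow> u0 x = 0"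
    "\<And>K. compact K \<Longrightarrow> K \<subseteq> U \<Longrightarrow> integrable lborel (\<lambda>x. indicator K x *\<^sub>R u0 x)"
    "(\<lambda>x. indicator U x *\<^sub>R u x) \<in> borel_measurable lebesgue"
    using borel_representative[OF U u] by blast
  obtain G0 where [measurable]: "G0 \<in> borel_measurable borel" and G0: "AE x in lborel. x \<in> U \<longrightarrow> G x = G0 x"
    "\<And>x. x \<notin> U \<Longrightarrow> G0 x = 0"
    "\<And>K. compact K \<Longrightarrow> K \<subseteq> U \<Longrightarrow> integrable lborel (\<lambda>x. indicator K x *\<^sub>R G0 x)"
    "(\<lambda>x. indicator U x *\<^sub>R G x) \<in> borel_measurable lebesgue"
    using borel_representative[OF U G] by blast
  have Uleb: "U \<inter> space lebesgue \<in> sets lebesgue" using U by auto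
  have weak: "(\<integral>x. u0 x * frechet_derivative \<psi> (at x) v \<partial>lborel) = - (\<integral>x. \<psi> x * (G0 x \<bullet> v) \<partial>lborel)"
    if \<psi>: "test_fun U \<psi>" for \<psi> v
  proof -
    have "continuous_on UNIV (iter_dd [] \<psi>)" "continuous_on UNIV (iter_dd [v] \<psi>)"
      using \<psi> unfolding test_fun_def smooth_on_def by blast+
    then have m[measurable]: "\<psi> \<in> borel_measurable borel" "(\<lambda>x. frechet_derivative \<psi> (at x) v) \<in> borel_measurable borel"
      by (auto intro: borel_measurable_continuous_onI)
    have "(\<integral>x. u x * frechet_derivative \<psi> (at x) v \<partial>lebesgue_on U) = (\<integral>x. (indicator U x *\<^sub>R u x) * frechet_derivative \<psi> (at x) v \<partial>lebesgue)"
      by (subst integral_restrict_space[OF Uleb]) (simp add: mult.assoc)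
    also have "\<dots> = (\<integral>x. u0 x * frechet_derivative \<psi> (at x) v \<partial>lebesgue)"
    proof (rule integral_cong_AE)
      show "(\<lambda>x. (indicator U x *\<^sub>R u x) * frechet_derivative \<psi> (at x) v) \<in> borel_measurable lebesgue"
        by (rule borel_measurable_times[OF u0(4)]) (auto intro!: measurable_completion)
      show "AE x in lebesgue. indicator U x *\<^sub>R u x * frechet_derivative \<psi> (at x) v = u0 x * frechet_derivative \<psi> (at x) v"
        using AE_completion[OF u0(1)] by eventually_elim (use u0(2) in \<open>auto simp: indicator_def\<close>)
    qed (auto intro!: measurable_completion)
    also have "\<dots> = (\<integral>x. u0 x * frechet_derivative \<psi> (at x) v \<partial>lborel)"
      by (rule integral_completion) simp
    finally have 1: "(\<integral>x. u x * frechet_derivative \<psi> (at x) v \<partial>lebesgue_on U) = \<dots>" .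
    have "(\<integral>x. \<psi> x * (G x \<bullet> v) \<partial>lebesgue_on U) = (\<integral>x. \<psi> x * ((indicator U x *\<^sub>R G x) \<bullet> v) \<partial>lebesgue)"
      by (subst integral_restrict_space[OF Uleb]) (simp add: mult_ac)
    also have "\<dots> = (\<integral>x. \<psi> x * (G0 x \<bullet> v) \<partial>lebesgue)"
    proof (rule integral_cong_AE)
      show "(\<lambda>x. \<psi> x * ((indicator U x *\<^sub>R G x) \<bullet> v)) \<in> borel_measurable lebesgue"
        by (intro borel_measurable_times borel_measurable_inner G0(4)) (auto intro!: measurable_completion)
      show "AE x in lebesgue. \<psi> x * ((indicator U x *\<^sub>R G x) \<bullet> v) = \<psi> x * (G0 x \<bullet> v)"
        using AE_completion[OF G0(1)] by eventually_elim (use G0(2) in \<open>auto simp: indicator_def\<close>)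
    qed (auto intro!: measurable_completion)
    also have "\<dots> = (\<integral>x. \<psi> x * (G0 x \<bullet> v) \<partial>lborel)"
      by (rule integral_completion) simp
    finally show ?thesis using 1 uG \<psi> by (simp add: weak_grad_def)
  qed
  have "upper_gradient U u0 (\<lambda>x. norm (G0 x))"
    unfolding upper_gradient_def
  proof (intro conjI allI)
    fix h
    from weak_shift_AE[OF U _ _ u0(3) G0(3) weak, of h]
    have "AE x in lborel. (\<forall>t\<in>{0..1}. x + t *\<^sub>R h \<in> U) \<longrightarrow>
      u0 (x + h) - u0 x = (\<integral>t. indicator {0..1} t * (G0 (x + t *\<^sub>R h) \<bullet> h) \<partial>lborel)" by simp
    then show "AE x in lborel. (\<forall>t\<in>{0..1}. x + t *\<^sub>R h \<in> U) \<longrightarrow>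
      ennreal \<bar>u0 (x + h) - u0 x\<bar> \<le> (\<integral>\<^sup>+t\<in>{0..1}. ennreal (norm h * norm (G0 (x + t *\<^sub>R h))) \<partial>lborel)"
    proof eventually_elim
      case (elim x)
      have "ennreal \<bar>\<integral>t. indicator {0..1} t * (G0 (x + t *\<^sub>R h) \<bullet> h) \<partial>lborel\<bar> \<le>
         (\<integral>\<^sup>+t. ennreal \<bar>indicator {0..1} t * (G0 (x + t *\<^sub>R h) \<bullet> h)\<bar> \<partial>lborel)"
      \<comment> \<open>If the integrand along the segment is not integrable, its Bochner integral
        is 0 by convention and the bound is trivial.\<close>
      proof (cases "integrable lborel (\<lambda>t. indicator {0..1} t * (G0 (x + t *\<^sub>R h) \<bullet> h))")
        case True
        then show ?thesis using integral_norm_bound_ennreal[OF True] by simp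
      next
        case False
        then show ?thesis by (simp add: not_integrable_integral_eq)
      qed
      also have "\<dots> \<le> (\<integral>\<^sup>+t\<in>{0..1}. ennreal (norm h * norm (G0 (x + t *\<^sub>R h))) \<partial>lborel)"
        by (intro nn_integral_mono)
           (auto simp: indicator_def mult.commute[of "norm h"] intro!: ennreal_leI Cauchy_Schwarz_ineq2)
      finally show ?case using elim by simp
    qed
  qed auto
  moreover have "AE x in lborel. x \<in> U \<longrightarrow> u x = u0 x \<and> norm (G x) = norm (G0 x)"
    using u0(1) G0(1) by eventually_elim auto
  ultimately show thesis by (rule that)
qed

section \<open>Shift estimates and a weighted Hardy inequality\<close>

text \<open>Convexity of a^p: its graph lies above the tangent at \<open>m\<close>. Here this is
  rearranged and read off from Young's inequality.\<close>

lemma young_tangent: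
  fixes p a m :: real
  assumes "1 < p" "0 \<le> a" "0 \<le> m"
  shows "p * m powr (p - 1) * a \<le> a powr p + (p - 1) * m powr p"
proof -
  have "a * m powr (p - 1) \<le> a powr p / p + (m powr (p - 1)) powr (p / (p - 1)) / (p / (p - 1))"
    using assms by (intro Youngs_inequality) (auto simp: field_simps)
  also have "(m powr (p - 1)) powr (p / (p - 1)) = m powr p"
    using assms by (simp add: powr_powr)
  finally show ?thesis using assms by (simp add: field_simps)
qed

text \<open>Hoelder's inequality with weight \<open>k\<close>, stated so that infinite integrals are
  allowed: the integral of \<open>g\<close> is represented by a real number \<open>a\<close> below
  it. The tangent inequality for g/k at one fixed point is multiplied by \<open>k\<close> and
  integrated.\<close>

lemma nn_integral_powr_Jensen:
  fixes g k :: "'a \<Rightarrow> real"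
  assumes p: "1 < p" and [measurable]: "g \<in> borel_measurable M" "k \<in> borel_measurable M" "A \<in> sets M"
    and g: "\<And>x. x \<in> A \<Longrightarrow> 0 \<le> g x" and k: "\<And>x. x \<in> A \<Longrightarrow> 0 < k x"
    and Z: "0 < Z" "(\<integral>\<^sup>+x\<in>A. ennreal (k x) \<partial>M) \<le> ennreal Z"
    and a: "0 \<le> a" "ennreal a \<le> (\<integral>\<^sup>+x\<in>A. ennreal (g x) \<partial>M)"
  shows "ennreal (a powr p) \<le> ennreal (Z powr (p - 1)) * (\<integral>\<^sup>+x\<in>A. ennreal (g x powr p * k x powr (1 - p)) \<partial>M)"
proof -
  let ?X = "\<integral>\<^sup>+x\<in>A. ennreal (g x powr p * k x powr (1 - p)) \<partial>M"
  \<comment> \<open>The tangent is taken at the weighted mean of g/k, with \<open>a\<close> and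
    \<open>Z\<close> standing for the integrals of \<open>g\<close> and \<open>k\<close>; this
    choice yields the factor Z^(p - 1).\<close>
  define m where "m = a / Z"
  have m: "0 \<le> m" using a Z by (simp add: m_def)
  have pt: "p * m powr (p - 1) * g x \<le> g x powr p * k x powr (1 - p) + (p - 1) * m powr p * k x" if "x \<in> A" for x
  proof -
    have "p * m powr (p - 1) * (g x / k x) * k x \<le> ((g x / k x) powr p + (p - 1) * m powr p) * k x"
      using young_tangent[OF p _ m, of "g x / k x"] g[OF that] k[OF that] by (intro mult_right_mono) auto
    moreover have "(g x / k x) powr p * k x = g x powr p * k x powr (1 - p)"
      using g[OF that] k[OF that] by (simp add: powr_divide powr_diff)
    ultimately show ?thesis using k[OF that] by (simp add: algebra_simps)
  qed
  have "ennreal (p * m powr p * Z) = ennreal (p * m powr (p - 1)) * ennreal a"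
  proof -
    have "m powr p * Z = m powr (p - 1) * a"
      using Z a by (cases "a = 0") (auto simp: m_def powr_diff)
    then show ?thesis using p a by (simp add: ennreal_mult[symmetric] mult.assoc)
  qed
  also have "\<dots> \<le> ennreal (p * m powr (p - 1)) * (\<integral>\<^sup>+x\<in>A. ennreal (g x) \<partial>M)"
    by (intro mult_left_mono a) auto
  also have "\<dots> = (\<integral>\<^sup>+x\<in>A. ennreal (p * m powr (p - 1) * g x) \<partial>M)"
    by (subst nn_integral_cmult[symmetric]) (use p g in \<open>auto intro!: nn_integral_cong simp: ennreal_mult indicator_def\<close>)
  also have "\<dots> \<le> (\<integral>\<^sup>+x. ennreal (g x powr p * k x powr (1 - p)) * indicator A x + ennreal ((p - 1) * m powr p) * (ennreal (k x) * indicator A x) \<partial>M)"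
    using pt p k by (intro nn_integral_mono)
      (auto simp: indicator_def ennreal_plus[symmetric] ennreal_mult[symmetric] less_imp_le simp del: ennreal_plus intro!: ennreal_leI)
  also have "\<dots> = ?X + ennreal ((p - 1) * m powr p) * (\<integral>\<^sup>+x\<in>A. ennreal (k x) \<partial>M)"
    by (subst nn_integral_add) (auto simp: nn_integral_cmult)
  also have "\<dots> \<le> ?X + ennreal ((p - 1) * m powr p) * ennreal Z"
    by (intro add_left_mono mult_left_mono Z) auto
  finally have *: "ennreal (p * m powr p * Z) \<le> ?X + ennreal ((p - 1) * m powr p * Z)"
    using p Z by (simp add: ennreal_mult)
  have "ennreal (m powr p * Z) \<le> ?X"
  \<comment> \<open>Cancelling (p - 1) m^p Z requires a finite integral; an infinite one makes the
    claim trivial.\<close>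
  proof (cases ?X)
    case (real r)
    then have "p * m powr p * Z \<le> r + (p - 1) * m powr p * Z"
      using * p Z by (simp add: ennreal_plus[symmetric] del: ennreal_plus)
    then show ?thesis using real by (simp add: algebra_simps ennreal_leI)
  qed auto
  then have "ennreal (Z powr (p - 1)) * ennreal (m powr p * Z) \<le> ennreal (Z powr (p - 1)) * ?X"
    by (intro mult_left_mono) auto
  moreover have "Z powr (p - 1) * (m powr p * Z) = a powr p"
    using Z a by (simp add: m_def powr_divide powr_diff)
  ultimately show ?thesis using Z by (simp add: ennreal_mult[symmetric])
qed

text \<open>General form of the Schur test. For each x the segment integral is estimated with the
  weight k(x, .) of mass at most Z(x); after Fubini and the substitution y = x + t h, what stands
  beside g(y)^p is an integral over t, bounded by \<Psi>. The choice of \<open>k\<close> decides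
  between the plain estimate and the Hardy inequality.\<close>

lemma upper_gradient_shift_kernel:
  fixes u g :: "'a::euclidean_space \<Rightarrow> real" and k :: "'a \<Rightarrow> real \<Rightarrow> real"
  assumes p: "1 < p" and ug: "upper_gradient U u g"
    and [measurable]: "W \<in> sets borel" "Z \<in> borel_measurable borel" "(\<lambda>(x, t). k x t) \<in> borel_measurable (borel \<Otimes>\<^sub>M borel)"
    and WU: "\<And>x t. x \<in> W \<Longrightarrow> 0 \<le> t \<Longrightarrow> t \<le> 1 \<Longrightarrow> x + t *\<^sub>R h \<in> U"
    and Z: "\<And>x. x \<in> W \<Longrightarrow> 0 < Z x" "\<And>x. x \<in> W \<Longrightarrow> (\<integral>\<^sup>+t\<in>{0..1}. ennreal (k x t) \<partial>lborel) \<le> ennreal (Z x)"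
    and k: "\<And>x t. x \<in> W \<Longrightarrow> 0 \<le> t \<Longrightarrow> t \<le> 1 \<Longrightarrow> 0 < k x t"
    and \<Psi>: "\<And>y. (\<integral>\<^sup>+t\<in>{0..1}. indicator W (y - t *\<^sub>R h) * ennreal (Z (y - t *\<^sub>R h) powr (p - 1) * k (y - t *\<^sub>R h) t powr (1 - p)) \<partial>lborel) \<le> \<Psi> y"
  shows "(\<integral>\<^sup>+x\<in>W. ennreal (\<bar>u (x + h) - u x\<bar> powr p) \<partial>lborel) \<le> (\<integral>\<^sup>+y. ennreal (norm h powr p * g y powr p) * \<Psi> y \<partial>lborel)"
proof -
  have [measurable]: "u \<in> borel_measurable borel" "g \<in> borel_measurable borel" and g: "\<And>x. 0 \<le> g x"
    and AE: "AE x in lborel. (\<forall>t\<in>{0..1}. x + t *\<^sub>R h \<in> U) \<longrightarrow>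
        ennreal \<bar>u (x + h) - u x\<bar> \<le> (\<integral>\<^sup>+t\<in>{0..1}. ennreal (norm h * g (x + t *\<^sub>R h)) \<partial>lborel)"
    using ug unfolding upper_gradient_def by auto
  have km[measurable]: "(\<lambda>t. k x t) \<in> borel_measurable borel" for x
    using measurable_compose[OF measurable_Pair1'[of x borel borel] assms(5)] by simp
  let ?c = "\<lambda>x t. ennreal (norm h powr p) * (indicator W x * ennreal (Z x powr (p - 1) * k x t powr (1 - p)))"
  have "AE x in lborel. ennreal (\<bar>u (x + h) - u x\<bar> powr p) * indicator W x \<le>
      (\<integral>\<^sup>+t. ?c x t * (ennreal (g (x + t *\<^sub>R h) powr p) * indicator {0..1} t) \<partial>lborel)"
    using AE
  proof eventually_elim
    case (elim x)
    show ?case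
    proof (cases "x \<in> W")
      case True
      then have "ennreal \<bar>u (x + h) - u x\<bar> \<le> (\<integral>\<^sup>+t\<in>{0..1}. ennreal (norm h * g (x + t *\<^sub>R h)) \<partial>lborel)"
        using elim WU by auto
      then have "ennreal (\<bar>u (x + h) - u x\<bar> powr p) \<le> ennreal (Z x powr (p - 1)) *
          (\<integral>\<^sup>+t\<in>{0..1}. ennreal ((norm h * g (x + t *\<^sub>R h)) powr p * k x t powr (1 - p)) \<partial>lborel)"
        by (intro nn_integral_powr_Jensen[OF p]) (use True Z k g in auto)
      also have "\<dots> = (\<integral>\<^sup>+t. ?c x t * (ennreal (g (x + t *\<^sub>R h) powr p) * indicator {0..1} t) \<partial>lborel)"
        using True g by (subst nn_integral_cmult[symmetric]; (intro nn_integral_cong)?)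
          (auto simp: ennreal_mult[symmetric] powr_mult indicator_def mult_ac)
      finally show ?thesis using True by simp
    qed simp
  qed
  then have "(\<integral>\<^sup>+x\<in>W. ennreal (\<bar>u (x + h) - u x\<bar> powr p) \<partial>lborel) \<le>
     (\<integral>\<^sup>+x. (\<integral>\<^sup>+t. ?c x t * (ennreal (g (x + t *\<^sub>R h) powr p) * indicator {0..1} t) \<partial>lborel) \<partial>lborel)"
    by (rule nn_integral_mono_AE)
  also have "\<dots> = (\<integral>\<^sup>+t. (\<integral>\<^sup>+x. ?c x t * (ennreal (g (x + t *\<^sub>R h) powr p) * indicator {0..1} t) \<partial>lborel) \<partial>lborel)"
    by (rule lborel_pair.Fubini') measurable
  also have "\<dots> = (\<integral>\<^sup>+t. (\<integral>\<^sup>+y. ?c (y - t *\<^sub>R h) t * (ennreal (g y powr p) * indicator {0..1} t) \<partial>lborel) \<partial>lborel)"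
  proof (rule nn_integral_cong)
    fix t :: real
    show "(\<integral>\<^sup>+x. ?c x t * (ennreal (g (x + t *\<^sub>R h) powr p) * indicator {0..1} t) \<partial>lborel) =
      (\<integral>\<^sup>+y. ?c (y - t *\<^sub>R h) t * (ennreal (g y powr p) * indicator {0..1} t) \<partial>lborel)"
      by (subst nn_integral_lborel_translate[of _ "t *\<^sub>R h", symmetric]) auto
  qed
  also have "\<dots> = (\<integral>\<^sup>+y. (\<integral>\<^sup>+t. ?c (y - t *\<^sub>R h) t * (ennreal (g y powr p) * indicator {0..1} t) \<partial>lborel) \<partial>lborel)"
    by (rule lborel_pair.Fubini') measurable
  also have "\<dots> = (\<integral>\<^sup>+y. ennreal (norm h powr p * g y powr p) *
     (\<integral>\<^sup>+t\<in>{0..1}. indicator W (y - t *\<^sub>R h) * ennreal (Z (y - t *\<^sub>R h) powr (p - 1) * k (y - t *\<^sub>R h) t powr (1 - p)) \<partial>lborel) \<partial>lborel)"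
    by (intro nn_integral_cong, subst nn_integral_cmult[symmetric]) (auto intro!: nn_integral_cong simp: ennreal_mult mult_ac)
  also have "\<dots> \<le> (\<integral>\<^sup>+y. ennreal (norm h powr p * g y powr p) * \<Psi> y \<partial>lborel)"
    by (intro nn_integral_mono mult_left_mono \<Psi>) auto
  finally show ?thesis .
qed

abbreviation Lp_int :: "real \<Rightarrow> 'a::euclidean_space set \<Rightarrow> ('a \<Rightarrow> real) \<Rightarrow> ennreal" where
  "Lp_int p A f \<equiv> \<integral>\<^sup>+x\<in>A. ennreal (f x powr p) \<partial>lborel"

text \<open>The constant kernel 1, for which \<Psi> is the indicator of \<open>K\<close>.\<close>

lemma upper_gradient_shift:
  fixes u g :: "'a::euclidean_space \<Rightarrow> real"
  assumes p: "1 < p" and ug: "upper_gradient U u g" and [measurable]: "W \<in> sets borel" "K \<in> sets borel"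
    and KU: "K \<subseteq> U" and WK: "\<And>x t. x \<in> W \<Longrightarrow> 0 \<le> t \<Longrightarrow> t \<le> 1 \<Longrightarrow> x + t *\<^sub>R h \<in> K"
  shows "(Lp_int p W (\<lambda>x. \<bar>u (x + h) - u x\<bar>))
    \<le> ennreal (norm h powr p) * (Lp_int p K (\<lambda>y. g y))"
proof -
  have [measurable]: "g \<in> borel_measurable borel" using ug by (simp add: upper_gradient_def)
  have "Lp_int p W (\<lambda>x. \<bar>u (x + h) - u x\<bar>) \<le> (\<integral>\<^sup>+y. ennreal (norm h powr p * g y powr p) * indicator K y \<partial>lborel)"
  proof (rule upper_gradient_shift_kernel[OF p ug, where Z="\<lambda>_. 1" and k="\<lambda>_ _. 1"])
    fix y
    have "(\<integral>\<^sup>+t\<in>{0..1}. indicator W (y - t *\<^sub>R h) * ennreal (1 powr (p - 1) * 1 powr (1 - p)) \<partial>lborel)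
        \<le> (\<integral>\<^sup>+t. indicator K y * indicator {0..1::real} t \<partial>lborel)"
    proof (intro nn_integral_mono)
      fix t :: real
      show "indicator W (y - t *\<^sub>R h) * ennreal (1 powr (p - 1) * 1 powr (1 - p)) * indicator {0..1} t \<le> (indicator K y * indicator {0..1} t :: ennreal)"
        using WK[of "y - t *\<^sub>R h" t] by (auto simp: indicator_def)
    qed
    also have "\<dots> = indicator K y" by (simp add: nn_integral_cmult)
    finally show "(\<integral>\<^sup>+t\<in>{0..1}. indicator W (y - t *\<^sub>R h) * ennreal (1 powr (p - 1) * 1 powr (1 - p)) \<partial>lborel)
        \<le> indicator K y" .
  qed (use WK KU in auto)
  also have "\<dots> = ennreal (norm h powr p) * (Lp_int p K (\<lambda>y. g y))"
    by (subst nn_integral_cmult[symmetric]) (auto intro!: nn_integral_cong simp: ennreal_mult mult_ac)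
  finally show ?thesis .
qed

section \<open>Two power integrals and the weighted shift estimate\<close>

lemma nn_integral_powr_tail:
  fixes d \<theta> :: real
  assumes "0 < d" "1 < \<theta>"
  shows "(\<integral>\<^sup>+t\<in>{0..1}. ennreal ((d + t) powr (- \<theta>)) \<partial>lborel) \<le> ennreal (d powr (1 - \<theta>) / (\<theta> - 1))"
proof -
  let ?F = "\<lambda>t. - ((d + t) powr (1 - \<theta>) / (\<theta> - 1))"
  have "((\<lambda>t. (d + t) powr (- \<theta>)) has_integral (?F 1 - ?F 0)) {0..1}"
  proof (rule fundamental_theorem_of_calculus)
    fix t :: real assume "t \<in> {0..1}"
    then have "((\<lambda>t. (d + t) powr (1 - \<theta>)) has_real_derivative (1 - \<theta>) * (d + t) powr (- \<theta>)) (at t within {0..1})"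
      using assms by (auto intro!: derivative_eq_intros)
    from DERIV_cmult[OF this, of "- (1 / (\<theta> - 1))"]
    have "(?F has_real_derivative - (1 / (\<theta> - 1)) * ((1 - \<theta>) * (d + t) powr (- \<theta>))) (at t within {0..1})"
      by simp
    moreover have "- (1 / (\<theta> - 1)) * ((1 - \<theta>) * X) = X" for X
      using assms by (simp add: divide_simps) (simp add: algebra_simps)
    ultimately have "(?F has_real_derivative (d + t) powr (- \<theta>)) (at t within {0..1})" by simp
    then show "(?F has_vector_derivative (d + t) powr (- \<theta>)) (at t within {0..1})"
      by (simp add: has_real_derivative_iff_has_vector_derivative)
  qed simp
  from nn_integral_has_integral_lebesgue'[OF _ this]
  have "(\<integral>\<^sup>+t\<in>{0..1}. ennreal ((d + t) powr (- \<theta>)) \<partial>lborel) = ennreal (?F 1 - ?F 0)" by simp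
  also have "\<dots> \<le> ennreal (d powr (1 - \<theta>) / (\<theta> - 1))"
    using assms by (intro ennreal_leI) simp
  finally show ?thesis .
qed

lemma nn_integral_powr_singular:
  fixes d :: real
  assumes "0 < d"
  shows "(\<integral>\<^sup>+t\<in>{0..d}. ennreal ((d - t) powr (- 1 / 2)) \<partial>lborel) = ennreal (2 * d powr (1 / 2))"
proof -
  have "(\<integral>\<^sup>+t\<in>{0..d}. ennreal ((d - t) powr (- 1 / 2)) \<partial>lborel) = (\<integral>\<^sup>+t\<in>{0..d}. ennreal (t powr (- 1 / 2)) \<partial>lborel)"
    by (subst nn_integral_real_affine[where c="-1" and t=d]) (auto intro!: nn_integral_cong simp: indicator_def)
  also have "\<dots> = ennreal (2 * d powr (1 / 2))"
    using nn_integral_has_integral_lebesgue'[OF _ has_integral_powr_from_0[of "-1/2" d]] assms by (simp add: mult.commute)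
  finally show ?thesis .
qed

text \<open>A Schur test: the exponent \<open>\<theta>\<close> is chosen so that \<open>(\<theta> - 1) (p - 1) = 1/2\<close>, which keeps both the inner
  integral of \<open>(\<delta> + t) powr (- \<theta>)\<close> over large \<open>t\<close> and the outer one of \<open>(\<delta> - t) powr (- 1/2)\<close> finite.\<close>

lemma upper_gradient_shift_Hardy:
  fixes u g \<delta> :: "'a::euclidean_space \<Rightarrow> real"
  assumes p: "1 < p" and ug: "upper_gradient U u g" and [measurable]: "W \<in> sets borel" "K \<in> sets borel"
    and KU: "K \<subseteq> U" and WK: "\<And>x t. x \<in> W \<Longrightarrow> 0 \<le> t \<Longrightarrow> t \<le> 1 \<Longrightarrow> x + t *\<^sub>R h \<in> K"
    and [measurable]: "\<delta> \<in> borel_measurable borel" and \<delta>: "\<And>x. x \<in> W \<Longrightarrow> 0 < \<delta> x" "\<And>x t. \<delta> (x + t *\<^sub>R h) = \<delta> x + t"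
  shows "(Lp_int p W (\<lambda>x. \<bar>u (x + h) - u x\<bar>))
    \<le> ennreal (2 * (2 * (p - 1)) powr (p - 1) * norm h powr p) * (Lp_int p K (\<lambda>y. \<delta> y * g y))"
proof -
  have [measurable]: "g \<in> borel_measurable borel" and g: "\<And>x. 0 \<le> g x" using ug by (auto simp: upper_gradient_def)
  define \<theta> where "\<theta> = 1 + 1 / (2 * (p - 1))"
  \<comment> \<open>These identities translate the choice of \<theta> into exponents: the weight
    mass to the power p - 1 becomes a multiple of (\<delta> y - t)^(-1/2), and the kernel factor
    becomes (\<delta> y)^(p - 1/2).\<close>
  have \<theta>: "1 < \<theta>" "1 / (\<theta> - 1) = 2 * (p - 1)" "(1 - \<theta>) * (p - 1) = - 1 / 2" "- \<theta> * (1 - p) = p - 1 / 2"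
    using p by (auto simp: \<theta>_def field_simps)
  let ?c = "(2 * (p - 1)) powr (p - 1)"
  let ?Z = "\<lambda>x. \<delta> x powr (1 - \<theta>) / (\<theta> - 1)" and ?k = "\<lambda>x t. (\<delta> x + t) powr (- \<theta>)"
  let ?\<Psi> = "\<lambda>y. ennreal (2 * ?c * \<delta> y powr p) * indicator K y"
  have \<delta>': "\<delta> (y - t *\<^sub>R h) = \<delta> y - t" for y t using \<delta>(2)[of "y - t *\<^sub>R h" t] by simp
  have "Lp_int p W (\<lambda>x. \<bar>u (x + h) - u x\<bar>) \<le> (\<integral>\<^sup>+y. ennreal (norm h powr p * g y powr p) * ?\<Psi> y \<partial>lborel)"
  proof (rule upper_gradient_shift_kernel[OF p ug, where Z="?Z" and k="?k"])
    fix y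
    let ?L = "\<integral>\<^sup>+t\<in>{0..1}. indicator W (y - t *\<^sub>R h) * ennreal (?Z (y - t *\<^sub>R h) powr (p - 1) * ?k (y - t *\<^sub>R h) t powr (1 - p)) \<partial>lborel"
    show "?L \<le> ?\<Psi> y"
    proof (cases "\<exists>t\<in>{0..1}. y - t *\<^sub>R h \<in> W")
      case False
      then have "?L = (\<integral>\<^sup>+t. 0 \<partial>(lborel :: real measure))"
        by (intro nn_integral_cong) (auto simp: indicator_def)
      then show ?thesis by simp
    next
      case True
      then obtain s where s: "0 \<le> s" "s \<le> 1" "y - s *\<^sub>R h \<in> W" by auto
      have yK: "y \<in> K" using WK[OF s(3,1,2)] by simp
      have d: "0 < \<delta> y" using \<delta>(1)[OF s(3)] s by (simp add: \<delta>')
      \<comment> \<open>Only t below \<delta> y contribute, since the starting point y - t h lies in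
        \<open>W\<close> and therefore has positive \<delta>.\<close>
      have "?L \<le> (\<integral>\<^sup>+t. ennreal (?c * \<delta> y powr (p - 1 / 2)) * (ennreal ((\<delta> y - t) powr (- 1 / 2)) * indicator {0..\<delta> y} t) \<partial>lborel)"
      proof (intro nn_integral_mono)
        fix t :: real
        show "indicator W (y - t *\<^sub>R h) * ennreal (?Z (y - t *\<^sub>R h) powr (p - 1) * ?k (y - t *\<^sub>R h) t powr (1 - p)) * indicator {0..1} t
          \<le> ennreal (?c * \<delta> y powr (p - 1 / 2)) * (ennreal ((\<delta> y - t) powr (- 1 / 2)) * indicator {0..\<delta> y} t)"
        proof (cases "y - t *\<^sub>R h \<in> W \<and> t \<in> {0..1}")
          case True
          then have t: "0 \<le> t" "t < \<delta> y" using \<delta>(1)[of "y - t *\<^sub>R h"] by (auto simp: \<delta>')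
          have "?Z (y - t *\<^sub>R h) powr (p - 1) = ((\<delta> y - t) powr (1 - \<theta>) * (1 / (\<theta> - 1))) powr (p - 1)"
            by (simp add: \<delta>')
          also have "\<dots> = (\<delta> y - t) powr (- 1 / 2) * ?c"
            unfolding \<theta>(2) using t p by (simp add: powr_mult powr_powr \<theta>(3))
          finally have 1: "?Z (y - t *\<^sub>R h) powr (p - 1) = (\<delta> y - t) powr (- 1 / 2) * ?c" .
          have 2: "?k (y - t *\<^sub>R h) t powr (1 - p) = \<delta> y powr (p - 1 / 2)"
            using d unfolding \<theta>(4)[symmetric] by (simp add: \<delta>' powr_powr)
          show ?thesis unfolding 1 2 using True t by (simp add: ennreal_mult[symmetric] mult_ac)
        qed (auto simp: indicator_def)
      qed
      also have "\<dots> = ennreal (?c * \<delta> y powr (p - 1 / 2)) * ennreal (2 * \<delta> y powr (1 / 2))"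
        by (subst nn_integral_cmult) (measurable, simp only: nn_integral_powr_singular[OF d])
      also have "\<dots> = ennreal (2 * ?c * (\<delta> y powr (p - 1 / 2) * \<delta> y powr (1 / 2)))"
        by (simp add: ennreal_mult[symmetric] mult_ac)
      also have "\<delta> y powr (p - 1 / 2) * \<delta> y powr (1 / 2) = \<delta> y powr p"
        by (simp add: powr_add[symmetric])
      finally show ?thesis using yK by simp
    qed
  next
    fix x assume "x \<in> W"
    from nn_integral_powr_tail[OF \<delta>(1)[OF this] \<theta>(1)]
    show "(\<integral>\<^sup>+t\<in>{0..1}. ennreal (?k x t) \<partial>lborel) \<le> ennreal (?Z x)" .
  next
    fix x t assume "x \<in> W" "0 \<le> (t::real)"
    then show "0 < ?k x t" using \<delta>(1)[of x] by simp
  next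
    fix x assume "x \<in> W"
    then show "0 < ?Z x" using \<delta>(1)[of x] \<theta>(1) by simp
  qed (use WK KU in auto)
  also have "\<dots> = (\<integral>\<^sup>+y. ennreal (2 * ?c * norm h powr p) * (ennreal ((\<delta> y * g y) powr p) * indicator K y) \<partial>lborel)"
  proof (intro nn_integral_cong)
    fix y
    show "ennreal (norm h powr p * g y powr p) * ?\<Psi> y = ennreal (2 * ?c * norm h powr p) * (ennreal ((\<delta> y * g y) powr p) * indicator K y)"
      using g[of y] by (cases "0 \<le> \<delta> y") (auto simp: powr_mult ennreal_mult[symmetric] mult_ac indicator_def)
  qed
  also have "\<dots> = ennreal (2 * ?c * norm h powr p) * (Lp_int p K (\<lambda>y. \<delta> y * g y))"
    by (subst nn_integral_cmult) auto
  finally show ?thesis .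
qed

section \<open>Chaining of oscillations\<close>

lemma powr_abs_triangle:
  fixes a b c p :: real
  assumes "1 < p"
  shows "\<bar>a - c\<bar> powr p \<le> 2 powr p * (\<bar>a - b\<bar> powr p + \<bar>b - c\<bar> powr p)"
proof -
  let ?m = "max \<bar>a - b\<bar> \<bar>b - c\<bar>"
  have "\<bar>a - c\<bar> powr p \<le> (2 * ?m) powr p"
  proof (intro powr_mono2)
    have "\<bar>a - c\<bar> \<le> \<bar>a - b\<bar> + \<bar>b - c\<bar>" by linarith
    also have "\<dots> \<le> ?m + ?m" by (intro add_mono) auto
    finally show "\<bar>a - c\<bar> \<le> 2 * ?m" by simp
  qed (use assms in auto)
  also have "\<dots> = 2 powr p * ?m powr p" by (simp add: powr_mult)
  also have "?m powr p \<le> \<bar>a - b\<bar> powr p + \<bar>b - c\<bar> powr p"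
    by (auto simp: max_def)
  finally show ?thesis by simp
qed

text \<open>Plays the role of the L^p distance of \<open>v\<close> to its mean, but makes sense in
  \<open>ennreal\<close> for every Borel function, including those without a finite mean.\<close>

definition osc :: "real \<Rightarrow> ('a::euclidean_space \<Rightarrow> real) \<Rightarrow> 'a set \<Rightarrow> 'a set \<Rightarrow> ennreal" where
  "osc p v A B = (\<integral>\<^sup>+x\<in>A. (Lp_int p B (\<lambda>y. \<bar>v x - v y\<bar>)) \<partial>lborel)"

lemma osc_mono: "A \<subseteq> A' \<Longrightarrow> B \<subseteq> B' \<Longrightarrow> osc p v A B \<le> osc p v A' B'"
  unfolding osc_def
  by (intro nn_integral_mono mult_mono) (auto simp: indicator_def)

lemma osc_Un_left:
  assumes [measurable]: "v \<in> borel_measurable borel" "A \<in> sets borel" "B \<in> sets borel" "C \<in> sets borel"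
  shows "osc p v (A \<union> B) C \<le> osc p v A C + osc p v B C"
  unfolding osc_def
  by (subst nn_integral_add[symmetric]) (auto intro!: nn_integral_mono simp: indicator_def)

lemma osc_commute:
  assumes [measurable]: "v \<in> borel_measurable borel" "A \<in> sets borel" "B \<in> sets borel"
  shows "osc p v A B = osc p v B A"
proof -
  have "osc p v A B = (\<integral>\<^sup>+x. \<integral>\<^sup>+y. ennreal (\<bar>v x - v y\<bar> powr p) * indicator B y * indicator A x \<partial>lborel \<partial>lborel)"
    unfolding osc_def by (intro nn_integral_cong nn_integral_multc[symmetric]) measurable
  also have "\<dots> = (\<integral>\<^sup>+y. \<integral>\<^sup>+x. ennreal (\<bar>v x - v y\<bar> powr p) * indicator B y * indicator A x \<partial>lborel \<partial>lborel)"
    by (rule lborel_pair.Fubini') measurable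
  also have "\<dots> = (\<integral>\<^sup>+y. \<integral>\<^sup>+x. ennreal (\<bar>v y - v x\<bar> powr p) * indicator A x * indicator B y \<partial>lborel \<partial>lborel)"
    by (intro nn_integral_cong) (simp add: mult_ac abs_minus_commute)
  also have "\<dots> = osc p v B A"
    unfolding osc_def by (intro nn_integral_cong nn_integral_multc) measurable
  finally show ?thesis .
qed

text \<open>The triangle inequality through v(z) is integrated over x, y and z in \<open>B\<close>;
  each term gains the measure of the set whose variable it does not contain.\<close>

lemma osc_trans:
  assumes p: "1 < p" and [measurable]: "v \<in> borel_measurable borel" "A \<in> sets borel" "B \<in> sets borel" "C \<in> sets borel"
  shows "emeasure lborel B * osc p v A C \<le>
    ennreal (2 powr p) * (emeasure lborel C * osc p v A B + emeasure lborel A * osc p v B C)"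
proof -
  let ?e = "\<lambda>x y. ennreal (\<bar>v x - v y\<bar> powr p)"
  have pt: "indicator B z * ?e x y \<le> ennreal (2 powr p) * (?e x z * indicator B z + ?e z y * indicator B z)" for x y z
    using powr_abs_triangle[OF p, of "v x" "v y" "v z"]
    by (auto simp: indicator_def ennreal_plus[symmetric] ennreal_mult[symmetric] simp del: ennreal_plus intro!: ennreal_leI)
  have 1: "emeasure lborel B * ?e x y \<le> ennreal (2 powr p) * ((\<integral>\<^sup>+z\<in>B. ?e x z \<partial>lborel) + (\<integral>\<^sup>+z\<in>B. ?e z y \<partial>lborel))" for x y
  proof -
    have "emeasure lborel B * ?e x y = (\<integral>\<^sup>+z. indicator B z * ?e x y \<partial>lborel)"
      by (simp add: nn_integral_multc)
    also have "\<dots> \<le> (\<integral>\<^sup>+z. ennreal (2 powr p) * (?e x z * indicator B z + ?e z y * indicator B z) \<partial>lborel)"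
      by (intro nn_integral_mono pt)
    also have "\<dots> = ennreal (2 powr p) * ((\<integral>\<^sup>+z\<in>B. ?e x z \<partial>lborel) + (\<integral>\<^sup>+z\<in>B. ?e z y \<partial>lborel))"
      by (simp add: nn_integral_cmult nn_integral_add)
    finally show ?thesis .
  qed
  have 2: "emeasure lborel B * (\<integral>\<^sup>+y\<in>C. ?e x y \<partial>lborel) \<le>
     ennreal (2 powr p) * (emeasure lborel C * (\<integral>\<^sup>+z\<in>B. ?e x z \<partial>lborel) + osc p v B C)" for x
  proof -
    have "emeasure lborel B * (\<integral>\<^sup>+y\<in>C. ?e x y \<partial>lborel) = (\<integral>\<^sup>+y. (emeasure lborel B * ?e x y) * indicator C y \<partial>lborel)"
      by (simp add: nn_integral_cmult[symmetric] mult.assoc)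
    also have "\<dots> \<le> (\<integral>\<^sup>+y. (ennreal (2 powr p) * ((\<integral>\<^sup>+z\<in>B. ?e x z \<partial>lborel) + (\<integral>\<^sup>+z\<in>B. ?e z y \<partial>lborel))) * indicator C y \<partial>lborel)"
      by (intro nn_integral_mono mult_right_mono 1) auto
    also have "\<dots> = (\<integral>\<^sup>+y. ennreal (2 powr p) * ((\<integral>\<^sup>+z\<in>B. ?e x z \<partial>lborel) * indicator C y + (\<integral>\<^sup>+z\<in>B. ?e y z \<partial>lborel) * indicator C y) \<partial>lborel)"
      by (intro nn_integral_cong) (auto simp: indicator_def abs_minus_commute)
    also have "\<dots> = ennreal (2 powr p) * ((\<integral>\<^sup>+z\<in>B. ?e x z \<partial>lborel) * emeasure lborel C + osc p v C B)"
      unfolding osc_def by (simp add: nn_integral_cmult nn_integral_add)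
    finally show ?thesis by (simp add: mult.commute osc_commute[of v C B])
  qed
  have "emeasure lborel B * osc p v A C = (\<integral>\<^sup>+x. (emeasure lborel B * (\<integral>\<^sup>+y\<in>C. ?e x y \<partial>lborel)) * indicator A x \<partial>lborel)"
    unfolding osc_def by (subst nn_integral_cmult[symmetric]) (auto simp: mult.assoc)
  also have "\<dots> \<le> (\<integral>\<^sup>+x. (ennreal (2 powr p) * (emeasure lborel C * (\<integral>\<^sup>+z\<in>B. ?e x z \<partial>lborel) + osc p v B C)) * indicator A x \<partial>lborel)"
    by (intro nn_integral_mono mult_right_mono 2) auto
  also have "\<dots> = (\<integral>\<^sup>+x. ennreal (2 powr p) * (emeasure lborel C * ((\<integral>\<^sup>+z\<in>B. ?e x z \<partial>lborel) * indicator A x) + osc p v B C * indicator A x) \<partial>lborel)"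
    by (intro nn_integral_cong) (auto simp: indicator_def)
  also have "\<dots> = ennreal (2 powr p) * (emeasure lborel C * osc p v A B + emeasure lborel A * osc p v B C)"
    by (subst nn_integral_cmult, simp, subst nn_integral_add) (simp_all add: nn_integral_cmult osc_def[of p v A B] mult.commute[of "emeasure lborel A"])
  finally show ?thesis .
qed

text \<open>Inserting v(x + h) replaces \<open>A\<close> by its translate at the price of one shift
  term. This moves a boundary layer into the interior, where chaining applies.\<close>

lemma osc_shift:
  assumes p: "1 < p" and [measurable]: "v \<in> borel_measurable borel" "A \<in> sets borel" "B \<in> sets borel"
  shows "osc p v A B \<le> ennreal (2 powr p) *
    (emeasure lborel B * (Lp_int p A (\<lambda>x. \<bar>v (x + h) - v x\<bar>)) + osc p v ((\<lambda>y. y - h) -` A) B)"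
proof -
  let ?e = "\<lambda>x y. ennreal (\<bar>x - y\<bar> powr p)"
  have [measurable]: "(\<lambda>y. y - h) -` A \<in> sets borel"
    using measurable_sets[of "\<lambda>y. y - h" borel borel A] by simp
  have pt: "?e (v x) (v y) \<le> ennreal (2 powr p) * (?e (v (x + h)) (v x) + ?e (v (x + h)) (v y))" for x y
    using powr_abs_triangle[OF p, of "v x" "v y" "v (x + h)"]
    by (auto simp: abs_minus_commute ennreal_plus[symmetric] ennreal_mult[symmetric] simp del: ennreal_plus intro!: ennreal_leI)
  have 1: "(\<integral>\<^sup>+y\<in>B. ?e (v x) (v y) \<partial>lborel) \<le> ennreal (2 powr p) * (emeasure lborel B * ?e (v (x + h)) (v x) + (\<integral>\<^sup>+y\<in>B. ?e (v (x + h)) (v y) \<partial>lborel))" for x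
  proof -
    have "(\<integral>\<^sup>+y\<in>B. ?e (v x) (v y) \<partial>lborel) \<le> (\<integral>\<^sup>+y. ennreal (2 powr p) * (?e (v (x + h)) (v x) * indicator B y + ?e (v (x + h)) (v y) * indicator B y) \<partial>lborel)"
      using pt by (intro nn_integral_mono) (auto simp: indicator_def)
    also have "\<dots> = ennreal (2 powr p) * (?e (v (x + h)) (v x) * emeasure lborel B + (\<integral>\<^sup>+y\<in>B. ?e (v (x + h)) (v y) \<partial>lborel))"
      by (simp add: nn_integral_cmult nn_integral_add)
    finally show ?thesis by (simp only: mult.commute[of "emeasure lborel B"])
  qed
  have "osc p v A B \<le> (\<integral>\<^sup>+x. (ennreal (2 powr p) * (emeasure lborel B * ?e (v (x + h)) (v x) + (\<integral>\<^sup>+y\<in>B. ?e (v (x + h)) (v y) \<partial>lborel))) * indicator A x \<partial>lborel)"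
    unfolding osc_def by (intro nn_integral_mono mult_right_mono 1) auto
  also have "\<dots> = (\<integral>\<^sup>+x. ennreal (2 powr p) * (emeasure lborel B * (?e (v (x + h)) (v x) * indicator A x) + (\<integral>\<^sup>+y\<in>B. ?e (v (x + h)) (v y) \<partial>lborel) * indicator A x) \<partial>lborel)"
    by (intro nn_integral_cong) (auto simp: indicator_def)
  also have "\<dots> = ennreal (2 powr p) * (emeasure lborel B * (\<integral>\<^sup>+x\<in>A. ?e (v (x + h)) (v x) \<partial>lborel) + (\<integral>\<^sup>+x. (\<integral>\<^sup>+y\<in>B. ?e (v (x + h)) (v y) \<partial>lborel) * indicator A x \<partial>lborel))"
    by (subst nn_integral_cmult, simp, subst nn_integral_add) (simp_all add: nn_integral_cmult)
  also have "(\<integral>\<^sup>+x. (\<integral>\<^sup>+y\<in>B. ?e (v (x + h)) (v y) \<partial>lborel) * indicator A x \<partial>lborel) = osc p v ((\<lambda>y. y - h) -` A) B"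
    unfolding osc_def
    by (subst nn_integral_lborel_translate[of _ h, symmetric]) (auto simp: indicator_def intro!: nn_integral_cong)
  finally show ?thesis .
qed

text \<open>Substituting y = x + h turns the double integral into an integral over h of shift
  integrals; only h shorter than the diameter contribute, hence the ball of radius 2 r.\<close>

lemma osc_ball:
  fixes v :: "'a::euclidean_space \<Rightarrow> real"
  assumes [measurable]: "v \<in> borel_measurable borel"
    and E: "\<And>h. (\<integral>\<^sup>+x\<in>{x. x \<in> ball a r \<and> x + h \<in> ball a r}. ennreal (\<bar>v (x + h) - v x\<bar> powr p) \<partial>lborel) \<le> E"
  shows "osc p v (ball a r) (ball a r) \<le> emeasure lborel (ball 0 (2 * r) :: 'a set) * E"
proof -
  let ?B = "ball a r"
  have [measurable]: "?B \<in> sets borel" by simp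
  have "osc p v ?B ?B = (\<integral>\<^sup>+x. \<integral>\<^sup>+y. ennreal (\<bar>v y - v x\<bar> powr p) * indicator ?B y * indicator ?B x \<partial>lborel \<partial>lborel)"
    unfolding osc_def
    by (intro nn_integral_cong) (auto simp: abs_minus_commute indicator_def)
  also have "\<dots> = (\<integral>\<^sup>+x. \<integral>\<^sup>+h. ennreal (\<bar>v (x + h) - v x\<bar> powr p) * indicator ?B (x + h) * indicator ?B x \<partial>lborel \<partial>lborel)"
  proof (rule nn_integral_cong)
    fix x :: 'a
    have m: "(\<lambda>y. ennreal (\<bar>v y - v x\<bar> powr p) * indicator ?B y * indicator ?B x) \<in> borel_measurable borel"
      by measurable
    show "(\<integral>\<^sup>+y. ennreal (\<bar>v y - v x\<bar> powr p) * indicator ?B y * indicator ?B x \<partial>lborel)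
      = (\<integral>\<^sup>+h. ennreal (\<bar>v (x + h) - v x\<bar> powr p) * indicator ?B (x + h) * indicator ?B x \<partial>lborel)"
      using nn_integral_lborel_translate[OF m, of x] by (simp add: add.commute)
  qed
  also have "\<dots> = (\<integral>\<^sup>+h. \<integral>\<^sup>+x. ennreal (\<bar>v (x + h) - v x\<bar> powr p) * indicator ?B (x + h) * indicator ?B x \<partial>lborel \<partial>lborel)"
    by (rule lborel_pair.Fubini') measurable
  also have "\<dots> \<le> (\<integral>\<^sup>+h\<in>(ball 0 (2 * r) :: 'a set). E \<partial>lborel)"
  proof (intro nn_integral_mono)
    fix h :: 'a
    show "(\<integral>\<^sup>+x. ennreal (\<bar>v (x + h) - v x\<bar> powr p) * indicator ?B (x + h) * indicator ?B x \<partial>lborel) \<le> E * indicator (ball 0 (2 * r)) h"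
    proof (cases "h \<in> ball 0 (2 * r)")
      case True
      have "(\<integral>\<^sup>+x. ennreal (\<bar>v (x + h) - v x\<bar> powr p) * indicator ?B (x + h) * indicator ?B x \<partial>lborel) =
        (\<integral>\<^sup>+x\<in>{x. x \<in> ball a r \<and> x + h \<in> ball a r}. ennreal (\<bar>v (x + h) - v x\<bar> powr p) \<partial>lborel)"
        by (intro nn_integral_cong) (auto simp: indicator_def)
      then show ?thesis using E[of h] True by simp
    next
      case False
      have "\<not> (x \<in> ?B \<and> x + h \<in> ?B)" for x
      proof
        assume "x \<in> ?B \<and> x + h \<in> ?B"
        then have "dist x (x + h) < 2 * r" using dist_triangle_less_add[of x a r "x + h" r] by (auto simp: dist_commute)
        then show False using False by (simp add: dist_norm)
      qed
      then have "(\<integral>\<^sup>+x. ennreal (\<bar>v (x + h) - v x\<bar> powr p) * indicator ?B (x + h) * indicator ?B x \<partial>lborel) = (\<integral>\<^sup>+x. 0 \<partial>(lborel :: 'a measure))"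
        by (intro nn_integral_cong) (auto simp: indicator_def)
      then show ?thesis by simp
    qed
  qed
  also have "\<dots> = emeasure lborel (ball 0 (2 * r) :: 'a set) * E"
    by (subst nn_integral_cmult_indicator) (auto simp: mult.commute)
  finally show ?thesis .
qed

text \<open>If the inner integral exceeded its average bound at every point of \<open>B\<close>,
  integrating over \<open>B\<close> would contradict the bound on \<open>osc\<close>. The constant
  that approximates \<open>v\<close> is thus a value of \<open>v\<close>, available before any
  integrability of \<open>v\<close> is known.\<close>

lemma osc_choose_point:
  assumes [measurable]: "v \<in> borel_measurable borel" "A \<in> sets borel" "B \<in> sets borel"
    and B: "0 < emeasure lborel B" "emeasure lborel B < \<infinity>" and E: "osc p v A B \<le> E"
  shows "\<exists>y\<in>B. (Lp_int p A (\<lambda>x. \<bar>v x - v y\<bar>)) \<le> E / emeasure lborel B"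
proof (rule ccontr)
  let ?K = "E / emeasure lborel B" and ?f = "\<lambda>y. \<integral>\<^sup>+x\<in>A. ennreal (\<bar>v x - v y\<bar> powr p) \<partial>lborel"
  assume "\<not> ?thesis"
  then have gt: "\<And>y. y \<in> B \<Longrightarrow> ?K < ?f y" by (simp add: not_le)
  \<comment> \<open>The assumed strict inequality at a single point already makes \<open>?K\<close>
    finite, which the subtraction below requires.\<close>
  have "\<exists>y. y \<in> B" using B(1) by (metis emeasure_empty equals0I less_irrefl)
  then have Kfin: "?K < top" using less_le_trans[OF gt top_greatest] by blast
  have KB: "?K * emeasure lborel B = E" using B
    by (simp add: ennreal_divide_times divide_eq_1_iff mult_divide_eq_ennreal)
  have fB: "(\<integral>\<^sup>+y\<in>B. ?f y \<partial>lborel) \<le> ?K * emeasure lborel B"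
  proof -
    have "(\<integral>\<^sup>+y\<in>B. ?f y \<partial>lborel) = osc p v B A" unfolding osc_def by (simp add: abs_minus_commute)
    then show ?thesis using E KB osc_commute[of v A B p] by simp
  qed
  have "(\<integral>\<^sup>+y. (?f y - ?K) * indicator B y \<partial>lborel) = (\<integral>\<^sup>+y. ?f y * indicator B y - ?K * indicator B y \<partial>lborel)"
    by (intro nn_integral_cong) (auto simp: indicator_def)
  also have "\<dots> = (\<integral>\<^sup>+y\<in>B. ?f y \<partial>lborel) - (\<integral>\<^sup>+y. ?K * indicator B y \<partial>lborel)"
  proof (rule nn_integral_diff)
    show "(\<integral>\<^sup>+y. ?K * indicator B y \<partial>lborel) \<noteq> \<infinity>"
      using Kfin B by (simp add: nn_integral_cmult ennreal_mult_eq_top_iff)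
    show "AE y in lborel. ?K * indicator B y \<le> ?f y * indicator B y"
      using gt by (intro AE_I2) (auto split: split_indicator intro: less_imp_le)
  qed measurable
  also have "\<dots> = 0"
  proof -
    have "?K * emeasure lborel B < top" using Kfin B by (simp add: ennreal_mult_less_top)
    then show ?thesis using diff_eq_0_ennreal[OF le_less_trans[OF fB] fB] by (simp add: nn_integral_cmult)
  qed
  finally have "AE y in lborel. (?f y - ?K) * indicator B y = 0"
    by (subst (asm) nn_integral_0_iff_AE) auto
  then have "AE y in lborel. y \<notin> B"
  proof eventually_elim
    case (elim y)
    show ?case
    proof
      assume y: "y \<in> B"
      then have "?f y - ?K = 0" using elim by simp
      then show False using gt[OF y] diff_gt_0_iff_gt_ennreal[of "?f y" ?K] by simp
    qed
  qed
  then have "emeasure lborel B = 0" by (subst (asm) AE_iff_measurable[of B]) auto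
  then show False using B by simp
qed

lemma ennreal_mult_le_cancel:
  assumes "0 < b" "b < \<infinity>" "b * x \<le> ennreal c * (y::ennreal)" "0 \<le> c"
  shows "x \<le> ennreal (c / enn2real b) * y"
proof -
  obtain r where r: "b = ennreal r" "0 < r" using assms(1,2) by (cases b) auto
  have "x = ennreal (1 / r) * (b * x)"
    using r by (simp add: mult.assoc[symmetric] ennreal_mult[symmetric])
  also have "\<dots> \<le> ennreal (1 / r) * (ennreal c * y)" by (intro mult_left_mono assms) auto
  also have "\<dots> = ennreal (c / r) * y"
    using r assms(4) by (simp add: mult.assoc[symmetric] ennreal_mult[symmetric])
  finally show ?thesis using r by simp
qed

text \<open>\<open>F\<close> collects pairs of a function and its energy, so that a constant chosen
  before the pair is uniform over a whole class of functions. In \<open>ball_shift\<close> it may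
  depend on the ball, since the energies are allowed to degenerate towards the boundary of
  \<open>D\<close>.\<close>

locale shift_controlled =
  fixes p :: real and F :: "(('a::euclidean_space \<Rightarrow> real) \<times> ennreal) set" and D :: "'a set"
  assumes p: "1 < p" and meas: "\<And>v E. (v, E) \<in> F \<Longrightarrow> v \<in> borel_measurable borel"
    and D: "open D" "connected D"
    and ball_shift: "\<And>a r. cball a r \<subseteq> D \<Longrightarrow> \<exists>C. \<forall>v E h. (v, E) \<in> F \<longrightarrow>
      (\<integral>\<^sup>+x\<in>{x. x \<in> ball a r \<and> x + h \<in> ball a r}. ennreal (\<bar>v (x + h) - v x\<bar> powr p) \<partial>lborel) \<le> ennreal C * E"
begin

definition ctl :: "'a set \<Rightarrow> 'a set \<Rightarrow> bool" where
  "ctl A B \<longleftrightarrow> (\<exists>C\<ge>0. \<forall>v E. (v, E) \<in> F \<longrightarrow> osc p v A B \<le> ennreal C * E)"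

lemma ctlI: "(\<And>v E. (v, E) \<in> F \<Longrightarrow> osc p v A B \<le> ennreal C * E) \<Longrightarrow> ctl A B"
  unfolding ctl_def
  by (rule exI[of _ "max C 0"]) (auto simp: max_def ennreal_neg split: if_splits)

lemma ctl_mono: "ctl A' B' \<Longrightarrow> A \<subseteq> A' \<Longrightarrow> B \<subseteq> B' \<Longrightarrow> ctl A B"
  unfolding ctl_def by (meson order_trans osc_mono)

lemma ctl_commute: "ctl A B \<Longrightarrow> A \<in> sets borel \<Longrightarrow> B \<in> sets borel \<Longrightarrow> ctl B A"
  unfolding ctl_def using osc_commute[OF meas, of _ _ A B] by auto

lemma ctl_Un:
  assumes "ctl A C" "ctl B C" and m: "A \<in> sets borel" "B \<in> sets borel" "C \<in> sets borel"
  shows "ctl (A \<union> B) C"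
proof -
  from assms(1) obtain c1 where c1: "0 \<le> c1" "\<And>v E. (v, E) \<in> F \<Longrightarrow> osc p v A C \<le> ennreal c1 * E"
    unfolding ctl_def by blast
  from assms(2) obtain c2 where c2: "0 \<le> c2" "\<And>v E. (v, E) \<in> F \<Longrightarrow> osc p v B C \<le> ennreal c2 * E"
    unfolding ctl_def by blast
  note c = c1(1) c2(1) c1(2) c2(2)
  show ?thesis
  proof (rule ctlI[of _ _ "c1 + c2"])
    fix v E assume vE: "(v, E) \<in> F"
    have "osc p v (A \<union> B) C \<le> osc p v A C + osc p v B C"
      by (rule osc_Un_left[OF meas[OF vE] m])
    also have "\<dots> \<le> ennreal c1 * E + ennreal c2 * E" by (intro add_mono c vE)
    finally show "osc p v (A \<union> B) C \<le> ennreal (c1 + c2) * E"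
      using c by (simp add: distrib_right)
  qed
qed

lemma ctl_UN:
  assumes "finite I" "\<And>i. i \<in> I \<Longrightarrow> ctl (A i) C" "\<And>i. i \<in> I \<Longrightarrow> A i \<in> sets borel" "C \<in> sets borel"
  shows "ctl (\<Union>i\<in>I. A i) C"
  using assms
proof (induction rule: finite_induct)
  case empty
  have "osc p v {} C = 0" for v by (simp add: osc_def)
  then show ?case by (intro ctlI[of _ _ 0]) simp
next
  case (insert i I)
  then show ?case by (simp, intro ctl_Un) auto
qed

lemma ctl_trans:
  assumes "ctl A B" "ctl B C" and m: "A \<in> sets borel" "B \<in> sets borel" "C \<in> sets borel"
    and B: "0 < emeasure lborel B" "emeasure lborel B < \<infinity>"
    and AC: "emeasure lborel A < \<infinity>" "emeasure lborel C < \<infinity>"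
  shows "ctl A C"
proof -
  from assms(1) obtain c1 where c1: "0 \<le> c1" "\<And>v E. (v, E) \<in> F \<Longrightarrow> osc p v A B \<le> ennreal c1 * E"
    unfolding ctl_def by blast
  from assms(2) obtain c2 where c2: "0 \<le> c2" "\<And>v E. (v, E) \<in> F \<Longrightarrow> osc p v B C \<le> ennreal c2 * E"
    unfolding ctl_def by blast
  note c = c1(1) c2(1) c1(2) c2(2)
  obtain a where a: "emeasure lborel A = ennreal a" "0 \<le> a" using AC(1) by (cases "emeasure lborel A") auto
  obtain d where d: "emeasure lborel C = ennreal d" "0 \<le> d" using AC(2) by (cases "emeasure lborel C") auto
  let ?c = "2 powr p * (d * c1 + a * c2)"
  show ?thesis
  proof (rule ctlI)
    fix v E assume vE: "(v, E) \<in> F"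
    have "emeasure lborel B * osc p v A C \<le> ennreal (2 powr p) * (emeasure lborel C * osc p v A B + emeasure lborel A * osc p v B C)"
      by (rule osc_trans[OF p meas[OF vE] m])
    also have "\<dots> \<le> ennreal (2 powr p) * (emeasure lborel C * (ennreal c1 * E) + emeasure lborel A * (ennreal c2 * E))"
      by (intro mult_left_mono add_mono c vE) auto
    also have "\<dots> = ennreal ?c * E"
      using a d c by (simp add: ennreal_mult[symmetric] mult.assoc[symmetric] distrib_right[symmetric] ennreal_plus[symmetric] del: ennreal_plus)
    finally show "osc p v A C \<le> ennreal (?c / enn2real (emeasure lborel B)) * E"
      using a d c by (intro ennreal_mult_le_cancel B) auto
  qed
qed

lemma ball_emeasure:
  "0 < r \<Longrightarrow> 0 < emeasure lborel (ball (a::'a) r)" "emeasure lborel (ball (a::'a) r) < \<infinity>"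
  using emeasure_lborel_ball_finite[of a r] content_ball_pos[of r a]
  by (auto simp: measure_def enn2real_positive_iff)

lemma ctl_ball:
  assumes "cball a r \<subseteq> D"
  shows "ctl (ball a r) (ball a r)"
proof -
  obtain C where C: "\<And>v E h. (v, E) \<in> F \<Longrightarrow>
      (\<integral>\<^sup>+x\<in>{x. x \<in> ball a r \<and> x + h \<in> ball a r}. ennreal (\<bar>v (x + h) - v x\<bar> powr p) \<partial>lborel) \<le> ennreal C * E"
    using ball_shift[OF assms] by blast
  obtain b where b: "emeasure lborel (ball 0 (2 * r) :: 'a set) = ennreal b" "0 \<le> b"
    using ball_emeasure(2)[of 0 "2 * r"] by (cases "emeasure lborel (ball 0 (2 * r) :: 'a set)") auto
  show ?thesis
  proof (rule ctlI)
    fix v E assume vE: "(v, E) \<in> F"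
    from osc_ball[OF meas[OF vE] C[OF vE]]
    show "osc p v (ball a r) (ball a r) \<le> ennreal (b * C) * E"
      using b by (simp add: ennreal_mult' mult.assoc)
  qed
qed

text \<open>Being joined by control between some pair of small balls is a symmetric and transitive
  relation with open classes, so on the connected set \<open>D\<close> there is only one class. This
  stands in for explicit finite chains of balls.\<close>

lemma ctl_balls:
  assumes x: "cball x r \<subseteq> D" "0 < r" and y: "cball y s \<subseteq> D" "0 < s"
  shows "ctl (ball x r) (ball y s)"
proof -
  define R where "R x y \<longleftrightarrow> (\<exists>r>0. \<exists>s>0. cball x r \<subseteq> D \<and> cball y s \<subseteq> D \<and> ctl (ball x r) (ball y s))" for x y
  note bm = ball_emeasure
  have "R x y"
  proof (rule connected_equivalence_relation[OF D(2)])
    show "x \<in> D" "y \<in> D" using x y by (auto simp: subset_eq)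
    show "R b a" if "R a b" for a b
      using that ctl_commute[of "ball a _" "ball b _"] unfolding R_def by force
    show "R a c" if ab: "R a b" and bc: "R b c" for a b c
    proof -
      obtain r s where 1: "0 < r" "0 < s" "cball a r \<subseteq> D" "cball b s \<subseteq> D" "ctl (ball a r) (ball b s)"
        using ab unfolding R_def by blast
      obtain r' s' where 2: "0 < r'" "0 < s'" "cball b r' \<subseteq> D" "cball c s' \<subseteq> D" "ctl (ball b r') (ball c s')"
        using bc unfolding R_def by blast
      \<comment> \<open>The two controls know different balls around \<open>b\<close>; both restrict
        to the smaller one, which has positive measure as transitivity demands.\<close>
      let ?m = "min s r'"
      have "ctl (ball a r) (ball b ?m)" "ctl (ball b ?m) (ball c s')"
        using ctl_mono[OF 1(5), of "ball a r" "ball b ?m"] ctl_mono[OF 2(5), of "ball b ?m" "ball c s'"] subset_ball[of ?m s b] subset_ball[of ?m r' b] by auto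
      then have "ctl (ball a r) (ball c s')"
        by (rule ctl_trans) (use 1 2 bm in auto)
      then show ?thesis using 1(1,3) 2(2,4) unfolding R_def by auto
    qed
    fix a assume "a \<in> D"
    then obtain r where r: "0 < r" "cball a r \<subseteq> D" using D(1) unfolding open_contains_cball by auto
    have "R a z" if z: "z \<in> ball a (r / 2)" for z
    proof -
      have "cball z (r / 2) \<subseteq> cball a r" "ball z (r / 2) \<subseteq> ball a r"
        using z r(1) by (simp_all add: cball_subset_cball_iff ball_subset_ball_iff dist_commute)
      moreover from this have "ctl (ball a r) (ball z (r / 2))"
        using ctl_mono[OF ctl_ball[OF r(2)]] by auto
      ultimately show ?thesis unfolding R_def using r by (intro exI[of _ r] conjI exI[of _ "r / 2"]) auto
    qed
    then show "\<exists>T. openin (top_of_set D) T \<and> a \<in> T \<and> (\<forall>x\<in>T. R a x)"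
      using r by (intro exI[of _ "D \<inter> ball a (r / 2)"]) (auto simp: openin_open \<open>a \<in> D\<close>)
  qed
  \<comment> \<open>The relation provides radii of its own; they are exchanged for the given ones
    through the control of a ball by itself.\<close>
  then obtain r' s' where 1: "0 < r'" "0 < s'" "cball x r' \<subseteq> D" "cball y s' \<subseteq> D" "ctl (ball x r') (ball y s')"
    unfolding R_def by blast
  let ?r = "min r r'" and ?s = "min s s'"
  have a: "ctl (ball x r) (ball x ?r)" by (rule ctl_mono[OF ctl_ball[OF x(1)]]) (simp_all add: subset_ball)
  have b: "ctl (ball x ?r) (ball y ?s)" by (rule ctl_mono[OF 1(5)]) (simp_all add: subset_ball)
  have c: "ctl (ball y ?s) (ball y s)" by (rule ctl_mono[OF ctl_ball[OF y(1)]]) (simp_all add: subset_ball)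
  have "ctl (ball x r) (ball y ?s)" using a b by (rule ctl_trans) (use x y 1 bm in auto)
  then show ?thesis using c by (rule ctl_trans) (use x y 1 bm in auto)
qed

lemma ctl_cover:
  assumes K: "compact K" and S: "S \<in> sets borel" "S \<subseteq> K" and B: "B \<in> sets borel"
    and loc: "\<And>x. x \<in> K \<Longrightarrow> \<exists>r>0. ctl (S \<inter> ball x r) B"
  shows "ctl S B"
proof -
  have "\<forall>x\<in>K. \<exists>r. 0 < r \<and> ctl (S \<inter> ball x r) B" using loc by auto
  then obtain r where r: "\<And>x. x \<in> K \<Longrightarrow> 0 < r x" "\<And>x. x \<in> K \<Longrightarrow> ctl (S \<inter> ball x (r x)) B"
    unfolding bchoice_iff by auto
  have "K \<subseteq> (\<Union>x\<in>K. ball x (r x))" using r(1) by force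
  then obtain I where I: "I \<subseteq> K" "finite I" "K \<subseteq> (\<Union>x\<in>I. ball x (r x))"
    using compactE_image[OF K, of K "\<lambda>x. ball x (r x)"] by auto
  have "ctl (\<Union>x\<in>I. S \<inter> ball x (r x)) B"
    by (rule ctl_UN) (use I r S B in auto)
  then show ?thesis by (rule ctl_mono) (use I S in auto)
qed

lemma ctl_compact:
  assumes K: "compact K" "K \<subseteq> D" and y: "cball y s \<subseteq> D" "0 < s"
  shows "ctl K (ball y s)"
proof (rule ctl_cover[OF K(1)])
  fix x assume "x \<in> K"
  then have "x \<in> D" using K(2) by auto
  then obtain r where r: "0 < r" "cball x r \<subseteq> D" using D(1) unfolding open_contains_cball by auto
  then show "\<exists>r>0. ctl (K \<inter> ball x r) (ball y s)"
    using ctl_mono[OF ctl_balls[OF r(2,1) y], of "K \<inter> ball x r" "ball y s"] by auto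
qed (use K in \<open>auto simp: compact_imp_closed\<close>)

lemma ctl_shift:
  assumes A: "A \<in> sets borel" and B: "B \<in> sets borel" "emeasure lborel B < \<infinity>"
    and sh: "\<And>v E. (v, E) \<in> F \<Longrightarrow> (Lp_int p A (\<lambda>x. \<bar>v (x + h) - v x\<bar>)) \<le> ennreal c * E"
    and AhB: "ctl ((\<lambda>x. x + h) ` A) B"
  shows "ctl A B"
proof -
  have eq: "(\<lambda>x. x + h) ` A = (\<lambda>y. y - h) -` A" by (force simp: image_iff)
  obtain d where d: "emeasure lborel B = ennreal d" "0 \<le> d" using B(2) by (cases "emeasure lborel B") auto
  from AhB obtain c2 where c2: "0 \<le> c2" "\<And>v E. (v, E) \<in> F \<Longrightarrow> osc p v ((\<lambda>y. y - h) -` A) B \<le> ennreal c2 * E"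
    unfolding eq ctl_def by blast
  show ?thesis
  proof (rule ctlI)
    fix v E assume vE: "(v, E) \<in> F"
    have "Lp_int p A (\<lambda>x. \<bar>v (x + h) - v x\<bar>) \<le> ennreal (max c 0) * E"
      using sh[OF vE] by (auto simp: max_def ennreal_neg split: if_splits)
    then have "osc p v A B \<le> ennreal (2 powr p) * (emeasure lborel B * (ennreal (max c 0) * E) + ennreal c2 * E)"
      by (intro order_trans[OF osc_shift[OF p meas[OF vE] A B(1), of h]] mult_left_mono add_mono c2 vE) auto
    also have "\<dots> = ennreal (2 powr p * (d * max c 0 + c2)) * E"
      using d c2 by (simp add: ennreal_mult[symmetric] mult.assoc[symmetric] distrib_right[symmetric] ennreal_plus[symmetric] del: ennreal_plus)
    finally show "osc p v A B \<le> ennreal (2 powr p * (d * max c 0 + c2)) * E" .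
  qed
qed

text \<open>Points of \<open>D\<close> are handled by balls; near a boundary point the piece of
  \<open>S\<close> is shifted so that its closure becomes a compact subset of \<open>D\<close>.
  Compactness of the closure of \<open>S\<close> leaves finitely many pieces.\<close>

lemma ctl_domain:
  assumes S: "S \<in> sets borel" "bounded S" and y: "cball y s \<subseteq> D" "0 < s"
    and bd: "\<And>x. x \<in> closure S \<Longrightarrow> x \<notin> D \<Longrightarrow> \<exists>r>0. \<exists>h c. closure ((\<lambda>x. x + h) ` (S \<inter> ball x r)) \<subseteq> D \<and>
      (\<forall>v E. (v, E) \<in> F \<longrightarrow> (Lp_int p (S \<inter> ball x r) (\<lambda>x. \<bar>v (x + h) - v x\<bar>)) \<le> ennreal c * E)"
  shows "ctl S (ball y s)"
proof (rule ctl_cover)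
  show "compact (closure S)" "S \<subseteq> closure S" "S \<in> sets borel" "ball y s \<in> sets borel"
    using S by (auto simp: closure_subset)
  fix x assume x: "x \<in> closure S"
  show "\<exists>r>0. ctl (S \<inter> ball x r) (ball y s)"
  proof (cases "x \<in> D")
    case True
    then obtain r where r: "0 < r" "cball x r \<subseteq> D" using D(1) unfolding open_contains_cball by auto
    then show ?thesis
      using ctl_mono[OF ctl_balls[OF r(2,1) y], of "S \<inter> ball x r" "ball y s"] by auto
  next
    case False
    from bd[OF x this] obtain r h c where r: "0 < r" and cl: "closure ((\<lambda>x. x + h) ` (S \<inter> ball x r)) \<subseteq> D"
      and sh: "\<And>v E. (v, E) \<in> F \<Longrightarrow> (Lp_int p (S \<inter> ball x r) (\<lambda>x. \<bar>v (x + h) - v x\<bar>)) \<le> ennreal c * E"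
      by blast
    have "bounded ((\<lambda>x. x + h) ` (S \<inter> ball x r))"
      using bounded_translation[of "S \<inter> ball x r" h] S(2) by (auto simp: add.commute bounded_Int)
    then have "ctl (closure ((\<lambda>x. x + h) ` (S \<inter> ball x r))) (ball y s)"
      by (intro ctl_compact cl y) auto
    then have "ctl ((\<lambda>x. x + h) ` (S \<inter> ball x r)) (ball y s)"
      by (rule ctl_mono) (auto simp: closure_subset)
    then have "ctl (S \<inter> ball x r) (ball y s)"
      by (intro ctl_shift[OF _ _ _ sh]) (use S ball_emeasure in auto)
    then show ?thesis using r by blast
  qed
qed

end

section \<open>The geometry of a single hole\<close>

lemma smooth_on_UNIV_continuous:
  assumes "smooth_on UNIV g"
  shows "continuous_on S g"
proof -
  have "continuous_on UNIV (iter_dd [] g)" using assms unfolding smooth_on_def by blast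
  then show ?thesis by (auto intro: continuous_on_subset)
qed

lemma smooth_on_UNIV_lipschitz:
  fixes g :: "'a::euclidean_space \<Rightarrow> real"
  assumes "smooth_on UNIV g"
  obtains L where "0 \<le> L" "\<And>x y. x \<in> cball a R \<Longrightarrow> y \<in> cball a R \<Longrightarrow> \<bar>g x - g y\<bar> \<le> L * norm (x - y)"
proof -
  have d: "g differentiable (at x)" for x
  proof -
    have "iter_dd [] g differentiable (at x)" using assms unfolding smooth_on_def by blast
    then show ?thesis by simp
  qed
  have "\<exists>M. \<forall>x\<in>cball a R. \<bar>frechet_derivative g (at x) b\<bar> \<le> M" for b
  proof -
    have "continuous_on UNIV (iter_dd [b] g)" using assms unfolding smooth_on_def by blast
    then have "continuous_on (cball a R) (\<lambda>x. frechet_derivative g (at x) b)"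
      by (auto intro: continuous_on_subset)
    then have "bounded ((\<lambda>x. frechet_derivative g (at x) b) ` cball a R)"
      by (intro compact_imp_bounded compact_continuous_image) auto
    then show ?thesis unfolding bounded_iff by auto
  qed
  then have "\<forall>b. \<exists>M. \<forall>x\<in>cball a R. \<bar>frechet_derivative g (at x) b\<bar> \<le> M" by simp
  from choice[OF this] obtain M where M: "\<And>b x. x \<in> cball a R \<Longrightarrow> \<bar>frechet_derivative g (at x) b\<bar> \<le> M b"
    by blast
  let ?L = "\<Sum>b\<in>Basis. \<bar>M b\<bar>"
  show ?thesis
  proof (rule that)
    show "0 \<le> ?L" by (simp add: sum_nonneg)
    fix x y assume xy: "x \<in> cball a R" "y \<in> cball a R"
    have "norm (g x - g y) \<le> ?L * norm (x - y)"
    proof (rule differentiable_bound)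
      show "convex (cball a R)" by simp
      fix z assume z: "z \<in> cball a R"
      show D: "(g has_derivative frechet_derivative g (at z)) (at z within cball a R)"
        by (rule has_derivative_at_withinI[OF d[of z, unfolded frechet_derivative_works]])
      have lin: "linear (frechet_derivative g (at z))" by (rule linear_frechet_derivative[OF d])
      show "onorm (frechet_derivative g (at z)) \<le> ?L"
      proof (rule onorm_le)
        fix v :: 'a
        have "frechet_derivative g (at z) v = frechet_derivative g (at z) (\<Sum>b\<in>Basis. (v \<bullet> b) *\<^sub>R b)"
          by (simp add: euclidean_representation)
        also have "\<dots> = (\<Sum>b\<in>Basis. (v \<bullet> b) * frechet_derivative g (at z) b)"
          by (simp add: linear_sum[OF lin] linear_cmul[OF lin])
        also have "\<bar>\<dots>\<bar> \<le> (\<Sum>b\<in>Basis. \<bar>(v \<bullet> b) * frechet_derivative g (at z) b\<bar>)" by (rule sum_abs)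
        also have "\<dots> \<le> (\<Sum>b\<in>Basis. norm v * \<bar>M b\<bar>)"
        proof (intro sum_mono)
          fix b :: 'a assume "b \<in> Basis"
          then show "\<bar>(v \<bullet> b) * frechet_derivative g (at z) b\<bar> \<le> norm v * \<bar>M b\<bar>"
            unfolding abs_mult using M[OF z, of b] by (intro mult_mono Basis_le_norm) auto
        qed
        also have "\<dots> = ?L * norm v" by (subst sum_distrib_right) (simp add: mult.commute)
        finally show "norm (frechet_derivative g (at z) v) \<le> ?L * norm v" by simp
      qed
    qed (use xy in auto)
    then show "\<bar>g x - g y\<bar> \<le> ?L * norm (x - y)" by simp
  qed
qed

text \<open>Signed height above the graph of \<open>g\<close> in direction \<nu>, the argument of
  \<open>g\<close> being the projection to the orthogonal complement of \<nu>. A shift along \<nu>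
  changes it by exactly the length of the shift, which is what the Hardy estimate asks of \<delta>
  and what the distance to the boundary fails to do in general.\<close>

definition height :: "'a::euclidean_space \<Rightarrow> ('a \<Rightarrow> real) \<Rightarrow> 'a \<Rightarrow> real" where
  "height \<nu> g y = y \<bullet> \<nu> - g (y - (y \<bullet> \<nu>) *\<^sub>R \<nu>)"

lemma height_shift: "norm \<nu> = 1 \<Longrightarrow> height \<nu> g (y + t *\<^sub>R \<nu>) = height \<nu> g y + t"
  by (simp add: height_def inner_add_left dot_square_norm algebra_simps)

lemma height_continuous: "continuous_on UNIV g \<Longrightarrow> continuous_on S (height \<nu> g)"
  unfolding height_def
  by (intro continuous_intros continuous_on_compose2[of UNIV g S]) auto

text \<open>Points of height at most 0 are limits of points of \<open>U\<close>, obtained by moving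
  along - \<nu>, while points of positive height have a neighbourhood that misses
  \<open>U\<close>.\<close>

lemma height_chart:
  assumes U: "open U" and x0: "x0 \<in> frontier U" and r: "0 < r" and \<nu>: "norm \<nu> = 1" and g: "continuous_on UNIV g"
    and chart: "U \<inter> ball x0 r = {y \<in> ball x0 r. y \<bullet> \<nu> < g (y - (y \<bullet> \<nu>) *\<^sub>R \<nu>)}"
  shows height_neg_iff: "\<And>y. y \<in> ball x0 r \<Longrightarrow> y \<in> U \<longleftrightarrow> height \<nu> g y < 0"
    and height_le_iff: "\<And>y. y \<in> ball x0 r \<Longrightarrow> y \<in> closure U \<longleftrightarrow> height \<nu> g y \<le> 0"
    and height_zero: "height \<nu> g x0 = 0"
proof -
  show 1: "y \<in> U \<longleftrightarrow> height \<nu> g y < 0" if "y \<in> ball x0 r" for y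
  proof -
    have "y \<in> U \<inter> ball x0 r \<longleftrightarrow> y \<in> ball x0 r \<and> y \<bullet> \<nu> < g (y - (y \<bullet> \<nu>) *\<^sub>R \<nu>)"
      unfolding chart by simp
    then show ?thesis using that by (simp add: height_def)
  qed
  show 2: "y \<in> closure U \<longleftrightarrow> height \<nu> g y \<le> 0" if y: "y \<in> ball x0 r" for y
  proof
    assume "height \<nu> g y \<le> 0"
    have "\<exists>z\<in>U. dist z y < e" if "0 < e" for e
    proof -
      have "dist x0 y < r" using y by simp
      define t where "t = min (e / 2) ((r - dist x0 y) / 2)"
      have t: "0 < t" "t < e" "t < r - dist x0 y"
        using \<open>0 < e\<close> \<open>dist x0 y < r\<close> by (auto simp: t_def min_less_iff_disj)
      let ?z = "y + (- t) *\<^sub>R \<nu>"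
      have d: "dist ?z y = t" using \<nu> t by (simp add: dist_norm)
      have "?z \<in> ball x0 r" using dist_triangle[of x0 ?z y] d t by (simp add: dist_commute)
      moreover have "height \<nu> g ?z < 0" using \<open>height \<nu> g y \<le> 0\<close> t by (simp only: height_shift[OF \<nu>])
      ultimately have "?z \<in> U" using 1 by blast
      then show ?thesis using d t by (intro bexI[of _ ?z]) auto
    qed
    then show "y \<in> closure U" by (simp add: closure_approachable)
  next
    assume yc: "y \<in> closure U"
    show "height \<nu> g y \<le> 0"
    proof (rule ccontr)
      assume neg: "\<not> height \<nu> g y \<le> 0"
      have "open (ball x0 r \<inter> height \<nu> g -` {0<..})"
        using continuous_on_open_vimage[of "ball x0 r" "height \<nu> g"] height_continuous[OF g] by (auto simp: Int_commute)
      moreover have "y \<in> ball x0 r \<inter> height \<nu> g -` {0<..}" using y neg by auto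
      ultimately have "(ball x0 r \<inter> height \<nu> g -` {0<..}) \<inter> U \<noteq> {}"
        using yc open_Int_closure_eq_empty[of "ball x0 r \<inter> height \<nu> g -` {0<..}" U] by auto
      then obtain z where "z \<in> ball x0 r" "0 < height \<nu> g z" "z \<in> U" by auto
      then show False using 1[of z] by simp
    qed
  qed
  have "x0 \<in> closure U" "x0 \<notin> U" using x0 U by (auto simp: frontier_def interior_open)
  then show "height \<nu> g x0 = 0" using 1[of x0] 2[of x0] r by auto
qed

text \<open>Above the graph every nearby exterior point can be pushed up by \<open>s\<close> along
  \<nu> without meeting the closure of \<open>U\<close>; it then lands in one fixed ball around
  \<open>z\<close>, which joins all such points.\<close>

lemma exterior_locally_connected:
  assumes U: "open U" and x0: "x0 \<in> frontier U" and sm: "smooth_boundary U" and e: "0 < e"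
  obtains d z where "0 < d" "z \<in> ball x0 e - closure U"
    "\<And>y. y \<in> ball x0 d - closure U \<Longrightarrow> \<exists>C. connected C \<and> y \<in> C \<and> z \<in> C \<and> C \<subseteq> ball x0 e - closure U"
    "x0 \<in> closure (- closure U)"
proof -
  obtain r \<nu> g where r: "0 < r" and \<nu>: "norm \<nu> = 1" and g: "smooth_on UNIV g"
    and chart: "U \<inter> ball x0 r = {y \<in> ball x0 r. y \<bullet> \<nu> < g (y - (y \<bullet> \<nu>) *\<^sub>R \<nu>)}"
    using sm x0 unfolding smooth_boundary_def by blast
  note gc = smooth_on_UNIV_continuous[OF g]
  note ch = height_chart[OF U x0 r \<nu> gc chart]
  let ?h = "height \<nu> g"
  define s where "s = min r e / 2"
  have s: "0 < s" "s < r" "s < e" using r e by (auto simp: s_def)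
  let ?z = "x0 + s *\<^sub>R \<nu>"
  have hz: "?h ?z = s" by (simp add: height_shift[OF \<nu>] ch(3))
  have "open (?h -` {0<..})" using height_continuous[OF gc, of UNIV] continuous_on_open_vimage[of UNIV ?h] by auto
  moreover have "?z \<in> ?h -` {0<..}" using hz s by simp
  ultimately obtain d0 where d0: "0 < d0" "ball ?z d0 \<subseteq> ?h -` {0<..}" unfolding open_contains_ball by blast
  \<comment> \<open>Small enough that the ball around the pushed-up centre stays above the graph,
    and that pushing up by \<open>s\<close> leaves neither the chart nor the ball of radius
    \<open>e\<close>.\<close>
  define d where "d = min d0 (s / 2)"
  have d: "0 < d" "d \<le> d0" "d + s < r" "d + s < e" using d0 s r e by (auto simp: d_def s_def min_def)
  have near: "y + t *\<^sub>R \<nu> \<in> ball x0 (d + s)" if "y \<in> ball x0 d" "0 \<le> t" "t \<le> s" for y t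
  proof -
    have "dist x0 (y + t *\<^sub>R \<nu>) \<le> dist x0 y + dist y (y + t *\<^sub>R \<nu>)" by (rule dist_triangle)
    also have "dist y (y + t *\<^sub>R \<nu>) = t" using \<nu> that by (simp add: dist_norm)
    finally show ?thesis using that by simp
  qed
  have ext: "y \<in> ball x0 e - closure U" if "y \<in> ball x0 (d + s)" "0 < ?h y" for y
    using ch(2)[of y] that d by auto
  have zin: "ball ?z d \<subseteq> ball x0 e - closure U"
  proof
    fix y assume y: "y \<in> ball ?z d"
    have "dist x0 y \<le> dist x0 ?z + dist ?z y" by (rule dist_triangle)
    then have "y \<in> ball x0 (d + s)" using y \<nu> s by (simp add: dist_norm)
    then show "y \<in> ball x0 e - closure U" using subsetD[OF d0(2), of y] d y by (intro ext) auto
  qed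
  show ?thesis
  proof (rule that)
    show "?z \<in> ball x0 e - closure U" using subsetD[OF zin, of ?z] d by simp
    show "0 < d" by fact
    fix y assume y: "y \<in> ball x0 d - closure U"
    then have hy: "0 < ?h y" using ch(2)[of y] d s by auto
    let ?C = "closed_segment y (y + s *\<^sub>R \<nu>) \<union> ball ?z d"
    have "y + s *\<^sub>R \<nu> \<in> ball ?z d" using y by (simp add: dist_norm)
    then have "connected ?C"
      by (intro connected_Un) auto
    moreover have "closed_segment y (y + s *\<^sub>R \<nu>) \<subseteq> ball x0 e - closure U"
    proof
      fix q assume "q \<in> closed_segment y (y + s *\<^sub>R \<nu>)"
      then obtain u where "0 \<le> u" "u \<le> 1" "q = y + (u * s) *\<^sub>R \<nu>"
        unfolding in_segment by (auto simp: algebra_simps)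
      moreover from this have "u * s \<le> s" using s by (simp add: mult_left_le_one_le)
      ultimately show "q \<in> ball x0 e - closure U"
        using near[of y "u * s"] y hy s by (intro ext) (auto simp: height_shift[OF \<nu>] add_pos_nonneg)
    qed
    ultimately show "\<exists>C. connected C \<and> y \<in> C \<and> ?z \<in> C \<and> C \<subseteq> ball x0 e - closure U"
      using zin d by (intro exI[of _ ?C]) auto
  next
    show "x0 \<in> closure (- closure U)"
      unfolding closure_approachable
    proof (intro allI impI)
      fix k :: real assume "0 < k"
      define t where "t = min (k / 2) s"
      have t: "0 < t" "t < k" "t \<le> s" using \<open>0 < k\<close> s by (auto simp: t_def)
      have "x0 + t *\<^sub>R \<nu> \<in> ball x0 e - closure U"
        using near[of x0 t] t d ch(3) by (intro ext) (auto simp: height_shift[OF \<nu>])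
      then show "\<exists>y\<in>- closure U. dist y x0 < k"
        using \<nu> t by (intro bexI[of _ "x0 + t *\<^sub>R \<nu>"]) (auto simp: dist_norm)
    qed
  qed
qed

text \<open>Removing the closure, and not only \<open>U\<close>, keeps the set open and, for
  nonempty \<open>U\<close>, the distance to \<open>U\<close> positive on it.\<close>

definition collar :: "'a::euclidean_space set \<Rightarrow> real \<Rightarrow> 'a set" where
  "collar U \<rho> = {x. infdist x U < \<rho>} - closure U"

lemma open_collar: "open (collar U \<rho>)"
proof -
  have "open {x. infdist x U < \<rho>}"
    by (intro open_Collect_less continuous_intros)
  then show ?thesis unfolding collar_def by (simp add: open_Diff)
qed

lemma infdist_closure: "infdist x (closure U) = infdist x U"
  by (simp add: infdist_eq_setdist)

text \<open>Walking straight to a nearest point of the closure stays in the collar: the distance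
  does not grow, and meeting the closure earlier would contradict minimality.\<close>

lemma collar_nearest_segment:
  assumes x: "x \<in> collar U \<rho>" and U: "open U" "U \<noteq> {}"
  obtains q where "q \<in> frontier U" "dist x q = infdist x U"
    "\<And>t. 0 \<le> t \<Longrightarrow> t < 1 \<Longrightarrow> x + t *\<^sub>R (q - x) \<in> collar U \<rho>"
proof -
  have "closure U \<noteq> {}" using U(2) by simp
  then obtain q where q: "q \<in> closure U" "infdist x (closure U) = dist x q"
    using infdist_attains_inf[of "closure U" x] by auto
  then have dq: "infdist x U = dist x q" by (simp add: infdist_closure)
  have xq: "dist x q < \<rho>" "x \<notin> closure U" using x dq by (auto simp: collar_def)
  then have pos: "0 < dist x q" using q(1) by (auto simp: zero_less_dist_iff)
  have col: "x + t *\<^sub>R (q - x) \<in> collar U \<rho>" if t: "0 \<le> t" "t < 1" for t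
  proof -
    let ?y = "x + t *\<^sub>R (q - x)"
    have "?y - q = (1 - t) *\<^sub>R (x - q)" by (simp add: algebra_simps)
    then have yq: "dist ?y q = (1 - t) * dist x q" using t by (simp add: dist_norm)
    have xy: "dist x ?y = t * dist x q" using t by (simp add: dist_norm norm_minus_commute)
    have "infdist ?y U = infdist ?y (closure U)" by (simp add: infdist_closure)
    also have "\<dots> \<le> dist ?y q" by (rule infdist_le[OF q(1)])
    also have "\<dots> \<le> dist x q" unfolding yq using t pos by (simp add: mult_left_le_one_le)
    finally have 1: "infdist ?y U < \<rho>" using xq by simp
    have "?y \<notin> closure U"
    proof
      assume "?y \<in> closure U"
      then have "infdist x (closure U) \<le> dist x ?y" by (rule infdist_le)
      then have "dist x q \<le> t * dist x q" using dq xy by (simp add: infdist_closure)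
      then show False using t pos by simp
    qed
    then show ?thesis using 1 by (simp add: collar_def)
  qed
  have "q \<notin> U"
  proof
    assume "q \<in> U"
    then obtain e where e: "0 < e" "ball q e \<subseteq> U" using U(1) unfolding open_contains_ball by auto
    \<comment> \<open>Were \<open>q\<close> in the open set \<open>U\<close>, this point of the
      segment would be within \<open>e\<close> of \<open>q\<close> and hence in \<open>U\<close>,
      although the segment avoids the closure.\<close>
    define t where "t = max 0 (1 - e / (2 * dist x q))"
    have t: "0 \<le> t" "t < 1" "1 - t \<le> e / (2 * dist x q)" using e pos by (auto simp: t_def)
    let ?y = "x + t *\<^sub>R (q - x)"
    have "?y - q = (1 - t) *\<^sub>R (x - q)" by (simp add: algebra_simps)
    then have "dist ?y q = (1 - t) * dist x q" using t by (simp add: dist_norm)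
    also have "\<dots> \<le> e / (2 * dist x q) * dist x q" using t pos by (intro mult_right_mono) auto
    also have "\<dots> < e" using e pos by simp
    finally have "?y \<in> U" using e(2) by (auto simp: dist_commute)
    then show False using col[OF t(1,2)] closure_subset by (auto simp: collar_def)
  qed
  then have "q \<in> frontier U" using q(1) U(1) by (simp add: frontier_def interior_open)
  then show ?thesis using that[of q] dq col by metis
qed

text \<open>A separation of the collar would separate the frontier: the closures of the two parts
  both reach it, by walking to nearest points; they cover it; and they are disjoint on it because
  the exterior is locally connected at every boundary point.\<close>

lemma connected_collar:
  assumes U: "open U" "U \<noteq> {}" and sm: "smooth_boundary U" and con: "connected (frontier U)" and \<rho>: "0 < \<rho>"
  shows "connected (collar U \<rho>)"
  unfolding connected_def
proof (rule notI, elim exE conjE)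
  let ?D = "collar U \<rho>"
  fix A B assume AB: "open A" "open B" "?D \<subseteq> A \<union> B" "A \<inter> B \<inter> ?D = {}" "A \<inter> ?D \<noteq> {}" "B \<inter> ?D \<noteq> {}"
  have sub: "ball x \<rho> - closure U \<subseteq> ?D" if "x \<in> frontier U" for x
  proof
    fix y assume y: "y \<in> ball x \<rho> - closure U"
    have "infdist y (closure U) \<le> dist y x" using that by (intro infdist_le) (simp add: frontier_def)
    then show "y \<in> ?D" using y by (auto simp: collar_def dist_commute infdist_closure)
  qed
  have touch: "\<exists>q\<in>frontier U. q \<in> closure (P \<inter> ?D)"
    if P: "P \<inter> ?D \<noteq> {}" and PQ: "open P" "open Q" "?D \<subseteq> P \<union> Q" "P \<inter> Q \<inter> ?D = {}" for P Q
  proof -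
    obtain x where x: "x \<in> P" "x \<in> ?D" using P by auto
    obtain q where q: "q \<in> frontier U" "dist x q = infdist x U"
      "\<And>t. 0 \<le> t \<Longrightarrow> t < 1 \<Longrightarrow> x + t *\<^sub>R (q - x) \<in> ?D"
      using collar_nearest_segment[OF x(2) U] by metis
    let ?f = "\<lambda>t. x + t *\<^sub>R (q - x)"
    let ?C = "?f ` {0..<1}"
    have "connected ?C" by (intro connected_continuous_image continuous_intros) auto
    moreover have CD: "?C \<subseteq> ?D" using q(3) by auto
    moreover have "x \<in> ?C" by (intro image_eqI[of _ _ 0]) auto
    ultimately have CP: "?C \<subseteq> P"
      using connectedD[of ?C P Q] PQ x by (simp add: disjoint_iff subset_eq) blast
    have "(\<lambda>n. ?f (1 - inverse (real (Suc n)))) \<longlonglongrightarrow> ?f (1 - 0)"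
      by (intro tendsto_intros LIMSEQ_inverse_real_of_nat)
    moreover have "?f (1 - inverse (real (Suc n))) \<in> P \<inter> ?D" for n
    proof -
      have "1 - inverse (real (Suc n)) \<in> {0..<1}" by (auto simp: field_simps)
      then show ?thesis using CP CD by blast
    qed
    ultimately have "q \<in> closure (P \<inter> ?D)"
      unfolding closure_sequential by (intro exI[of _ "\<lambda>n. ?f (1 - inverse (real (Suc n)))"]) auto
    then show ?thesis using q(1) by auto
  qed
  let ?FA = "closure (A \<inter> ?D)" and ?FB = "closure (B \<inter> ?D)"
  have 1: "frontier U \<inter> ?FA \<noteq> {}" using touch[OF AB(5,1,2,3,4)] by auto
  have BA: "?D \<subseteq> B \<union> A" "B \<inter> A \<inter> ?D = {}" using AB(3,4) by auto
  have 2: "frontier U \<inter> ?FB \<noteq> {}" using touch[OF AB(6,2,1) BA] by auto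
  have disj: "x \<notin> ?FA \<or> x \<notin> ?FB" and cov: "x \<in> ?FA \<union> ?FB" if x: "x \<in> frontier U" for x
  proof -
    obtain d z where dz: "0 < d" "z \<in> ball x \<rho> - closure U"
      "\<And>y. y \<in> ball x d - closure U \<Longrightarrow> \<exists>C. connected C \<and> y \<in> C \<and> z \<in> C \<and> C \<subseteq> ball x \<rho> - closure U"
      "x \<in> closure (- closure U)"
      using exterior_locally_connected[OF U(1) x sm \<rho>] by metis
    \<comment> \<open>A point of \<open>P\<close> close enough to the boundary point is joined to
      \<open>z\<close> inside the collar, so \<open>z\<close> lies in \<open>P\<close> as well; and
      \<open>z\<close> cannot lie in both parts.\<close>
    have side: "z \<in> P" if xc: "x \<in> closure (P \<inter> ?D)" and PQ: "open P" "open Q" "?D \<subseteq> P \<union> Q" "P \<inter> Q \<inter> ?D = {}" for P Q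
    proof -
      obtain y where y: "y \<in> P \<inter> ?D" "dist y x < d" using xc dz(1) unfolding closure_approachable by blast
      then have "y \<in> ball x d - closure U" by (auto simp: collar_def dist_commute)
      from dz(3)[OF this] obtain C where C: "connected C" "y \<in> C" "z \<in> C" "C \<subseteq> ball x \<rho> - closure U" by auto
      then have "C \<subseteq> ?D" using sub[OF x] by auto
      then show ?thesis using connectedD[OF C(1) PQ(1,2)] C(2,3) PQ(3,4) y(1) by (auto simp: disjoint_iff)
    qed
    have zD: "z \<in> ?D" using dz(2) sub[OF x] by auto
    show "x \<notin> ?FA \<or> x \<notin> ?FB"
    proof (rule ccontr)
      assume "\<not> ?thesis"
      then have "z \<in> A" "z \<in> B" using side[OF _ AB(1-4)] side[OF _ AB(2,1) BA] by auto
      then show False using AB(4) zD by auto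
    qed
    have "x \<in> closure ?D" unfolding closure_approachable
    proof (intro allI impI)
      fix k :: real assume "0 < k"
      then obtain y where "y \<in> - closure U" "dist y x < min k \<rho>"
        using dz(4) \<rho> unfolding closure_approachable by (metis min_less_iff_conj)
      then show "\<exists>y\<in>?D. dist y x < k" using sub[OF x] by (intro bexI[of _ y]) (auto simp: dist_commute)
    qed
    moreover have "?D = (A \<inter> ?D) \<union> (B \<inter> ?D)" using AB(3) by auto
    ultimately show "x \<in> ?FA \<union> ?FB" by (metis closure_Un)
  qed
  have "closed ?FA" "closed ?FB" by auto
  moreover have "frontier U \<subseteq> ?FA \<union> ?FB" using cov by blast
  moreover have "?FA \<inter> ?FB \<inter> frontier U = {}" using disj by blast
  moreover have "?FA \<inter> frontier U \<noteq> {}" "?FB \<inter> frontier U \<noteq> {}" using 1 2 by (simp_all add: Int_commute)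
  ultimately have "\<exists>A B. closed A \<and> closed B \<and> frontier U \<subseteq> A \<union> B \<and> A \<inter> B \<inter> frontier U = {} \<and> A \<inter> frontier U \<noteq> {} \<and> B \<inter> frontier U \<noteq> {}"
    by (rule_tac exI[of _ ?FA], rule_tac exI[of _ ?FB]) simp
  then show False using con unfolding connected_closed by (rule notE[rotated])
qed

text \<open>A part of a separation of the closure that missed the frontier would be open and closed
  in the whole space, which boundedness excludes. So both parts meet the frontier and separate
  it.\<close>

lemma connected_closure_of_connected_frontier:
  fixes U :: "'a::euclidean_space set"
  assumes U: "open U" "bounded U" and con: "connected (frontier U)"
  shows "connected (closure U)"
  unfolding connected_closed
proof (rule notI, elim exE conjE)
  fix A B assume AB: "closed A" "closed B" "closure U \<subseteq> A \<union> B" "A \<inter> B \<inter> closure U = {}" "A \<inter> closure U \<noteq> {}" "B \<inter> closure U \<noteq> {}"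
  have fr: "frontier U \<subseteq> closure U" by (simp add: frontier_def)
  have hit: "P \<inter> frontier U \<noteq> {}" if PQ: "closed P" "closed Q" "closure U \<subseteq> P \<union> Q" "P \<inter> Q \<inter> closure U = {}" "P \<inter> closure U \<noteq> {}" for P Q
  proof
    assume em: "P \<inter> frontier U = {}"
    have "closure U = U \<union> frontier U" using closure_Un_frontier[of U] closure_subset[of U] by (auto simp: frontier_def)
    then have eq: "P \<inter> closure U = U \<inter> (- Q)" using em PQ(3,4) by (simp add: set_eq_iff subset_eq) metis
    have "closed (P \<inter> closure U)" using PQ(1) by auto
    moreover have "open (P \<inter> closure U)" unfolding eq using U(1) PQ(2) by auto
    ultimately have "P \<inter> closure U = UNIV" using PQ(5) clopen[of "P \<inter> closure U"] by simp
    then have "closure U = UNIV" by auto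
    then show False using bounded_closure[OF U(2)] not_bounded_UNIV by simp
  qed
  have BA: "closure U \<subseteq> B \<union> A" "B \<inter> A \<inter> closure U = {}" using AB(3,4) by auto
  have "A \<inter> frontier U \<noteq> {}" by (rule hit[OF AB(1-5)])
  moreover have "B \<inter> frontier U \<noteq> {}" by (rule hit[OF AB(2,1) BA AB(6)])
  moreover have "frontier U \<subseteq> A \<union> B" "A \<inter> B \<inter> frontier U = {}" using AB(3,4) fr by auto
  ultimately have "\<exists>A B. closed A \<and> closed B \<and> frontier U \<subseteq> A \<union> B \<and> A \<inter> B \<inter> frontier U = {} \<and> A \<inter> frontier U \<noteq> {} \<and> B \<inter> frontier U \<noteq> {}"
    using AB(1,2) by (rule_tac exI[of _ A], rule_tac exI[of _ B]) simp
  then show False using con unfolding connected_closed by (rule notE[rotated])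
qed

lemma collar_inner_bound:
  fixes U :: "'a::euclidean_space set"
  assumes U: "U \<noteq> {}" and b: "cball a r \<subseteq> collar U s"
  shows "\<exists>m>0. \<forall>y\<in>cball a r. m \<le> infdist y U"
proof (cases "cball a r = {}")
  case False
  have "continuous_on (cball a r) (\<lambda>y. infdist y U)" by (intro continuous_intros)
  then obtain z where z: "z \<in> cball a r" "\<And>y. y \<in> cball a r \<Longrightarrow> infdist z U \<le> infdist y U"
    using continuous_attains_inf[OF compact_cball False] by blast
  have "z \<notin> closure U" using z(1) b by (auto simp: collar_def)
  then have "0 < infdist z U" using in_closure_iff_infdist_zero[OF U, of z] infdist_nonneg[of z U] by auto
  then show ?thesis using z(2) by blast
qed (auto intro: exI[of _ 1])

lemma bounded_collar:
  fixes U :: "'a::euclidean_space set"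
  assumes U: "bounded U" "U \<noteq> {}"
  shows "bounded (collar U s)"
proof (cases "0 < s")
  case True
  have "collar U s \<subseteq> {x. infdist x (closure U) \<le> s}" by (auto simp: collar_def infdist_closure)
  moreover have "compact {x. infdist x (closure U) \<le> s}"
    using U True by (intro compact_infdist_le) auto
  ultimately show ?thesis using compact_imp_bounded bounded_subset by blast
next
  case False
  then have "x \<notin> collar U s" for x using infdist_nonneg[of x U] by (simp add: collar_def)
  then have "collar U s = {}" by auto
  then show ?thesis by simp
qed

section \<open>Weighted Poincare inequality on the collar of one hole\<close>

lemma borel_measurable_infdist [measurable]:
  "(\<lambda>x. infdist x A) \<in> borel_measurable (borel :: 'a::euclidean_space measure)"
  by (intro borel_measurable_continuous_onI continuous_intros)

lemma sets_borel_collar [measurable]: "collar U \<rho> \<in> sets borel"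
  using open_collar by (rule borel_open)

text \<open>Compares height with distance, so that the height weight of the Hardy estimate can be
  replaced by the distance to \<open>U\<close>.\<close>

lemma height_lipschitz:
  fixes \<nu> :: "'a::euclidean_space"
  assumes \<nu>: "norm \<nu> = 1" and g: "smooth_on UNIV g"
  obtains M where "1 \<le> M" "\<And>y q. y \<in> ball x0 r \<Longrightarrow> q \<in> ball x0 r \<Longrightarrow> height \<nu> g y - height \<nu> g q \<le> M * dist y q"
proof -
  \<comment> \<open>The projection at most doubles the norm, so this ball contains the projection of
    the whole chart.\<close>
  define R where "R = 2 * (norm x0 + r)"
  obtain L where L: "0 \<le> L" "\<And>x y. x \<in> cball 0 R \<Longrightarrow> y \<in> cball 0 R \<Longrightarrow> \<bar>g x - g y\<bar> \<le> L * norm (x - y)"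
    using smooth_on_UNIV_lipschitz[OF g, of 0 R] by auto
  let ?P = "\<lambda>y. y - (y \<bullet> \<nu>) *\<^sub>R \<nu>"
  have P2: "norm (?P y) \<le> 2 * norm y" for y
  proof -
    have "norm (?P y) \<le> norm y + norm ((y \<bullet> \<nu>) *\<^sub>R \<nu>)" by (rule norm_triangle_ineq4)
    also have "norm ((y \<bullet> \<nu>) *\<^sub>R \<nu>) \<le> norm y" using Cauchy_Schwarz_ineq2[of y \<nu>] \<nu> by simp
    finally show ?thesis by simp
  qed
  have PR: "?P y \<in> cball 0 R" if "y \<in> ball x0 r" for y
  proof -
    have "norm y \<le> norm x0 + norm (y - x0)" by norm
    then have "norm y \<le> norm x0 + r" using that by (simp add: dist_norm norm_minus_commute)
    then show ?thesis using P2[of y] by (simp add: R_def)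
  qed
  show ?thesis
  proof (rule that[of "1 + 2 * L"])
    show "1 \<le> 1 + 2 * L" using L by simp
    fix y q assume yq: "y \<in> ball x0 r" "q \<in> ball x0 r"
    have "height \<nu> g y - height \<nu> g q = (y - q) \<bullet> \<nu> + (g (?P q) - g (?P y))"
      by (simp add: height_def inner_diff_left)
    also have "(y - q) \<bullet> \<nu> \<le> norm (y - q)" using Cauchy_Schwarz_ineq2[of "y - q" \<nu>] \<nu> by simp
    also have "g (?P q) - g (?P y) \<le> L * norm (?P q - ?P y)" using L(2)[OF PR PR, OF yq(2,1)] by simp
    also have "?P q - ?P y = ?P (q - y)" by (simp add: algebra_simps inner_diff_left)
    also have "L * norm (?P (q - y)) \<le> L * (2 * norm (q - y))" by (intro mult_left_mono P2 L)
    finally show "height \<nu> g y - height \<nu> g q \<le> (1 + 2 * L) * dist y q"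
      by (simp add: dist_norm norm_minus_commute algebra_simps)
  qed
qed

text \<open>The Hardy estimate with \<delta> = height / s and shift s \<nu>, so that \<delta> grows
  at unit rate in t. Afterwards the height is bounded by \<open>M\<close> times the distance to
  \<open>U\<close>.\<close>

lemma collar_boundary_shift:
  fixes U :: "'a::euclidean_space set"
  assumes p: "1 < p" and U: "open U" and sm: "smooth_boundary U" and x0: "x0 \<in> frontier U" and \<rho>: "0 < \<rho>"
  shows "\<exists>r>0. \<exists>h c. closure ((\<lambda>x. x + h) ` (collar U (\<rho> / 2) \<inter> ball x0 r)) \<subseteq> collar U \<rho> \<and>
    (\<forall>u g. upper_gradient (collar U \<rho>) u g \<longrightarrow>
      (Lp_int p (collar U (\<rho> / 2) \<inter> ball x0 r) (\<lambda>x. \<bar>u (x + h) - u x\<bar>))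
      \<le> ennreal c * (Lp_int p (collar U \<rho>) (\<lambda>x. infdist x U * g x)))"
proof -
  obtain r \<nu> g where r: "0 < r" and \<nu>: "norm \<nu> = 1" and g: "smooth_on UNIV g"
    and chart: "U \<inter> ball x0 r = {y \<in> ball x0 r. y \<bullet> \<nu> < g (y - (y \<bullet> \<nu>) *\<^sub>R \<nu>)}"
    using sm x0 unfolding smooth_boundary_def by blast
  note gc = smooth_on_UNIV_continuous[OF g]
  note ch = height_chart[OF U x0 r \<nu> gc chart]
  let ?h = "height \<nu> g"
  obtain M where M: "1 \<le> M" "\<And>y q. y \<in> ball x0 r \<Longrightarrow> q \<in> ball x0 r \<Longrightarrow> ?h y - ?h q \<le> M * dist y q"
    using height_lipschitz[OF \<nu> g, of x0 r] by auto
  \<comment> \<open>A ball of radius \<open>e\<close> lies in the chart and within \<rho> of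
    \<open>U\<close>. With \<open>s\<close> a quarter of it, a layer of radius \<open>s\<close>
    shifted by at most \<open>s\<close> stays within e / 2.\<close>
  define e where "e = min r \<rho> / 2"
  have e: "0 < e" "e \<le> r / 2" "e < r" "e < \<rho>" using r \<rho> by (auto simp: e_def min_def)
  define s where "s = e / 4"
  have s: "0 < s" "s = e / 4" using e by (auto simp: s_def)
  define K where "K = ball x0 e \<inter> ?h -` {0<..}"
  have hm[measurable]: "?h \<in> borel_measurable borel"
    using height_continuous[OF gc, of UNIV] by (rule borel_measurable_continuous_onI)
  have K[measurable]: "K \<in> sets borel"
    unfolding K_def using measurable_sets[OF hm, of "{0<..}"] by auto
  have x0c: "x0 \<in> closure U" using x0 by (simp add: frontier_def)
  have U0: "U \<noteq> {}" using x0c by auto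
  have Kcol: "K \<subseteq> collar U \<rho>"
  proof
    fix y assume y: "y \<in> K"
    have "infdist y (closure U) \<le> dist y x0" using x0c by (rule infdist_le)
    then have "infdist y U < \<rho>" using y e by (auto simp: K_def infdist_closure dist_commute)
    then show "y \<in> collar U \<rho>" using y ch(2)[of y] e by (auto simp: K_def collar_def)
  qed
  have hbound: "?h y \<le> M * infdist y U" if y: "y \<in> K" for y
  proof -
    have yr: "y \<in> ball x0 r" "dist x0 y < e" using y e by (auto simp: K_def)
    have "?h y / M \<le> dist y q" if q: "q \<in> U" for q
    proof (cases "q \<in> ball x0 r")
      case True
      then have "?h q < 0" using ch(1) q by blast
      then have "?h y \<le> M * dist y q" using M(2)[OF yr(1) True] by simp
      then show ?thesis using M(1) by (simp add: field_simps)
    next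
      \<comment> \<open>Outside the chart nothing is known about the height of \<open>q\<close>, but
        \<open>q\<close> is at least as far from \<open>y\<close> as \<open>x0\<close> is, and
        \<open>x0\<close> has height 0.\<close>
      case False
      have "r \<le> dist x0 q" using False by simp
      then have "e \<le> dist y q" using dist_triangle[of x0 q y] yr e by simp
      moreover have "?h y \<le> M * dist y x0" using M(2)[OF yr(1), of x0] ch(3) r by simp
      ultimately have "?h y / M \<le> dist y x0" "dist y x0 \<le> dist y q" using M(1) yr by (simp_all add: field_simps dist_commute)
      then show ?thesis by simp
    qed
    then have "?h y / M \<le> infdist y U"
      using U0 by (simp add: infdist_notempty) (rule cINF_greatest, auto)
    then show ?thesis using M(1) by (simp add: field_simps)
  qed
  let ?v = "s *\<^sub>R \<nu>" and ?W = "collar U (\<rho> / 2) \<inter> ball x0 s"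
  have Wm: "?W \<in> sets borel" using open_collar[of U "\<rho> / 2"] by auto
  have Wh: "0 < ?h x" if "x \<in> ?W" for x
    using ch(2)[of x] that s e by (auto simp: collar_def)
  have shiftball: "dist x0 (x + t *\<^sub>R ?v) \<le> e / 2" if "x \<in> ball x0 s" "0 \<le> t" "t \<le> 1" for x t
  proof -
    have "dist x0 (x + t *\<^sub>R ?v) \<le> dist x0 x + dist x (x + t *\<^sub>R ?v)" by (rule dist_triangle)
    also have "dist x (x + t *\<^sub>R ?v) = t * s" using \<nu> that s by (simp add: dist_norm)
    also have "t * s \<le> s" using that s by (simp add: mult_left_le_one_le)
    finally have "dist x0 (x + t *\<^sub>R ?v) \<le> dist x0 x + s" by simp
    moreover have "dist x0 x < s" using that by simp
    ultimately show ?thesis using s(2) by linarith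
  qed
  have hs: "?h (x + t *\<^sub>R ?v) = ?h x + t * s" for x t
    using height_shift[OF \<nu>, of g x "t * s"] by simp
  have WK: "x + t *\<^sub>R ?v \<in> K" if "x \<in> ?W" "0 \<le> t" "t \<le> 1" for x t
    using shiftball[of x t] Wh[OF that(1)] that s e by (auto simp: K_def height_shift[OF \<nu>] add_pos_nonneg)
  define C where "C = 2 * (2 * (p - 1)) powr (p - 1) * norm ?v powr p"
  \<comment> \<open>After the shift all heights are at least \<open>s\<close>, a closed condition,
    so the closure of the shifted layer stays off the boundary of \<open>U\<close>.\<close>
  have "closure ((\<lambda>x. x + ?v) ` ?W) \<subseteq> cball x0 (e / 2) \<inter> ?h -` {s..}"
  proof (rule closure_minimal)
    show "(\<lambda>x. x + ?v) ` ?W \<subseteq> cball x0 (e / 2) \<inter> ?h -` {s..}"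
    proof (rule image_subsetI)
      fix x assume x: "x \<in> ?W"
      show "x + ?v \<in> cball x0 (e / 2) \<inter> ?h -` {s..}"
        using shiftball[of x 1] Wh[OF x] x by (simp add: height_shift[OF \<nu>])
    qed
    show "closed (cball x0 (e / 2) \<inter> ?h -` {s..})"
      using continuous_closed_vimage[of "{s..}" ?h] height_continuous[OF gc, of UNIV]
      by (auto simp: continuous_on_eq_continuous_at)
  qed
  also have "\<dots> \<subseteq> K" using e s by (auto simp: K_def)
  also note Kcol
  finally have cl: "closure ((\<lambda>x. x + ?v) ` ?W) \<subseteq> collar U \<rho>" .
  show ?thesis
  proof (rule exI[of _ s], rule conjI[OF s(1)], rule exI[of _ ?v], rule exI[of _ "C * (M / s) powr p"], intro conjI allI impI cl)
    fix u g' assume ug: "upper_gradient (collar U \<rho>) u g'"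
    then have [measurable]: "g' \<in> borel_measurable borel" and g': "\<And>x. 0 \<le> g' x" by (auto simp: upper_gradient_def)
    have "(Lp_int p ?W (\<lambda>x. \<bar>u (x + ?v) - u x\<bar>))
      \<le> ennreal C * (Lp_int p K (\<lambda>y. ?h y / s * g' y))"
      unfolding C_def
    proof (rule upper_gradient_shift_Hardy[OF p ug Wm K Kcol WK])
      show "?h (x + t *\<^sub>R ?v) / s = ?h x / s + t" for x t
        using s unfolding hs by (simp add: add_divide_distrib)
    qed (use Wh s in auto)
    also have "Lp_int p K (\<lambda>y. ?h y / s * g' y) \<le>
      (\<integral>\<^sup>+y. ennreal ((M / s) powr p) * (ennreal ((infdist y U * g' y) powr p) * indicator (collar U \<rho>) y) \<partial>lborel)"
    proof (intro nn_integral_mono)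
      fix y
      show "ennreal ((?h y / s * g' y) powr p) * indicator K y \<le>
        ennreal ((M / s) powr p) * (ennreal ((infdist y U * g' y) powr p) * indicator (collar U \<rho>) y)"
      proof (cases "y \<in> K")
        case True
        have "?h y / s * g' y \<le> (M * infdist y U) / s * g' y"
          using hbound[OF True] s g'[of y] by (intro mult_right_mono divide_right_mono) auto
        then have "(?h y / s * g' y) powr p \<le> ((M / s) * (infdist y U * g' y)) powr p"
          using True s g'[of y] p by (intro powr_mono2) (auto simp: K_def)
        also have "\<dots> = (M / s) powr p * (infdist y U * g' y) powr p"
          by (rule powr_mult)
        finally show ?thesis using True Kcol by (auto simp: ennreal_mult[symmetric] intro!: ennreal_leI)
      qed simp
    qed
    also have "\<dots> = ennreal ((M / s) powr p) * (Lp_int p (collar U \<rho>) (\<lambda>y. infdist y U * g' y))"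
      by (rule nn_integral_cmult) measurable
    finally show "(Lp_int p ?W (\<lambda>x. \<bar>u (x + ?v) - u x\<bar>))
      \<le> ennreal (C * (M / s) powr p) * (Lp_int p (collar U \<rho>) (\<lambda>x. infdist x U * g' x))"
      using p by (simp add: C_def ennreal_mult mult.assoc mult_left_mono)
  qed
qed

lemma open_ball_pair:
  fixes b :: "'a::real_normed_vector"
  shows "open {x. x \<in> ball b d \<and> x + h \<in> ball b d}"
proof -
  have eq: "{x. x \<in> ball b d \<and> x + h \<in> ball b d} = ball b d \<inter> ball (b - h) d"
    by (auto simp: dist_norm algebra_simps)
  show ?thesis unfolding eq by (intro open_Int open_ball)
qed

lemma ball_pair_segment:
  fixes x :: "'a::real_normed_vector"
  assumes "x \<in> ball b d" "x + h \<in> ball b d" "0 \<le> t" "t \<le> 1"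
  shows "x + t *\<^sub>R h \<in> ball b d"
proof -
  have "x + t *\<^sub>R h \<in> closed_segment x (x + h)" unfolding in_segment using assms
    by (intro exI[of _ t]) (auto simp: algebra_simps)
  moreover have "closed_segment x (x + h) \<subseteq> ball b d"
    using assms by (intro closed_segment_subset) auto
  ultimately show ?thesis by blast
qed

lemma ball_pair_norm:
  fixes x :: "'a::real_normed_vector"
  assumes "x \<in> ball b d" "x + h \<in> ball b d"
  shows "norm h \<le> 2 * d"
proof -
  have "dist x (x + h) < 2 * d" using assms dist_triangle_less_add[of x b d "x + h" d] by (auto simp: dist_commute)
  then show ?thesis by (simp add: dist_norm)
qed

text \<open>In balls inside the collar the weight is bounded below, and at the hole the weighted
  shift estimate applies. Passing from \<rho> to \<rho> / 2 puts the outer boundary of the smaller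
  collar into the interior of the larger one, so the frontier of \<open>U\<close> is the only
  boundary to be treated.\<close>

lemma collar_Poincare:
  fixes U :: "'a::euclidean_space set"
  assumes p: "1 < p" and U: "open U" "U \<noteq> {}" "bounded U" and sm: "smooth_boundary U"
    and con: "connected (frontier U)" and \<rho>: "0 < \<rho>" and a: "cball a r \<subseteq> collar U \<rho>" "0 < r"
  shows "\<exists>C\<ge>0. \<forall>u g. upper_gradient (collar U \<rho>) u g \<longrightarrow>
    osc p u (collar U (\<rho> / 2)) (ball a r) \<le> ennreal C * (Lp_int p (collar U \<rho>) (\<lambda>x. infdist x U * g x))"
proof -
  let ?D = "collar U \<rho>" and ?S = "collar U (\<rho> / 2)"
  let ?E = "\<lambda>g. \<integral>\<^sup>+x\<in>?D. ennreal ((infdist x U * g x) powr p) \<partial>lborel"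
  define F where "F = {(u, ?E g) | u g. upper_gradient ?D u g}"
  have Dm[measurable]: "?D \<in> sets borel" and Sm: "?S \<in> sets borel" using open_collar by auto
  interpret shift_controlled p F ?D
  proof
    show "1 < p" by fact
    show "open ?D" by (rule open_collar)
    show "connected ?D" by (rule connected_collar[OF U(1,2) sm con \<rho>])
    show "v \<in> borel_measurable borel" if "(v, E) \<in> F" for v E
      using that by (auto simp: F_def upper_gradient_def)
    fix b d assume bd: "cball b d \<subseteq> ?D"
    from collar_inner_bound[OF U(2) bd]
    obtain m where m: "0 < m" "\<And>y. y \<in> cball b d \<Longrightarrow> m \<le> infdist y U" by blast
    show "\<exists>C. \<forall>v E h. (v, E) \<in> F \<longrightarrow>
      (\<integral>\<^sup>+x\<in>{x. x \<in> ball b d \<and> x + h \<in> ball b d}. ennreal (\<bar>v (x + h) - v x\<bar> powr p) \<partial>lborel) \<le> ennreal C * E"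
    proof (intro exI[of _ "(2 * d) powr p * (1 / m) powr p"] allI impI)
      fix v E h assume "(v, E) \<in> F"
      then obtain g where g: "upper_gradient ?D v g" "E = ?E g" by (auto simp: F_def)
      then have [measurable]: "g \<in> borel_measurable borel" and g0: "\<And>x. 0 \<le> g x" by (auto simp: upper_gradient_def)
      let ?W = "{x. x \<in> ball b d \<and> x + h \<in> ball b d}"
      have "Lp_int p ?W (\<lambda>x. \<bar>v (x + h) - v x\<bar>) \<le> ennreal (norm h powr p) * (Lp_int p (ball b d) (\<lambda>y. g y))"
        by (rule upper_gradient_shift[OF p g(1)]) (use open_ball_pair[of b d h] ball_pair_segment[of _ b d h] bd in auto)
      also have "\<dots> \<le> ennreal (norm h powr p) * (\<integral>\<^sup>+y. ennreal ((1 / m) powr p) * (ennreal ((infdist y U * g y) powr p) * indicator ?D y) \<partial>lborel)"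
      proof (intro mult_left_mono nn_integral_mono)
        fix y
        show "ennreal (g y powr p) * indicator (ball b d) y \<le> ennreal ((1 / m) powr p) * (ennreal ((infdist y U * g y) powr p) * indicator ?D y)"
        proof (cases "y \<in> ball b d")
          case True
          then have yD: "y \<in> ?D" "m \<le> infdist y U" using bd m(2)[of y] by auto
          have "g y powr p \<le> (1 / m * (infdist y U * g y)) powr p"
          proof (intro powr_mono2)
            have "m * g y \<le> infdist y U * g y" using yD(2) g0 by (rule mult_right_mono)
            then show "g y \<le> 1 / m * (infdist y U * g y)" using m(1) by (simp add: field_simps)
          qed (use g0 p in auto)
          also have "\<dots> = (1 / m) powr p * (infdist y U * g y) powr p"
            by (rule powr_mult)
          finally show ?thesis using True yD by (simp add: ennreal_mult[symmetric] ennreal_leI)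
        qed simp
      qed simp
      also have "\<dots> = ennreal (norm h powr p) * (ennreal ((1 / m) powr p) * E)"
        unfolding g(2) by (subst nn_integral_cmult) auto
      finally have *: "Lp_int p ?W (\<lambda>x. \<bar>v (x + h) - v x\<bar>) \<le> ennreal (norm h powr p) * (ennreal ((1 / m) powr p) * E)" .
      show "Lp_int p ?W (\<lambda>x. \<bar>v (x + h) - v x\<bar>) \<le> ennreal ((2 * d) powr p * (1 / m) powr p) * E"
      \<comment> \<open>A nonempty \<open>?W\<close> bounds the length of \<open>h\<close> by the
        diameter of the ball; this makes the constant independent of \<open>h\<close>.\<close>
      proof (cases "?W = {}")
        case False
        then have "norm h \<le> 2 * d" using ball_pair_norm by fastforce
        then have "norm h powr p \<le> (2 * d) powr p" using p by (intro powr_mono2) auto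
        then have "ennreal (norm h powr p) * (ennreal ((1 / m) powr p) * E) \<le> ennreal ((2 * d) powr p) * (ennreal ((1 / m) powr p) * E)"
          by (intro mult_right_mono ennreal_leI) auto
        then show ?thesis using order_trans[OF *] by (simp add: ennreal_mult mult.assoc)
      qed simp
    qed
  qed
  have "ctl ?S (ball a r)"
  proof (rule ctl_domain[OF Sm _ a])
    show "bounded ?S" by (rule bounded_collar[OF U(3,2)])
    fix x assume x: "x \<in> closure ?S" "x \<notin> ?D"
    have "?S \<subseteq> {x. infdist x U \<le> \<rho> / 2}" by (auto simp: collar_def)
    moreover have "closed {x. infdist x U \<le> \<rho> / 2}" by (intro closed_Collect_le continuous_intros)
    ultimately have "infdist x U \<le> \<rho> / 2" using closure_minimal x(1) by blast
    then have xc: "x \<in> closure U" using x(2) \<rho> by (auto simp: collar_def)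
    have "?S \<subseteq> - U" using closure_subset by (auto simp: collar_def)
    then have "closure ?S \<subseteq> - U" using U(1) by (intro closure_minimal) auto
    then have "x \<in> frontier U" using x(1) xc U(1) by (auto simp: frontier_def interior_open)
    from collar_boundary_shift[OF p U(1) sm this \<rho>]
    obtain d h c where d: "0 < d" "closure ((\<lambda>x. x + h) ` (?S \<inter> ball x d)) \<subseteq> ?D"
      "\<And>u g. upper_gradient ?D u g \<Longrightarrow> (Lp_int p (?S \<inter> ball x d) (\<lambda>x. \<bar>u (x + h) - u x\<bar>)) \<le> ennreal c * ?E g"
      by auto
    show "\<exists>r>0. \<exists>h c. closure ((\<lambda>x. x + h) ` (?S \<inter> ball x r)) \<subseteq> ?D \<and>
      (\<forall>v E. (v, E) \<in> F \<longrightarrow> (Lp_int p (?S \<inter> ball x r) (\<lambda>x. \<bar>v (x + h) - v x\<bar>)) \<le> ennreal c * E)"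
      by (rule exI[of _ d], rule conjI[OF d(1)], rule exI[of _ h], rule exI[of _ c], rule conjI[OF d(2)]) (use d(3) in \<open>auto simp: F_def\<close>)
  qed
  then obtain C where "0 \<le> C" "\<And>v E. (v, E) \<in> F \<Longrightarrow> osc p v ?S (ball a r) \<le> ennreal C * E"
    unfolding ctl_def by auto
  then show ?thesis by (intro exI[of _ C]) (auto simp: F_def)
qed

section \<open>Poincare inequality under shift control\<close>

text \<open>The factor (1 + norm h)^p in place of norm h^p admits functions with jumps, whose short
  shifts are not small: the functions filled into the holes are of this kind. The Lipschitz charts
  enter through a shift along - \<nu>, for which the hypothesis on shifts is used directly.\<close>

lemma domain_Poincare:
  fixes \<Omega> :: "'a::euclidean_space set"
  assumes p: "1 < p" and \<Omega>: "open \<Omega>" "connected \<Omega>" "bounded \<Omega>" "lipschitz_boundary \<Omega>"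
    and a: "cball a r \<subseteq> \<Omega>" "0 < r"
  shows "\<exists>C\<ge>0. \<forall>v E. v \<in> borel_measurable borel \<and>
    (\<forall>h W. W \<in> sets borel \<and> (\<forall>x\<in>W. \<forall>t\<in>{0..1}. x + t *\<^sub>R h \<in> \<Omega>) \<longrightarrow>
       (Lp_int p W (\<lambda>x. \<bar>v (x + h) - v x\<bar>)) \<le> ennreal ((1 + norm h) powr p) * E) \<longrightarrow>
    osc p v \<Omega> (ball a r) \<le> ennreal C * E"
proof -
  define F where "F = {(v, E). v \<in> borel_measurable borel \<and>
    (\<forall>h W. W \<in> sets borel \<and> (\<forall>x\<in>W. \<forall>t\<in>{0..1}. x + t *\<^sub>R h \<in> \<Omega>) \<longrightarrow>
       (Lp_int p W (\<lambda>x. \<bar>v (x + h) - v x\<bar>)) \<le> ennreal ((1 + norm h) powr p) * E)}"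
  have Fshift: "Lp_int p W (\<lambda>x. \<bar>v (x + h) - v x\<bar>) \<le> ennreal ((1 + norm h) powr p) * E"
    if "(v, E) \<in> F" "W \<in> sets borel" "\<And>x t. x \<in> W \<Longrightarrow> 0 \<le> t \<Longrightarrow> t \<le> 1 \<Longrightarrow> x + t *\<^sub>R h \<in> \<Omega>" for v E W h
    using that unfolding F_def by auto
  interpret shift_controlled p F \<Omega>
  proof
    show "v \<in> borel_measurable borel" if "(v, E) \<in> F" for v E using that by (auto simp: F_def)
    fix b d assume bd: "cball b d \<subseteq> \<Omega>"
    show "\<exists>C. \<forall>v E h. (v, E) \<in> F \<longrightarrow>
      (\<integral>\<^sup>+x\<in>{x. x \<in> ball b d \<and> x + h \<in> ball b d}. ennreal (\<bar>v (x + h) - v x\<bar> powr p) \<partial>lborel) \<le> ennreal C * E"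
    proof (intro exI[of _ "(1 + 2 * d) powr p"] allI impI)
      fix v E h assume vE: "(v, E) \<in> F"
      let ?W = "{x. x \<in> ball b d \<and> x + h \<in> ball b d}"
      show "Lp_int p ?W (\<lambda>x. \<bar>v (x + h) - v x\<bar>) \<le> ennreal ((1 + 2 * d) powr p) * E"
      proof (cases "?W = {}")
        case False
        then have h: "norm h \<le> 2 * d" using ball_pair_norm by fastforce
        have "Lp_int p ?W (\<lambda>x. \<bar>v (x + h) - v x\<bar>) \<le> ennreal ((1 + norm h) powr p) * E"
        proof (rule Fshift[OF vE borel_open[OF open_ball_pair]])
          fix x t assume "x \<in> ?W" "0 \<le> t" "t \<le> (1::real)"
          then have "x + t *\<^sub>R h \<in> ball b d" by (intro ball_pair_segment) auto
          then show "x + t *\<^sub>R h \<in> \<Omega>" using bd ball_subset_cball by blast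
        qed
        also have "\<dots> \<le> ennreal ((1 + 2 * d) powr p) * E"
          using p h by (intro mult_right_mono ennreal_leI powr_mono2) auto
        finally show ?thesis .
      qed simp
    qed
  qed (fact p \<Omega>)+
  have "ctl \<Omega> (ball a r)"
  proof (rule ctl_domain[OF _ \<Omega>(3) a])
    fix x0 assume "x0 \<in> closure \<Omega>" "x0 \<notin> \<Omega>"
    then have x0: "x0 \<in> frontier \<Omega>" using \<Omega>(1) by (simp add: frontier_def interior_open)
    obtain r \<nu> g L where r: "0 < r" and \<nu>: "norm \<nu> = 1" and g: "L-lipschitz_on UNIV g"
      and chart: "\<Omega> \<inter> ball x0 r = {y \<in> ball x0 r. y \<bullet> \<nu> < g (y - (y \<bullet> \<nu>) *\<^sub>R \<nu>)}"
      using \<Omega>(4) x0 unfolding lipschitz_boundary_def by blast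
    note gc = lipschitz_on_continuous_on[OF g]
    note ch = height_chart[OF \<Omega>(1) x0 r \<nu> gc chart]
    let ?h = "height \<nu> g"
    define s where "s = r / 4"
    have s: "0 < s" "s = r / 4" using r by (auto simp: s_def)
    \<comment> \<open>The domain lies below the graph, so the shift goes down; it keeps the segments
      in \<Omega> and produces heights at most - s.\<close>
    let ?v = "(- s) *\<^sub>R \<nu>" and ?W = "\<Omega> \<inter> ball x0 s"
    have near: "dist x0 (x + t *\<^sub>R ?v) \<le> r / 2" if "x \<in> ball x0 s" "0 \<le> t" "t \<le> 1" for x t
    proof -
      have "dist x0 (x + t *\<^sub>R ?v) \<le> dist x0 x + dist x (x + t *\<^sub>R ?v)" by (rule dist_triangle)
      also have "dist x (x + t *\<^sub>R ?v) = t * s" using \<nu> that s by (simp add: dist_norm)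
      also have "t * s \<le> s" using that s by (simp add: mult_left_le_one_le)
      finally have "dist x0 (x + t *\<^sub>R ?v) \<le> dist x0 x + s" by simp
      moreover have "dist x0 x < s" using that by simp
      ultimately show ?thesis using s(2) by linarith
    qed
    have hs: "?h (x + t *\<^sub>R ?v) = ?h x - t * s" for x t
      using height_shift[OF \<nu>, of g x "t * (- s)"] by simp
    have Wh: "?h x < 0" if "x \<in> ?W" for x using ch(1)[of x] that s by auto
    have W\<Omega>: "x + t *\<^sub>R ?v \<in> \<Omega>" if "x \<in> ?W" "0 \<le> t" "t \<le> 1" for x t
    proof -
      have "x + t *\<^sub>R ?v \<in> ball x0 r" using near[of x t] that r by (simp del: scaleR_minus_left)
      moreover have "?h (x + t *\<^sub>R ?v) < 0" unfolding hs using Wh[OF that(1)] that s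
        by (meson diff_le_eq le_add_same_cancel1 le_less_trans less_imp_le mult_nonneg_nonneg)
      ultimately show ?thesis using ch(1) by blast
    qed
    have "closure ((\<lambda>x. x + ?v) ` ?W) \<subseteq> cball x0 (r / 2) \<inter> ?h -` {..- s}"
    proof (rule closure_minimal)
      show "(\<lambda>x. x + ?v) ` ?W \<subseteq> cball x0 (r / 2) \<inter> ?h -` {..- s}"
      proof (rule image_subsetI)
        fix x assume x: "x \<in> ?W"
        show "x + ?v \<in> cball x0 (r / 2) \<inter> ?h -` {..- s}"
          using near[of x 1] Wh[OF x] x hs[of x 1] by (simp del: scaleR_minus_left)
      qed
      show "closed (cball x0 (r / 2) \<inter> ?h -` {..- s})"
        using continuous_closed_vimage[of "{..- s}" ?h] height_continuous[OF gc, of UNIV]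
        by (auto simp: continuous_on_eq_continuous_at)
    qed
    also have "\<dots> \<subseteq> \<Omega>"
    proof
      fix y assume "y \<in> cball x0 (r / 2) \<inter> ?h -` {..- s}"
      then have "y \<in> ball x0 r" "?h y < 0" using r s by auto
      then show "y \<in> \<Omega>" using ch(1) by blast
    qed
    finally have cl: "closure ((\<lambda>x. x + ?v) ` ?W) \<subseteq> \<Omega>" .
    have sh: "\<forall>v E. (v, E) \<in> F \<longrightarrow> (Lp_int p ?W (\<lambda>x. \<bar>v (x + ?v) - v x\<bar>)) \<le> ennreal ((1 + norm ?v) powr p) * E"
      using W\<Omega> \<Omega>(1) by (intro allI impI Fshift) auto
    show "\<exists>r>0. \<exists>h c. closure ((\<lambda>x. x + h) ` (\<Omega> \<inter> ball x0 r)) \<subseteq> \<Omega> \<and>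
      (\<forall>v E. (v, E) \<in> F \<longrightarrow> (Lp_int p (\<Omega> \<inter> ball x0 r) (\<lambda>x. \<bar>v (x + h) - v x\<bar>)) \<le> ennreal c * E)"
      by (rule exI[of _ s], rule conjI[OF s(1)], rule exI[of _ ?v], rule exI[of _ "(1 + norm ?v) powr p"], rule conjI[OF cl sh])
  qed (use \<Omega> in auto)
  then obtain C where "0 \<le> C" "\<And>v E. (v, E) \<in> F \<Longrightarrow> osc p v \<Omega> (ball a r) \<le> ennreal C * E"
    unfolding ctl_def by auto
  then show ?thesis by (intro exI[of _ C]) (auto simp: F_def)
qed

section \<open>A system of separated holes\<close>

text \<open>Both integrals are measures with a density, so local inequalities add up over countably
  many disjoint sets with the same constant.\<close>

lemma nn_integral_UN_le:
  assumes J: "countable J" and dis: "disjoint_family_on D J"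
    and D[measurable]: "\<And>j. j \<in> J \<Longrightarrow> D j \<in> sets borel" "\<And>j. j \<in> J \<Longrightarrow> S j \<in> sets borel"
    and sub: "\<And>j. j \<in> J \<Longrightarrow> S j \<subseteq> D j" "\<And>j. j \<in> J \<Longrightarrow> D j \<subseteq> X"
    and [measurable]: "f \<in> borel_measurable borel" "F \<in> borel_measurable borel"
    and le: "\<And>j. j \<in> J \<Longrightarrow> (\<integral>\<^sup>+x\<in>S j. f x \<partial>lborel) \<le> c * (\<integral>\<^sup>+x\<in>D j. F x \<partial>(lborel :: 'a::euclidean_space measure))"
  shows "(\<integral>\<^sup>+x\<in>(\<Union>j\<in>J. S j). f x \<partial>lborel) \<le> c * (\<integral>\<^sup>+x\<in>X. F x \<partial>lborel)"
proof -
  have disS: "disjoint_family_on S J" using dis sub(1) unfolding disjoint_family_on_def by fast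
  have US: "(\<Union>j\<in>J. S j) \<in> sets borel" "(\<Union>j\<in>J. D j) \<in> sets borel" using J D by (auto intro: sets.countable_UN')
  have "(\<integral>\<^sup>+x\<in>(\<Union>j\<in>J. S j). f x \<partial>lborel) = emeasure (density lborel f) (\<Union>j\<in>J. S j)"
    using US by (simp add: emeasure_density)
  also have "\<dots> = (\<integral>\<^sup>+j. emeasure (density lborel f) (S j) \<partial>count_space J)"
    using J disS D by (intro emeasure_UN_countable) auto
  also have "\<dots> \<le> (\<integral>\<^sup>+j. c * emeasure (density lborel F) (D j) \<partial>count_space J)"
    using D le by (intro nn_integral_mono) (simp add: emeasure_density)
  also have "\<dots> = c * (\<integral>\<^sup>+j. emeasure (density lborel F) (D j) \<partial>count_space J)"
    by (rule nn_integral_cmult) simp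
  also have "(\<integral>\<^sup>+j. emeasure (density lborel F) (D j) \<partial>count_space J) = emeasure (density lborel F) (\<Union>j\<in>J. D j)"
    using J dis D by (intro emeasure_UN_countable[symmetric]) auto
  also have "\<dots> = (\<integral>\<^sup>+x\<in>(\<Union>j\<in>J. D j). F x \<partial>lborel)" using US by (simp add: emeasure_density)
  also have "\<dots> \<le> (\<integral>\<^sup>+x\<in>X. F x \<partial>lborel)"
    using sub(2) by (intro nn_integral_mono) (auto simp: indicator_def)
  finally show ?thesis by (simp add: mult_left_mono)
qed

text \<open>The weighted Hoelder inequality for counting measure and weight 1.\<close>

lemma powr_sum_le:
  fixes a :: "nat \<Rightarrow> real"
  assumes p: "1 < p" and N: "0 < N"
  shows "ennreal (\<bar>\<Sum>i<N. a i\<bar> powr p) \<le> ennreal (real N powr (p - 1)) * (\<Sum>i<N. ennreal (\<bar>a i\<bar> powr p))"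
proof -
  let ?M = "count_space {..<N}"
  have "ennreal (\<bar>\<Sum>i<N. a i\<bar> powr p) \<le> ennreal (real N powr (p - 1)) * (\<integral>\<^sup>+i\<in>{..<N}. ennreal (\<bar>a i\<bar> powr p * 1 powr (1 - p)) \<partial>?M)"
  proof (rule nn_integral_powr_Jensen[OF p])
    show "(\<integral>\<^sup>+i\<in>{..<N}. ennreal 1 \<partial>?M) \<le> ennreal (real N)"
      by (simp add: nn_integral_count_space_finite ennreal_of_nat_eq_real_of_nat)
    have "ennreal \<bar>\<Sum>i<N. a i\<bar> \<le> ennreal (\<Sum>i<N. \<bar>a i\<bar>)" by (intro ennreal_leI sum_abs)
    then show "ennreal \<bar>\<Sum>i<N. a i\<bar> \<le> (\<integral>\<^sup>+i\<in>{..<N}. ennreal \<bar>a i\<bar> \<partial>?M)"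
      by (simp add: nn_integral_count_space_finite sum_ennreal)
  qed (use N in auto)
  then show ?thesis by (simp add: nn_integral_count_space_finite)
qed

text \<open>A shift by \<open>h\<close> is split into about \<open>norm h / \<kappa>\<close> short shifts.\<close>

lemma iterate_short_shifts:
  fixes v :: "'a::euclidean_space \<Rightarrow> real"
  assumes p: "1 < p" and \<kappa>: "0 < \<kappa>" and [measurable]: "v \<in> borel_measurable borel"
    and short: "\<And>h W. norm h \<le> \<kappa> \<Longrightarrow> W \<in> sets borel \<Longrightarrow> (\<And>x t. x \<in> W \<Longrightarrow> 0 \<le> t \<Longrightarrow> t \<le> 1 \<Longrightarrow> x + t *\<^sub>R h \<in> U) \<Longrightarrow>
       (Lp_int p W (\<lambda>x. \<bar>v (x + h) - v x\<bar>)) \<le> E"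
    and [measurable]: "W \<in> sets borel" and WU: "\<And>x t. x \<in> W \<Longrightarrow> 0 \<le> t \<Longrightarrow> t \<le> 1 \<Longrightarrow> x + t *\<^sub>R h \<in> U"
  shows "Lp_int p W (\<lambda>x. \<bar>v (x + h) - v x\<bar>) \<le> ennreal ((norm h / \<kappa> + 1) powr p) * E"
proof -
  \<comment> \<open>The extra 1 makes \<open>N\<close> positive even for h = 0, and the steps no
    longer than \<kappa>.\<close>
  define N where "N = nat \<lfloor>norm h / \<kappa>\<rfloor> + 1"
  have N: "0 < N" "norm h / \<kappa> \<le> real N" "real N \<le> norm h / \<kappa> + 1"
    using \<kappa> by (auto simp: N_def) linarith+
  define k where "k = (1 / real N) *\<^sub>R h"
  have k: "norm k \<le> \<kappa>" using N \<kappa> by (simp add: k_def field_simps)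
  have kN: "real N *\<^sub>R k = h" using N by (simp add: k_def)
  have tel: "v (x + h) - v x = (\<Sum>i<N. v (x + real i *\<^sub>R k + k) - v (x + real i *\<^sub>R k))" for x
  proof -
    have "(\<Sum>i<N. v (x + real (Suc i) *\<^sub>R k) - v (x + real i *\<^sub>R k)) = v (x + real N *\<^sub>R k) - v (x + real 0 *\<^sub>R k)"
      by (rule sum_lessThan_telescope)
    then show ?thesis by (simp add: kN algebra_simps)
  qed
  have step: "Lp_int p W (\<lambda>x. \<bar>v (x + real i *\<^sub>R k + k) - v (x + real i *\<^sub>R k)\<bar>) \<le> E" if i: "i < N" for i
  proof -
    \<comment> \<open>The i-th step starts on a translate of \<open>W\<close>, and its segments are
      pieces of the segments that \<open>WU\<close> keeps in \<open>U\<close>.\<close>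
    let ?W = "(\<lambda>y. y - real i *\<^sub>R k) -` W"
    have [measurable]: "?W \<in> sets borel" using measurable_sets[of "\<lambda>y. y - real i *\<^sub>R k" borel borel W] by simp
    have "(Lp_int p W (\<lambda>x. \<bar>v (x + real i *\<^sub>R k + k) - v (x + real i *\<^sub>R k)\<bar>)) =
      (Lp_int p ?W (\<lambda>y. \<bar>v (y + k) - v y\<bar>))"
      by (subst nn_integral_lborel_translate[of _ "real i *\<^sub>R k", symmetric]) (auto simp: indicator_def intro!: nn_integral_cong)
    also have "\<dots> \<le> E"
    proof (rule short[OF k])
      fix y t assume y: "y \<in> ?W" and t: "0 \<le> t" "t \<le> (1::real)"
      have "(real i + t) / real N \<le> 1" using i t by (simp add: field_simps)
      then have "(y - real i *\<^sub>R k) + ((real i + t) / real N) *\<^sub>R h \<in> U" using y t N by (intro WU) auto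
      also have "((real i + t) / real N) *\<^sub>R h = real i *\<^sub>R k + t *\<^sub>R k"
        by (simp add: k_def add_divide_distrib scaleR_add_left)
      finally show "y + t *\<^sub>R k \<in> U" by simp
    qed simp
    finally show ?thesis .
  qed
  have "Lp_int p W (\<lambda>x. \<bar>v (x + h) - v x\<bar>) \<le>
    (\<integral>\<^sup>+x. ennreal (real N powr (p - 1)) * (\<Sum>i<N. ennreal (\<bar>v (x + real i *\<^sub>R k + k) - v (x + real i *\<^sub>R k)\<bar> powr p) * indicator W x) \<partial>lborel)"
    unfolding tel using powr_sum_le[OF p N(1)] by (intro nn_integral_mono) (auto simp: indicator_def)
  also have "\<dots> = ennreal (real N powr (p - 1)) * (\<Sum>i<N. (Lp_int p W (\<lambda>x. \<bar>v (x + real i *\<^sub>R k + k) - v (x + real i *\<^sub>R k)\<bar>)))"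
    by (subst nn_integral_cmult, measurable, subst nn_integral_sum) auto
  also have "\<dots> \<le> ennreal (real N powr (p - 1)) * (\<Sum>i<N. E)"
    using step by (intro mult_left_mono sum_mono) auto
  \<comment> \<open>One factor N comes from the number of steps and N^(p - 1) from
    convexity.\<close>
  also have "\<dots> = ennreal (real N powr p) * E"
  proof -
    have "real N powr (p - 1) * real N = real N powr p" using N by (simp add: powr_diff)
    then show ?thesis
      by (simp add: ennreal_of_nat_eq_real_of_nat mult.assoc[symmetric] ennreal_mult[symmetric])
  qed
  also have "\<dots> \<le> ennreal ((norm h / \<kappa> + 1) powr p) * E"
    using N p by (intro mult_right_mono ennreal_leI powr_mono2) auto
  finally show ?thesis .
qed

text \<open>u(x) is compared with u(y) for all y in \<open>B\<close>, so a bound for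
  \<open>u\<close> on a good set \<open>B\<close> together with the oscillation controls
  \<open>u\<close> on \<open>A\<close>.\<close>

lemma osc_norm:
  fixes u :: "'a::euclidean_space \<Rightarrow> real"
  assumes p: "1 < p" and [measurable]: "u \<in> borel_measurable borel" "A \<in> sets borel" "B \<in> sets borel"
  shows "emeasure lborel B * (Lp_int p A (\<lambda>x. \<bar>u x\<bar>)) \<le>
    ennreal (2 powr p) * (osc p u A B + emeasure lborel A * (Lp_int p B (\<lambda>y. \<bar>u y\<bar>)))"
proof -
  let ?e = "\<lambda>x. ennreal (\<bar>u x\<bar> powr p)"
  have 1: "emeasure lborel B * ?e x \<le> ennreal (2 powr p) * ((Lp_int p B (\<lambda>y. \<bar>u x - u y\<bar>)) + (\<integral>\<^sup>+y\<in>B. ?e y \<partial>lborel))" for x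
  proof -
    have pt: "?e x \<le> ennreal (2 powr p) * (ennreal (\<bar>u x - u y\<bar> powr p) + ?e y)" for y
      using powr_abs_triangle[OF p, of "u x" 0 "u y"]
      by (auto simp: ennreal_plus[symmetric] ennreal_mult[symmetric] simp del: ennreal_plus intro!: ennreal_leI)
    have "emeasure lborel B * ?e x = (\<integral>\<^sup>+y. ?e x * indicator B y \<partial>lborel)"
      by (subst nn_integral_cmult_indicator) (auto simp: mult.commute)
    also have "\<dots> \<le> (\<integral>\<^sup>+y. ennreal (2 powr p) * (ennreal (\<bar>u x - u y\<bar> powr p) * indicator B y + ?e y * indicator B y) \<partial>lborel)"
      using pt by (intro nn_integral_mono) (auto simp: indicator_def)
    also have "\<dots> = ennreal (2 powr p) * ((Lp_int p B (\<lambda>y. \<bar>u x - u y\<bar>)) + (\<integral>\<^sup>+y\<in>B. ?e y \<partial>lborel))"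
      by (simp add: nn_integral_cmult nn_integral_add)
    finally show ?thesis .
  qed
  have "emeasure lborel B * (\<integral>\<^sup>+x\<in>A. ?e x \<partial>lborel) = (\<integral>\<^sup>+x. (emeasure lborel B * ?e x) * indicator A x \<partial>lborel)"
    by (subst nn_integral_cmult[symmetric]) (auto simp: mult.assoc)
  also have "\<dots> \<le> (\<integral>\<^sup>+x. (ennreal (2 powr p) * ((Lp_int p B (\<lambda>y. \<bar>u x - u y\<bar>)) + (\<integral>\<^sup>+y\<in>B. ?e y \<partial>lborel))) * indicator A x \<partial>lborel)"
    by (intro nn_integral_mono mult_right_mono 1) auto
  also have "\<dots> = (\<integral>\<^sup>+x. ennreal (2 powr p) * ((Lp_int p B (\<lambda>y. \<bar>u x - u y\<bar>)) * indicator A x + (\<integral>\<^sup>+y\<in>B. ?e y \<partial>lborel) * indicator A x) \<partial>lborel)"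
    by (intro nn_integral_cong) (auto simp: indicator_def)
  also have "\<dots> = ennreal (2 powr p) * (osc p u A B + emeasure lborel A * (\<integral>\<^sup>+y\<in>B. ?e y \<partial>lborel))"
    by (subst nn_integral_cmult, simp, subst nn_integral_add) (simp_all add: nn_integral_cmult osc_def mult.commute[of "emeasure lborel A"])
  finally show ?thesis .
qed

lemma upper_gradient_subset:
  assumes "upper_gradient U u g" "U' \<subseteq> U"
  shows "upper_gradient U' u g"
  unfolding upper_gradient_def
proof (intro conjI allI)
  fix h
  have "AE x in lborel. (\<forall>t\<in>{0..1}. x + t *\<^sub>R h \<in> U) \<longrightarrow>
      ennreal \<bar>u (x + h) - u x\<bar> \<le> (\<integral>\<^sup>+t\<in>{0..1}. ennreal (norm h * g (x + t *\<^sub>R h)) \<partial>lborel)"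
    using assms(1) by (simp add: upper_gradient_def)
  then show "AE x in lborel. (\<forall>t\<in>{0..1}. x + t *\<^sub>R h \<in> U') \<longrightarrow>
      ennreal \<bar>u (x + h) - u x\<bar> \<le> (\<integral>\<^sup>+t\<in>{0..1}. ennreal (norm h * g (x + t *\<^sub>R h)) \<partial>lborel)"
    by eventually_elim (use assms(2) in auto)
qed (use assms(1) in \<open>auto simp: upper_gradient_def\<close>)

text \<open>The index set may be infinite, so every constant (radius of the reference ball, lower
  bound of the distance, collar volume, Poincare constant) is common to all holes: this is where
  uniformity is recorded. On the reference ball the distance to the hole is at least \<beta>, so the
  weight is harmless there. Separation by 2 * \<rho> makes the \<rho>-neighbourhoods
  disjoint.\<close>

locale hole_system =
  fixes p \<rho> :: real and J :: "'j set" and V :: "'j \<Rightarrow> 'a::euclidean_space set" and a :: "'j \<Rightarrow> 'a"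
    and r \<beta> C0 m0 :: real
  assumes p: "1 < p" and \<rho>: "0 < \<rho>" and J: "countable J" "J \<noteq> {}"
    and V: "\<And>j. j \<in> J \<Longrightarrow> open (V j)" "\<And>j. j \<in> J \<Longrightarrow> V j \<noteq> {}"
    and sep: "\<And>i j x y. i \<in> J \<Longrightarrow> j \<in> J \<Longrightarrow> i \<noteq> j \<Longrightarrow> x \<in> closure (V i) \<Longrightarrow> y \<in> closure (V j) \<Longrightarrow> 2 * \<rho> \<le> dist x y"
    and r: "0 < r" and \<beta>: "0 < \<beta>" and C0: "0 \<le> C0"
    and ball: "\<And>j. j \<in> J \<Longrightarrow> ball (a j) r \<subseteq> collar (V j) (\<rho> / 2)"
      "\<And>j x. j \<in> J \<Longrightarrow> x \<in> ball (a j) r \<Longrightarrow> \<beta> \<le> infdist x (V j)"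
    and m0: "\<And>j. j \<in> J \<Longrightarrow> emeasure lborel (collar (V j) (\<rho> / 2)) \<le> ennreal m0" "0 \<le> m0"
    and Poincare: "\<And>j u g. j \<in> J \<Longrightarrow> upper_gradient (collar (V j) \<rho>) u g \<Longrightarrow>
      osc p u (collar (V j) (\<rho> / 2)) (ball (a j) r) \<le> ennreal C0 * (Lp_int p (collar (V j) \<rho>) (\<lambda>x. infdist x (V j) * g x))"
begin

definition P where "P = (\<Union>j\<in>J. closure (V j))"
definition nbhd where "nbhd j s = {x. infdist x (V j) < s}"
abbreviation w where "w \<equiv> \<lambda>x. infdist x P"

definition inside where "inside U = {j \<in> J. nbhd j \<rho> \<subseteq> U}"

lemma P_borel [measurable]: "P \<in> sets borel"
  unfolding P_def using J by (auto intro!: sets.countable_UN')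

lemma open_nbhd: "open (nbhd j s)"
  unfolding nbhd_def by (intro open_Collect_less continuous_intros)

lemma nbhd_borel [measurable]: "nbhd j s \<in> sets borel"
  using open_nbhd by (rule borel_open)

lemma collar_eq: "collar (V j) s = nbhd j s - closure (V j)"
  by (simp add: collar_def nbhd_def)

lemma closure_subset_nbhd: "j \<in> J \<Longrightarrow> 0 < s \<Longrightarrow> closure (V j) \<subseteq> nbhd j s"
  using in_closure_iff_infdist_zero[OF V(2)] by (auto simp: nbhd_def)

lemma nearest:
  assumes "j \<in> J" obtains q where "q \<in> closure (V j)" "infdist x (V j) = dist x q"
  using infdist_attains_inf[of "closure (V j)" x] V(2)[OF assms] by (auto simp: infdist_closure)

lemma nbhd_sep:
  assumes "i \<in> J" "j \<in> J" "i \<noteq> j" "x \<in> nbhd i \<rho>" "y \<in> closure (V j)"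
  shows "\<rho> < dist x y"
proof -
  obtain q where q: "q \<in> closure (V i)" "infdist x (V i) = dist x q" using nearest[OF assms(1)] by metis
  have "2 * \<rho> \<le> dist q y" by (rule sep[OF assms(1-3) q(1) assms(5)])
  then show ?thesis using q(2) assms(4) dist_triangle[of q y x] by (simp add: nbhd_def dist_commute)
qed

lemma nbhd_disjoint: "i \<in> J \<Longrightarrow> j \<in> J \<Longrightarrow> x \<in> nbhd i \<rho> \<Longrightarrow> x \<in> nbhd j \<rho> \<Longrightarrow> i = j"
proof (rule ccontr)
  assume a: "i \<in> J" "j \<in> J" "x \<in> nbhd i \<rho>" "x \<in> nbhd j \<rho>" "i \<noteq> j"
  obtain q where q: "q \<in> closure (V j)" "infdist x (V j) = dist x q" using nearest[OF a(2)] by metis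
  then show False using nbhd_sep[OF a(1,2,5,3) q(1)] a(4) by (simp add: nbhd_def)
qed

lemma collar_disjoint_P: "j \<in> J \<Longrightarrow> collar (V j) \<rho> \<inter> P = {}"
proof -
  assume j: "j \<in> J"
  have "x \<notin> closure (V i)" if "x \<in> collar (V j) \<rho>" "i \<in> J" for x i
    using that nbhd_disjoint[OF that(2) j, of x] closure_subset_nbhd[OF that(2) \<rho>] by (auto simp: collar_eq)
  then show ?thesis by (auto simp: P_def)
qed

lemma P_nonempty: "P \<noteq> {}" using J V by (auto simp: P_def)

lemma w_less: "w x < s \<Longrightarrow> \<exists>j\<in>J. x \<in> nbhd j s"
proof -
  assume "w x < s"
  then obtain y where "y \<in> P" "dist x y < s"
    using P_nonempty by (auto simp: infdist_notempty cINF_less_iff)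
  then obtain j where j: "j \<in> J" "y \<in> closure (V j)" by (auto simp: P_def)
  then have "infdist x (V j) < s"
    using infdist_le[of y "closure (V j)" x] \<open>dist x y < s\<close> by (simp add: infdist_closure)
  then show ?thesis using j(1) by (auto simp: nbhd_def)
qed

text \<open>Near hole \<open>j\<close> no other hole is closer. So the energy weighted by the
  distance to one hole is bounded by the one weighted with \<open>w\<close>, which does not depend
  on \<open>j\<close> and can be summed.\<close>

lemma w_collar: "j \<in> J \<Longrightarrow> x \<in> nbhd j \<rho> \<Longrightarrow> infdist x (V j) \<le> w x"
proof (rule ccontr)
  assume j: "j \<in> J" "x \<in> nbhd j \<rho>" and "\<not> infdist x (V j) \<le> w x"
  then have "w x < infdist x (V j)" by simp
  from w_less[OF this] obtain i where i: "i \<in> J" "infdist x (V i) < infdist x (V j)" by (auto simp: nbhd_def)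
  then have "x \<in> nbhd i \<rho>" using j(2) by (simp add: nbhd_def)
  then have "i = j" using nbhd_disjoint i(1) j by blast
  then show False using i(2) by simp
qed

lemma disjoint_collars: "disjoint_family_on (\<lambda>j. collar (V j) \<rho>) J"
  unfolding disjoint_family_on_def using nbhd_disjoint by (auto simp: collar_eq)

lemma inside_collar: "j \<in> inside U \<Longrightarrow> collar (V j) \<rho> \<subseteq> U - P"
  using collar_disjoint_P[of j] by (auto simp: inside_def collar_eq)

lemma hole_osc:
  assumes j: "j \<in> inside U" and ug: "upper_gradient (U - P) u g"
  shows "osc p u (collar (V j) (\<rho> / 2)) (ball (a j) r) \<le> ennreal C0 * (Lp_int p (collar (V j) \<rho>) (\<lambda>x. w x * g x))"
proof -
  have jJ: "j \<in> J" using j by (simp add: inside_def)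
  have g: "\<And>x. 0 \<le> g x" using ug by (simp add: upper_gradient_def)
  have "osc p u (collar (V j) (\<rho> / 2)) (ball (a j) r) \<le> ennreal C0 * (Lp_int p (collar (V j) \<rho>) (\<lambda>x. infdist x (V j) * g x))"
    by (rule Poincare[OF jJ upper_gradient_subset[OF ug inside_collar[OF j]]])
  also have "\<dots> \<le> ennreal C0 * (Lp_int p (collar (V j) \<rho>) (\<lambda>x. w x * g x))"
  proof (intro mult_left_mono nn_integral_mono)
    fix x
    show "ennreal ((infdist x (V j) * g x) powr p) * indicator (collar (V j) \<rho>) x \<le> ennreal ((w x * g x) powr p) * indicator (collar (V j) \<rho>) x"
      using w_collar[OF jJ, of x] g[of x] p
      by (cases "x \<in> collar (V j) \<rho>") (auto simp: collar_eq intro!: ennreal_leI powr_mono2 mult_right_mono mult_nonneg_nonneg infdist_nonneg)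
  qed simp
  finally show ?thesis .
qed

definition mB where "mB = measure lborel (ball (0::'a) r)"

lemma emeasure_hole_ball: "emeasure lborel (ball (a j) r) = ennreal mB" "0 < mB"
proof -
  have "emeasure lborel (ball (a j) r) = emeasure lborel (ball (0::'a) r)"
    using r by (simp add: emeasure_ball)
  then show "emeasure lborel (ball (a j) r) = ennreal mB"
    unfolding mB_def using emeasure_lborel_ball_finite[of "0::'a" r]
    by (simp add: emeasure_eq_ennreal_measure)
  show "0 < mB" unfolding mB_def using r by (rule content_ball_pos)
qed

text \<open>Transfers \<open>u\<close> from the reference ball, where \<open>w\<close> is at least
  \<beta>, to the whole half collar. The constant collects the oscillation bound \<open>C0\<close>,
  the collar volume \<open>m0\<close> times the loss (1 / \<beta>)^p, and the division by the volume
  \<open>mB\<close> of the reference ball.\<close>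

lemma hole_norm:
  assumes j: "j \<in> inside U" and ug: "upper_gradient (U - P) u g"
  defines "C \<equiv> 2 powr p * (C0 + m0 * (1 / \<beta>) powr p) / mB"
  shows "Lp_int p (collar (V j) (\<rho> / 2)) (\<lambda>x. \<bar>u x\<bar>) \<le>
    ennreal C * (\<integral>\<^sup>+x\<in>collar (V j) \<rho>. (ennreal ((w x * g x) powr p) + ennreal ((w x * \<bar>u x\<bar>) powr p)) \<partial>lborel)"
proof -
  have jJ: "j \<in> J" using j by (simp add: inside_def)
  have [measurable]: "u \<in> borel_measurable borel" "g \<in> borel_measurable borel" and g: "\<And>x. 0 \<le> g x"
    using ug by (auto simp: upper_gradient_def)
  let ?S = "collar (V j) (\<rho> / 2)" and ?B = "ball (a j) r" and ?D = "collar (V j) \<rho>"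
  let ?E = "\<integral>\<^sup>+x\<in>?D. ennreal ((w x * g x) powr p) \<partial>lborel" and ?E' = "\<integral>\<^sup>+x\<in>?D. ennreal ((w x * \<bar>u x\<bar>) powr p) \<partial>lborel"
  have SD: "?S \<subseteq> ?D" using \<rho> by (auto simp: collar_def)
  have "Lp_int p ?B (\<lambda>y. \<bar>u y\<bar>) \<le> (\<integral>\<^sup>+y. ennreal ((1 / \<beta>) powr p) * (ennreal ((w y * \<bar>u y\<bar>) powr p) * indicator ?D y) \<partial>lborel)"
  proof (intro nn_integral_mono)
    fix y
    show "ennreal (\<bar>u y\<bar> powr p) * indicator ?B y \<le> ennreal ((1 / \<beta>) powr p) * (ennreal ((w y * \<bar>u y\<bar>) powr p) * indicator ?D y)"
    proof (cases "y \<in> ?B")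
      case True
      then have yD: "y \<in> ?D" using ball(1)[OF jJ] SD by auto
      have "\<beta> \<le> w y" using ball(2)[OF jJ True] w_collar[OF jJ, of y] yD by (auto simp: collar_eq)
      then have "\<bar>u y\<bar> powr p \<le> (1 / \<beta> * (w y * \<bar>u y\<bar>)) powr p"
        using \<beta> p mult_right_mono[of \<beta> "w y" "\<bar>u y\<bar>"] by (intro powr_mono2) (auto simp: field_simps)
      also have "\<dots> = (1 / \<beta>) powr p * (w y * \<bar>u y\<bar>) powr p" by (rule powr_mult)
      finally show ?thesis using True yD by (simp add: ennreal_mult[symmetric] ennreal_leI)
    qed simp
  qed
  also have "\<dots> = ennreal ((1 / \<beta>) powr p) * ?E'" by (rule nn_integral_cmult) measurable
  finally have B: "Lp_int p ?B (\<lambda>y. \<bar>u y\<bar>) \<le> ennreal ((1 / \<beta>) powr p) * ?E'" .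
  have "ennreal mB * (Lp_int p ?S (\<lambda>x. \<bar>u x\<bar>)) \<le>
     ennreal (2 powr p) * (osc p u ?S ?B + emeasure lborel ?S * (Lp_int p ?B (\<lambda>y. \<bar>u y\<bar>)))"
    using osc_norm[OF p, of u ?S ?B] by (simp add: emeasure_hole_ball)
  also have "\<dots> \<le> ennreal (2 powr p) * (ennreal C0 * ?E + ennreal m0 * (ennreal ((1 / \<beta>) powr p) * ?E'))"
    by (intro mult_left_mono add_mono mult_mono hole_osc[OF j ug] B m0(1) jJ) auto
  also have "\<dots> \<le> ennreal (2 powr p) * (ennreal (C0 + m0 * (1 / \<beta>) powr p) * ?E + ennreal (C0 + m0 * (1 / \<beta>) powr p) * ?E')"
    unfolding mult.assoc[symmetric] using C0 m0(2)
    by (intro mult_left_mono add_mono mult_right_mono) (auto simp: ennreal_mult[symmetric] intro!: ennreal_leI)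
  also have "\<dots> = ennreal (2 powr p * (C0 + m0 * (1 / \<beta>) powr p)) * (?E + ?E')"
  proof -
    have K: "0 \<le> C0 + m0 * (1 / \<beta>) powr p" using C0 m0(2) by simp
    show ?thesis unfolding ennreal_mult[OF powr_ge_zero K] by (simp only: distrib_left mult.assoc)
  qed
  finally have "Lp_int p ?S (\<lambda>x. \<bar>u x\<bar>) \<le> ennreal (2 powr p * (C0 + m0 * (1 / \<beta>) powr p) / enn2real (ennreal mB)) * (?E + ?E')"
    using emeasure_hole_ball(2) C0 m0(2) by (intro ennreal_mult_le_cancel) auto
  also have "?E + ?E' = (\<integral>\<^sup>+x\<in>?D. (ennreal ((w x * g x) powr p) + ennreal ((w x * \<bar>u x\<bar>) powr p)) \<partial>lborel)"
    by (subst nn_integral_add[symmetric]) (auto simp: distrib_right)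
  finally show ?thesis using emeasure_hole_ball(2) by (simp add: C_def)
qed

text \<open>Points with \<open>w\<close> below \<rho> / 2 lie in half collars and are summed hole by
  hole; elsewhere \<open>w\<close> itself is bounded below. The condition on \<open>U\<close> says
  that no neighbourhood of a hole is cut by the boundary, so the whole collar is available around
  each hole concerned.\<close>

lemma unit_norm_bound:
  "\<exists>C\<ge>0. \<forall>U u g. (\<forall>j\<in>J. nbhd j \<rho> \<inter> U \<noteq> {} \<longrightarrow> nbhd j \<rho> \<subseteq> U) \<and> U \<in> sets borel \<and> upper_gradient (U - P) u g \<longrightarrow>
    (Lp_int p (U - P) (\<lambda>x. \<bar>u x\<bar>)) \<le>
      ennreal C * ((Lp_int p (U - P) (\<lambda>x. w x * g x)) + (Lp_int p (U - P) (\<lambda>x. w x * \<bar>u x\<bar>)))"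
proof -
  define C where "C = 2 powr p * (C0 + m0 * (1 / \<beta>) powr p) / mB"
  have C: "0 \<le> C" using C0 m0(2) emeasure_hole_ball(2) by (simp add: C_def)
  show ?thesis
  proof (intro exI[of _ "C + (2 / \<rho>) powr p"] conjI allI impI)
    show "0 \<le> C + (2 / \<rho>) powr p" using C by simp
    fix U :: "'a set" and u g :: "'a \<Rightarrow> real"
    assume A: "(\<forall>j\<in>J. nbhd j \<rho> \<inter> U \<noteq> {} \<longrightarrow> nbhd j \<rho> \<subseteq> U) \<and> U \<in> sets borel \<and> upper_gradient (U - P) u g"
    then have [measurable]: "U \<in> sets borel" and ug: "upper_gradient (U - P) u g" by auto
    then have [measurable]: "u \<in> borel_measurable borel" "g \<in> borel_measurable borel"
      by (auto simp: upper_gradient_def)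
    let ?f = "\<lambda>x. ennreal (\<bar>u x\<bar> powr p)" and ?G = "\<lambda>x. ennreal ((w x * g x) powr p) + ennreal ((w x * \<bar>u x\<bar>) powr p)"
    let ?S = "\<Union>j\<in>inside U. collar (V j) (\<rho> / 2)"
    have cin: "countable (inside U)" using J(1) by (auto simp: inside_def intro: countable_subset)
    have Sm[measurable]: "?S \<in> sets borel" using cin by (auto intro!: sets.countable_UN')
    have holes: "(\<integral>\<^sup>+x\<in>?S. ?f x \<partial>lborel) \<le> ennreal C * (\<integral>\<^sup>+x\<in>U - P. ?G x \<partial>lborel)"
    proof (rule nn_integral_UN_le[OF cin])
      show "disjoint_family_on (\<lambda>j. collar (V j) \<rho>) (inside U)"
        using disjoint_collars by (rule disjoint_family_on_mono[rotated]) (auto simp: inside_def)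
      show "collar (V j) (\<rho> / 2) \<subseteq> collar (V j) \<rho>" for j using \<rho> by (auto simp: collar_def)
    qed (use inside_collar hole_norm[OF _ ug] in \<open>auto simp: C_def\<close>)
    have far: "?f x \<le> ennreal ((2 / \<rho>) powr p) * ?G x" if x: "\<rho> / 2 \<le> w x" for x
    proof -
      have "\<bar>u x\<bar> powr p \<le> (2 / \<rho> * (w x * \<bar>u x\<bar>)) powr p"
        using x \<rho> p mult_right_mono[OF x, of "\<bar>u x\<bar>"] by (intro powr_mono2) (auto simp: field_simps)
      also have "\<dots> = (2 / \<rho>) powr p * (w x * \<bar>u x\<bar>) powr p" by (rule powr_mult)
      finally have "?f x \<le> ennreal ((2 / \<rho>) powr p) * ennreal ((w x * \<bar>u x\<bar>) powr p)"
        by (simp add: ennreal_mult[symmetric] ennreal_leI)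
      also have "\<dots> \<le> ennreal ((2 / \<rho>) powr p) * ?G x" by (intro mult_left_mono) auto
      finally show ?thesis .
    qed
    have near: "x \<in> ?S" if x: "x \<in> U - P" "w x < \<rho> / 2" for x
    proof -
      obtain j where j: "j \<in> J" "x \<in> nbhd j (\<rho> / 2)" using w_less[OF x(2)] by auto
      then have "x \<in> nbhd j \<rho>" using \<rho> by (auto simp: nbhd_def)
      then have "j \<in> inside U" using A j(1) x(1) by (auto simp: inside_def)
      then show ?thesis using j x(1) by (auto simp: collar_eq P_def)
    qed
    have "(\<integral>\<^sup>+x\<in>U - P. ?f x \<partial>lborel) \<le> (\<integral>\<^sup>+x. ?f x * indicator ?S x + ennreal ((2 / \<rho>) powr p) * (?G x * indicator (U - P) x) \<partial>lborel)"
    proof (intro nn_integral_mono)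
      fix x
      show "?f x * indicator (U - P) x \<le> ?f x * indicator ?S x + ennreal ((2 / \<rho>) powr p) * (?G x * indicator (U - P) x)"
      proof (cases "x \<in> U - P")
        case True
        show ?thesis
        proof (cases "w x < \<rho> / 2")
          case True2: True
          have "x \<in> ?S" by (rule near[OF True True2])
          then have "?f x * indicator (U - P) x \<le> ?f x * indicator ?S x" using True by simp
          then show ?thesis by (rule order_trans) simp
        next
          case False
          then have "?f x \<le> ennreal ((2 / \<rho>) powr p) * ?G x" using far by simp
          then show ?thesis using True by (simp add: add_increasing)
        qed
      qed simp
    qed
    also have "\<dots> = (\<integral>\<^sup>+x\<in>?S. ?f x \<partial>lborel) + ennreal ((2 / \<rho>) powr p) * (\<integral>\<^sup>+x\<in>U - P. ?G x \<partial>lborel)"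
      by (subst nn_integral_add) (auto simp: nn_integral_cmult)
    also have "\<dots> \<le> ennreal C * (\<integral>\<^sup>+x\<in>U - P. ?G x \<partial>lborel) + ennreal ((2 / \<rho>) powr p) * (\<integral>\<^sup>+x\<in>U - P. ?G x \<partial>lborel)"
      by (intro add_right_mono holes)
    also have "\<dots> = ennreal (C + (2 / \<rho>) powr p) * (\<integral>\<^sup>+x\<in>U - P. ?G x \<partial>lborel)"
      using C by (simp add: distrib_right)
    also have "(\<integral>\<^sup>+x\<in>U - P. ?G x \<partial>lborel) = (Lp_int p (U - P) (\<lambda>x. w x * g x)) + (Lp_int p (U - P) (\<lambda>x. w x * \<bar>u x\<bar>))"
      by (subst nn_integral_add[symmetric]) (auto simp: distrib_right)
    finally show "(\<integral>\<^sup>+x\<in>U - P. ?f x \<partial>lborel) \<le> ennreal (C + (2 / \<rho>) powr p) * \<dots>" .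
  qed
qed

text \<open>The constant is the value of \<open>u\<close> at a suitable point of the reference ball;
  dividing by the volume of that ball gives C0 / mB.\<close>

lemma hole_value:
  assumes j: "j \<in> inside U" and ug: "upper_gradient (U - P) u g"
  shows "\<exists>c. (Lp_int p (collar (V j) (\<rho> / 2)) (\<lambda>x. \<bar>u x - c\<bar>)) \<le>
    ennreal (C0 / mB) * (Lp_int p (collar (V j) \<rho>) (\<lambda>x. w x * g x))"
proof -
  let ?E = "\<integral>\<^sup>+x\<in>collar (V j) \<rho>. ennreal ((w x * g x) powr p) \<partial>lborel"
  have "\<exists>y\<in>ball (a j) r. (Lp_int p (collar (V j) (\<rho> / 2)) (\<lambda>x. \<bar>u x - u y\<bar>)) \<le>
    ennreal C0 * ?E / emeasure lborel (ball (a j) r)"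
    using ug emeasure_hole_ball
    by (intro osc_choose_point hole_osc[OF j ug]) (auto simp: upper_gradient_def)
  also have "ennreal C0 * ?E / emeasure lborel (ball (a j) r) = ennreal (C0 / mB) * ?E"
    using emeasure_hole_ball(2) C0
    by (simp add: emeasure_hole_ball(1) divide_ennreal_def inverse_ennreal ennreal_mult' divide_inverse mult_ac)
  finally show ?thesis by blast
qed

text \<open>\<open>u\<close> is extended into each hole by a constant. The extension jumps across the boundary of the hole, which does
  no harm since only its shifts at scale \<open>\<rho>\<close> are estimated.\<close>

lemma filled_short_shift:
  assumes UJ: "\<And>j. j \<in> J \<Longrightarrow> nbhd j \<rho> \<inter> U \<noteq> {} \<Longrightarrow> nbhd j \<rho> \<subseteq> U" and [measurable]: "U \<in> sets borel"
    and ug: "upper_gradient (U - P) u g"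
  defines "C \<equiv> 1 + 2 * (2 powr p) * (C0 / mB)" and "E \<equiv> \<integral>\<^sup>+x\<in>U - P. ennreal ((w x * g x) powr p) \<partial>lborel"
  obtains v where "v \<in> borel_measurable borel" "\<And>x. x \<notin> P \<Longrightarrow> v x = u x"
    "\<And>h W. norm h \<le> \<rho> / 8 \<Longrightarrow> W \<in> sets borel \<Longrightarrow> (\<And>x t. x \<in> W \<Longrightarrow> 0 \<le> t \<Longrightarrow> t \<le> 1 \<Longrightarrow> x + t *\<^sub>R h \<in> U) \<Longrightarrow>
      (Lp_int p W (\<lambda>x. \<bar>v (x + h) - v x\<bar>)) \<le> ennreal C * E"
proof -
  have [measurable]: "u \<in> borel_measurable borel" "g \<in> borel_measurable borel" and g: "\<And>x. 0 \<le> g x"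
    using ug by (auto simp: upper_gradient_def)
  let ?G = "\<lambda>x. ennreal ((w x * g x) powr p)"
  have "\<forall>j\<in>inside U. \<exists>c. (Lp_int p (collar (V j) (\<rho> / 2)) (\<lambda>x. \<bar>u x - c\<bar>)) \<le>
    ennreal (C0 / mB) * (\<integral>\<^sup>+x\<in>collar (V j) \<rho>. ?G x \<partial>lborel)"
    using hole_value[OF _ ug] by blast
  from bchoice[OF this] obtain c where c: "\<And>j. j \<in> inside U \<Longrightarrow>
     (Lp_int p (collar (V j) (\<rho> / 2)) (\<lambda>x. \<bar>u x - c j\<bar>)) \<le> ennreal (C0 / mB) * (\<integral>\<^sup>+x\<in>collar (V j) \<rho>. ?G x \<partial>lborel)"
    by blast
  define N where "N = (\<Union>j\<in>J. nbhd j \<rho>)"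
  \<comment> \<open>The filling constant is spread over the whole neighbourhood of its hole, so that
    the values at x and at x + h can be compared with the same number; 0 elsewhere is a
    default.\<close>
  define k where "k x = (if x \<in> N then c (THE j. j \<in> J \<and> x \<in> nbhd j \<rho>) else 0)" for x
  have k: "k x = c j" if "j \<in> J" "x \<in> nbhd j \<rho>" for j x
  proof -
    have "(THE j. j \<in> J \<and> x \<in> nbhd j \<rho>) = j"
    proof (rule the_equality)
      fix i assume "i \<in> J \<and> x \<in> nbhd i \<rho>"
      then show "i = j" using nbhd_disjoint[of i j x] that by simp
    qed (use that in simp)
    then show ?thesis using that by (auto simp: k_def N_def)
  qed
  have N[measurable]: "N \<in> sets borel" unfolding N_def using J by (auto intro!: sets.countable_UN')
  have km[measurable]: "k \<in> borel_measurable borel"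
  proof (rule measurable_piecewise_restrict[where C="insert (- N) ((\<lambda>j. nbhd j \<rho>) ` J)"])
    show "countable (insert (- N) ((\<lambda>j. nbhd j \<rho>) ` J))" using J by simp
    show "\<Omega> \<inter> space borel \<in> sets borel" if "\<Omega> \<in> insert (- N) ((\<lambda>j. nbhd j \<rho>) ` J)" for \<Omega>
      using that N by (auto simp: borel_open open_nbhd)
    show "space borel \<subseteq> \<Union> (insert (- N) ((\<lambda>j. nbhd j \<rho>) ` J))" by (auto simp: N_def)
    fix \<Omega> assume \<Omega>: "\<Omega> \<in> insert (- N) ((\<lambda>j. nbhd j \<rho>) ` J)"
    have "\<exists>d. \<forall>x\<in>\<Omega>. k x = d"
    proof (cases "\<Omega> = - N")
      case True then show ?thesis by (auto simp: k_def)
    next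
      case False
      then obtain j where "j \<in> J" "\<Omega> = nbhd j \<rho>" using \<Omega> by auto
      then show ?thesis using k by blast
    qed
    then obtain d where "\<forall>x\<in>\<Omega>. k x = d" by blast
    then show "k \<in> borel_measurable (restrict_space borel \<Omega>)"
      by (subst measurable_cong[where g="\<lambda>_. d"]) (auto simp: space_restrict_space)
  qed
  define v where "v x = (if x \<in> P then k x else u x)" for x
  have vm[measurable]: "v \<in> borel_measurable borel" unfolding v_def by measurable
  have vu: "v x = u x" if "x \<notin> P" for x using that by (simp add: v_def)
  have cin: "countable (inside U)" using J(1) by (auto simp: inside_def intro: countable_subset)
  have insJ: "j \<in> J" if "j \<in> inside U" for j using that by (simp add: inside_def)
  define Y where "Y = (\<Union>j\<in>inside U. collar (V j) (\<rho> / 2))"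
  have Y[measurable]: "Y \<in> sets borel" unfolding Y_def using cin by (auto intro!: sets.countable_UN')
  let ?f = "\<lambda>x. ennreal (\<bar>v x - k x\<bar> powr p)"
  have fY: "(\<integral>\<^sup>+x\<in>Y. ?f x \<partial>lborel) \<le> ennreal (C0 / mB) * E"
    unfolding Y_def E_def
  proof (rule nn_integral_UN_le[OF cin])
    show "disjoint_family_on (\<lambda>j. collar (V j) \<rho>) (inside U)"
      using disjoint_collars by (rule disjoint_family_on_mono[rotated]) (auto simp: inside_def)
    show "collar (V j) (\<rho> / 2) \<subseteq> collar (V j) \<rho>" for j using \<rho> by (auto simp: collar_def)
    fix j assume j: "j \<in> inside U"
    have "(\<integral>\<^sup>+x\<in>collar (V j) (\<rho> / 2). ?f x \<partial>lborel) = (Lp_int p (collar (V j) (\<rho> / 2)) (\<lambda>x. \<bar>u x - c j\<bar>))"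
    proof (intro nn_integral_cong)
      fix x
      show "?f x * indicator (collar (V j) (\<rho> / 2)) x = ennreal (\<bar>u x - c j\<bar> powr p) * indicator (collar (V j) (\<rho> / 2)) x"
      proof (cases "x \<in> collar (V j) (\<rho> / 2)")
        case True
        then have "x \<in> collar (V j) \<rho>" using \<rho> by (auto simp: collar_def)
        then have "x \<notin> P" "x \<in> nbhd j \<rho>" using collar_disjoint_P[OF insJ[OF j]] by (auto simp: collar_eq)
        then show ?thesis using k[OF insJ[OF j]] vu by simp
      qed simp
    qed
    then show "(\<integral>\<^sup>+x\<in>collar (V j) (\<rho> / 2). ?f x \<partial>lborel) \<le> ennreal (C0 / mB) * (\<integral>\<^sup>+x\<in>collar (V j) \<rho>. ?G x \<partial>lborel)"
      using c[OF j] by simp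
  qed (use inside_collar in auto)
  show ?thesis
  proof (rule that[OF vm vu])
    fix h :: 'a and W
    assume h: "norm h \<le> \<rho> / 8" and [measurable]: "W \<in> sets borel"
      and WU: "\<And>x t. x \<in> W \<Longrightarrow> 0 \<le> t \<Longrightarrow> t \<le> 1 \<Longrightarrow> x + t *\<^sub>R h \<in> U"
    \<comment> \<open>Thresholds for shifts of length at most \<rho> / 8: starting from
      \<open>w\<close> at least \<rho> / 4 the segment keeps \<open>w\<close> at least \<rho> / 8,
      hence at least norm h; starting from smaller \<open>w\<close>, both endpoints stay in the
      \<rho> / 2-neighbourhood of one hole.\<close>
    let ?W1 = "{x\<in>W. \<rho> / 4 \<le> w x}" and ?d = "\<lambda>x. ennreal (\<bar>v (x + h) - v x\<bar> powr p)"
    let ?K = "{x\<in>U - P. \<rho> / 8 \<le> w x}"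
    have W1m[measurable]: "?W1 \<in> sets borel" and Km[measurable]: "?K \<in> sets borel" by measurable
    have W1K: "x + t *\<^sub>R h \<in> ?K" if x: "x \<in> ?W1" and t: "0 \<le> t" "t \<le> 1" for x t
    proof -
      have "w x \<le> w (x + t *\<^sub>R h) + dist x (x + t *\<^sub>R h)" by (rule infdist_triangle)
      also have "dist x (x + t *\<^sub>R h) = t * norm h" using t by (simp add: dist_norm)
      also have "t * norm h \<le> \<rho> / 8" using h t mult_left_le_one_le[of "norm h" t] by simp
      finally have "\<rho> / 8 \<le> w (x + t *\<^sub>R h)" using x by simp
      moreover from this have "x + t *\<^sub>R h \<notin> P" using \<rho> by auto
      ultimately show ?thesis using WU x t by auto
    qed
    have far: "(\<integral>\<^sup>+x\<in>?W1. ?d x \<partial>lborel) \<le> E"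
    proof -
      have "(\<integral>\<^sup>+x\<in>?W1. ?d x \<partial>lborel) = (Lp_int p ?W1 (\<lambda>x. \<bar>u (x + h) - u x\<bar>))"
      proof (intro nn_integral_cong)
        fix x show "?d x * indicator ?W1 x = ennreal (\<bar>u (x + h) - u x\<bar> powr p) * indicator ?W1 x"
          using W1K[of x 0] W1K[of x 1] vu by (cases "x \<in> ?W1") auto
      qed
      also have "\<dots> \<le> ennreal (norm h powr p) * (Lp_int p ?K (\<lambda>y. g y))"
        by (rule upper_gradient_shift[OF p ug W1m Km _ W1K]) auto
      also have "\<dots> = (Lp_int p ?K (\<lambda>y. norm h * g y))"
        by (subst nn_integral_cmult[symmetric]) (auto simp: powr_mult ennreal_mult mult.assoc)
      also have "\<dots> \<le> E" unfolding E_def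
      proof (intro nn_integral_mono)
        fix y
        show "ennreal ((norm h * g y) powr p) * indicator ?K y \<le> ?G y * indicator (U - P) y"
        proof (cases "y \<in> ?K")
          case True
          then have "norm h \<le> w y" using h by simp
          then have "(norm h * g y) powr p \<le> (w y * g y) powr p"
            using g[of y] p by (intro powr_mono2 mult_right_mono) auto
          then show ?thesis using True by (simp add: ennreal_leI)
        qed simp
      qed
      finally show ?thesis .
    qed
    have nearpt: "?d x \<le> ennreal (2 powr p) * (?f (x + h) * indicator Y (x + h) + ?f x * indicator Y x)"
      if x: "x \<in> W" "w x < \<rho> / 4" for x
    proof -
      obtain j where j: "j \<in> J" "x \<in> nbhd j (\<rho> / 4)" using w_less[OF x(2)] by auto
      have "infdist (x + h) (V j) \<le> infdist x (V j) + dist (x + h) x" by (rule infdist_triangle)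
      then have xh: "x + h \<in> nbhd j (\<rho> / 2)" using j(2) h \<rho> by (simp add: nbhd_def dist_norm)
      have x2: "x \<in> nbhd j (\<rho> / 2)" using j(2) \<rho> by (simp add: nbhd_def)
      have sub: "nbhd j (\<rho> / 2) \<subseteq> nbhd j \<rho>" using \<rho> by (auto simp: nbhd_def)
      have "x \<in> U" using WU[OF x(1), of 0] by simp
      then have jin: "j \<in> inside U" using UJ[OF j(1)] j(1) x2 sub by (auto simp: inside_def)
      \<comment> \<open>On \<open>P\<close> the function \<open>v\<close> equals \<open>k\<close>
        and the integrand vanishes; off \<open>P\<close> such a point lies in a half collar, hence
        in \<open>Y\<close>.\<close>
      have fi: "?f y * indicator Y y = ?f y" and ky: "k y = c j" if y: "y \<in> nbhd j (\<rho> / 2)" for y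
      proof -
        show "k y = c j" using k[OF j(1)] y sub by blast
        show "?f y * indicator Y y = ?f y"
        proof (cases "y \<in> P")
          case True
          then show ?thesis using p by (simp add: v_def)
        next
          case False
          then have "y \<in> collar (V j) (\<rho> / 2)" using y j(1) by (auto simp: collar_eq P_def)
          then have "y \<in> Y" using jin by (auto simp: Y_def)
          then show ?thesis by simp
        qed
      qed
      have "\<bar>v (x + h) - v x\<bar> powr p \<le> 2 powr p * (\<bar>v (x + h) - k (x + h)\<bar> powr p + \<bar>v x - k x\<bar> powr p)"
        using powr_abs_triangle[OF p, of "v (x + h)" "v x" "c j"] ky[OF xh] ky[OF x2] by (simp add: abs_minus_commute)
      then show ?thesis unfolding fi[OF xh] fi[OF x2]
        by (auto simp: ennreal_plus[symmetric] ennreal_mult[symmetric] simp del: ennreal_plus intro!: ennreal_leI)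
    qed
    have "(\<integral>\<^sup>+x\<in>W. ?d x \<partial>lborel) \<le> (\<integral>\<^sup>+x. ?d x * indicator ?W1 x + ennreal (2 powr p) * (?f (x + h) * indicator Y (x + h) + ?f x * indicator Y x) \<partial>lborel)"
    proof (intro nn_integral_mono)
      fix x
      show "?d x * indicator W x \<le> ?d x * indicator ?W1 x + ennreal (2 powr p) * (?f (x + h) * indicator Y (x + h) + ?f x * indicator Y x)"
      proof (cases "x \<in> W \<and> w x < \<rho> / 4")
        case True
        then show ?thesis using nearpt[of x] by simp
      next
        case False
        then have "?d x * indicator W x \<le> ?d x * indicator ?W1 x" by (auto simp: indicator_def)
        then show ?thesis by (rule order_trans) simp
      qed
    qed
    also have "\<dots> = (\<integral>\<^sup>+x\<in>?W1. ?d x \<partial>lborel) + ennreal (2 powr p) * ((\<integral>\<^sup>+x. ?f (x + h) * indicator Y (x + h) \<partial>lborel) + (\<integral>\<^sup>+x\<in>Y. ?f x \<partial>lborel))"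
      by (simp add: nn_integral_add nn_integral_cmult)
    also have "(\<integral>\<^sup>+x. ?f (x + h) * indicator Y (x + h) \<partial>lborel) = (\<integral>\<^sup>+x\<in>Y. ?f x \<partial>lborel)"
      by (rule nn_integral_lborel_translate) measurable
    also have "(\<integral>\<^sup>+x\<in>?W1. ?d x \<partial>lborel) + ennreal (2 powr p) * ((\<integral>\<^sup>+x\<in>Y. ?f x \<partial>lborel) + (\<integral>\<^sup>+x\<in>Y. ?f x \<partial>lborel))
      \<le> E + ennreal (2 powr p) * (ennreal (C0 / mB) * E + ennreal (C0 / mB) * E)"
      by (intro add_mono mult_left_mono far fY) auto
    also have "\<dots> = ennreal C * E"
    proof -
      have K: "0 \<le> C0 / mB" "0 \<le> 2 * (2 powr p) * (C0 / mB)" using C0 emeasure_hole_ball(2) by auto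
      have "ennreal C = ennreal (1 + 2 powr p * (C0 / mB + C0 / mB))"
        unfolding C_def by (simp add: algebra_simps)
      also have "\<dots> = 1 + ennreal (2 powr p) * (ennreal (C0 / mB) + ennreal (C0 / mB))"
      proof -
        have "ennreal (1 + 2 powr p * (q + q)) = 1 + ennreal (2 powr p) * (ennreal q + ennreal q)" if "0 \<le> q" for q :: real
        proof -
          have "0 \<le> q + q" using that by simp
          then have "ennreal (1 + 2 powr p * (q + q)) = ennreal 1 + ennreal (2 powr p * (q + q))"
            by (intro ennreal_plus mult_nonneg_nonneg) auto
          also have "ennreal (2 powr p * (q + q)) = ennreal (2 powr p) * ennreal (q + q)"
            using \<open>0 \<le> q + q\<close> by (intro ennreal_mult) auto
          also have "ennreal (q + q) = ennreal q + ennreal q" using that by (intro ennreal_plus)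
          finally show ?thesis by simp
        qed
        then show ?thesis using K(1) by blast
      qed
      finally have "ennreal C = \<dots>" .
      then show ?thesis by (simp only: distrib_left distrib_right mult.assoc mult_1)
    qed
    finally show "(\<integral>\<^sup>+x\<in>W. ?d x \<partial>lborel) \<le> ennreal C * E" .
  qed
qed

end

section \<open>Periodic perforation and scaling\<close>

lemma nn_integral_lborel_affine:
  fixes b :: "'a::euclidean_space"
  assumes [measurable]: "f \<in> borel_measurable borel" and c: "0 < c"
  shows "(\<integral>\<^sup>+x. f x \<partial>lborel) = ennreal (c ^ DIM('a)) * (\<integral>\<^sup>+y. f (b + c *\<^sub>R y) \<partial>lborel)"
proof -
  have "(\<integral>\<^sup>+x. f x \<partial>lborel) = (\<integral>\<^sup>+x. f x \<partial>density (distr lborel borel (\<lambda>x. b + c *\<^sub>R x)) (\<lambda>_. \<bar>c\<bar> ^ DIM('a)))"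
    using c by (subst lborel_affine[of c b]) auto
  also have "\<dots> = ennreal (c ^ DIM('a)) * (\<integral>\<^sup>+y. f (b + c *\<^sub>R y) \<partial>lborel)"
    using c by (simp add: nn_integral_density nn_integral_distr nn_integral_cmult)
  finally show ?thesis .
qed

lemma AE_lborel_affine:
  fixes b :: "'a::euclidean_space"
  assumes P: "AE x in lborel. P x" and c: "0 < c"
  shows "AE y in lborel. P (b + c *\<^sub>R y)"
proof -
  from P obtain N where N: "{x. \<not> P x} \<subseteq> N" "emeasure lborel N = 0" and [measurable]: "N \<in> sets borel"
    by (auto elim!: AE_E)
  let ?M = "(\<lambda>y. b + c *\<^sub>R y) -` N"
  have M: "?M \<in> sets borel" using measurable_sets[of "\<lambda>y. b + c *\<^sub>R y" borel borel N] by simp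
  have "0 = (\<integral>\<^sup>+x. indicator N x \<partial>lborel)" using N by simp
  also have "\<dots> = ennreal (c ^ DIM('a)) * (\<integral>\<^sup>+y. indicator N (b + c *\<^sub>R y) \<partial>lborel)"
    by (rule nn_integral_lborel_affine) (use c in auto)
  also have "(\<integral>\<^sup>+y. indicator N (b + c *\<^sub>R y) \<partial>lborel) = (\<integral>\<^sup>+y. indicator ?M y \<partial>lborel)"
    by (intro nn_integral_cong) (simp add: indicator_def)
  also have "\<dots> = emeasure lborel ?M" using M by simp
  finally have "emeasure lborel ?M = 0" using c by simp
  then show ?thesis using M N(1) by (intro AE_I[of _ _ ?M]) auto
qed

text \<open>The chain rule: a shift by \<open>h\<close> in the new variable is a shift by c h in the
  old one, whose length supplies the factor \<open>c\<close>.\<close>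

lemma upper_gradient_affine:
  fixes b :: "'a::euclidean_space"
  assumes ug: "upper_gradient U u g" and c: "0 < c"
  shows "upper_gradient {y. b + c *\<^sub>R y \<in> U} (\<lambda>y. u (b + c *\<^sub>R y)) (\<lambda>y. c * g (b + c *\<^sub>R y))"
  unfolding upper_gradient_def
proof (intro conjI allI)
  have [measurable]: "u \<in> borel_measurable borel" "g \<in> borel_measurable borel" and g: "\<And>x. 0 \<le> g x"
    using ug by (auto simp: upper_gradient_def)
  show "(\<lambda>y. u (b + c *\<^sub>R y)) \<in> borel_measurable borel" "(\<lambda>y. c * g (b + c *\<^sub>R y)) \<in> borel_measurable borel" by measurable
  show "0 \<le> c * g (b + c *\<^sub>R x)" for x using g c by simp
  fix h
  have "AE x in lborel. (\<forall>t\<in>{0..1}. x + t *\<^sub>R (c *\<^sub>R h) \<in> U) \<longrightarrow>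
      ennreal \<bar>u (x + c *\<^sub>R h) - u x\<bar> \<le> (\<integral>\<^sup>+t\<in>{0..1}. ennreal (norm (c *\<^sub>R h) * g (x + t *\<^sub>R (c *\<^sub>R h))) \<partial>lborel)"
    using ug unfolding upper_gradient_def by blast
  from AE_lborel_affine[OF this c, of b]
  show "AE y in lborel. (\<forall>t\<in>{0..1}. y + t *\<^sub>R h \<in> {y. b + c *\<^sub>R y \<in> U}) \<longrightarrow>
      ennreal \<bar>u (b + c *\<^sub>R (y + h)) - u (b + c *\<^sub>R y)\<bar> \<le> (\<integral>\<^sup>+t\<in>{0..1}. ennreal (norm h * (c * g (b + c *\<^sub>R (y + t *\<^sub>R h)))) \<partial>lborel)"
    by eventually_elim (simp add: algebra_simps abs_of_pos[OF c])
qed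

lemma osc_translate:
  fixes u :: "'a::euclidean_space \<Rightarrow> real"
  assumes [measurable]: "u \<in> borel_measurable borel" "A \<in> sets borel" "B \<in> sets borel"
  shows "osc p u {x. x - z \<in> A} {x. x - z \<in> B} = osc p (\<lambda>x. u (x + z)) A B"
proof -
  have "(\<integral>\<^sup>+y\<in>{x. x - z \<in> B}. ennreal (\<bar>s - u y\<bar> powr p) \<partial>lborel) = (Lp_int p B (\<lambda>y. \<bar>s - u (y + z)\<bar>))" for s
    by (subst nn_integral_lborel_translate[of _ z, symmetric]) (auto simp: indicator_def intro!: nn_integral_cong)
  then have "osc p u {x. x - z \<in> A} {x. x - z \<in> B} =
      (\<integral>\<^sup>+x. (Lp_int p B (\<lambda>y. \<bar>u x - u (y + z)\<bar>)) * indicator {x. x - z \<in> A} x \<partial>lborel)"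
    by (simp add: osc_def)
  also have "\<dots> = osc p (\<lambda>x. u (x + z)) A B" unfolding osc_def
    by (subst nn_integral_lborel_translate[of _ z, symmetric]) (auto simp: indicator_def intro!: nn_integral_cong)
  finally show ?thesis .
qed

lemma infdist_translate: "infdist (x :: 'a::real_normed_vector) ((+) z ` A) = infdist (x - z) A"
  by (auto simp: infdist_def image_image dist_norm algebra_simps)

lemma closure_translate_mem: "x \<in> closure ((+) z ` A) \<longleftrightarrow> (x :: 'a::real_normed_vector) - z \<in> closure A"
  by (simp add: closure_translation image_iff) (metis add_diff_cancel_left' diff_add_cancel add.commute)

lemma collar_translate: "collar ((+) z ` A) s = {x. x - z \<in> collar A s}"
  by (auto simp: collar_def infdist_translate closure_translate_mem)

text \<open>Gives all lattice translates of a hole the very same Poincare constant.\<close>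

lemma collar_Poincare_translate:
  fixes A :: "'a::euclidean_space set"
  assumes *: "\<And>u g. upper_gradient (collar A \<rho>) u g \<Longrightarrow>
      osc p u (collar A s) (ball a r) \<le> ennreal C * (Lp_int p (collar A \<rho>) (\<lambda>x. infdist x A * g x))"
    and ug: "upper_gradient (collar ((+) z ` A) \<rho>) u g"
  shows "osc p u (collar ((+) z ` A) s) (ball (z + a) r) \<le>
    ennreal C * (Lp_int p (collar ((+) z ` A) \<rho>) (\<lambda>x. infdist x ((+) z ` A) * g x))"
proof -
  have [measurable]: "u \<in> borel_measurable borel" "g \<in> borel_measurable borel" using ug by (auto simp: upper_gradient_def)
  have "upper_gradient (collar A \<rho>) (\<lambda>x. u (x + z)) (\<lambda>x. g (x + z))"
    using upper_gradient_affine[OF ug[unfolded collar_translate], of 1 z] by (simp add: add.commute)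
  from *[OF this]
  have "osc p (\<lambda>x. u (x + z)) (collar A s) (ball a r) \<le> ennreal C * (Lp_int p (collar A \<rho>) (\<lambda>x. infdist x A * g (x + z)))" .
  also have "osc p (\<lambda>x. u (x + z)) (collar A s) (ball a r) = osc p u {x. x - z \<in> collar A s} {x. x - z \<in> ball a r}"
    by (rule osc_translate[symmetric]) auto
  also have "{x. x - z \<in> ball a r} = ball (z + a) r" by (auto simp: dist_norm algebra_simps)
  also have "(Lp_int p (collar A \<rho>) (\<lambda>x. infdist x A * g (x + z))) =
     (\<integral>\<^sup>+x\<in>{x. x - z \<in> collar A \<rho>}. ennreal ((infdist (x - z) A * g x) powr p) \<partial>lborel)"
    by (subst nn_integral_lborel_translate[of _ z, symmetric]) (auto simp: indicator_def intro!: nn_integral_cong)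
  finally show ?thesis by (simp add: collar_translate infdist_translate)
qed

text \<open>The segment from x to a point outside \<open>S\<close> must cross the frontier of
  \<open>S\<close>, which is at least \<open>c\<close> away from x.\<close>

lemma dist_ge_of_setdist_frontier:
  fixes A S :: "'a::euclidean_space set"
  assumes AS: "A \<subseteq> S" and c: "0 < c" "c \<le> setdist A (frontier S)" and x: "x \<in> closure A" and y: "y \<notin> S"
  shows "c \<le> dist x y"
proof -
  have d: "c \<le> dist x q" if "q \<in> frontier S" for q
    using setdist_le_dist[of x "closure A" q "frontier S"] x that c(2) by simp
  have "x \<in> S"
  proof (rule ccontr)
    assume "x \<notin> S"
    then have "x \<in> frontier S" using closure_mono[OF AS] x interior_subset by (auto simp: frontier_def)
    then show False using d[of x] c(1) by simp
  qed
  then have "closed_segment x y \<inter> frontier S \<noteq> {}"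
    using y by (intro connected_Int_frontier) auto
  then obtain q where q: "q \<in> closed_segment x y" "q \<in> frontier S" by auto
  then have "dist x q \<le> dist x y" using segment_bound(1)[OF q(1)] by (simp add: dist_norm norm_minus_commute)
  then show ?thesis using d[OF q(2)] by simp
qed

lemma finite_choice_down:
  fixes Q :: "nat \<Rightarrow> real \<Rightarrow> bool"
  assumes "\<And>i. i < m \<Longrightarrow> \<exists>c>0. Q i c" "\<And>i c c'. i < m \<Longrightarrow> Q i c \<Longrightarrow> 0 < c' \<Longrightarrow> c' \<le> c \<Longrightarrow> Q i c'"
  shows "\<exists>c>0. \<forall>i<m. Q i c"
  using assms
proof (induction m)
  case (Suc m)
  from Suc.IH Suc.prems obtain c where c: "0 < c" "\<And>i. i < m \<Longrightarrow> Q i c" by (metis less_SucI)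
  from Suc.prems(1)[of m] obtain d where d: "0 < d" "Q m d" by auto
  have "Q i (min c d)" if "i < Suc m" for i
    using that c d Suc.prems(2)[of i c "min c d"] Suc.prems(2)[of i d "min c d"] by (cases "i = m") auto
  then show ?case using c d by (intro exI[of _ "min c d"]) auto
qed (auto intro: exI[of _ 1])

lemma finite_choice_up:
  fixes Q :: "nat \<Rightarrow> real \<Rightarrow> bool"
  assumes "\<And>i. i < m \<Longrightarrow> \<exists>c\<ge>0. Q i c" "\<And>i c c'. i < m \<Longrightarrow> Q i c \<Longrightarrow> c \<le> c' \<Longrightarrow> Q i c'"
  shows "\<exists>c\<ge>0. \<forall>i<m. Q i c"
  using assms
proof (induction m)
  case (Suc m)
  from Suc.IH Suc.prems obtain c where c: "0 \<le> c" "\<And>i. i < m \<Longrightarrow> Q i c" by (metis less_SucI)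
  from Suc.prems(1)[of m] obtain d where d: "0 \<le> d" "Q m d" by auto
  have "Q i (max c d)" if "i < Suc m" for i
    using that c d Suc.prems(2)[of i c "max c d"] Suc.prems(2)[of i d "max c d"] by (cases "i = m") auto
  then show ?case using c d by (intro exI[of _ "max c d"]) auto
qed (auto intro: exI[of _ 0])

text \<open>The neighbourhood is a union of balls centred in the closure; each ball is joined to the
  connected closure, which all the pieces share.\<close>

lemma connected_infdist_nbhd:
  fixes A :: "'a::euclidean_space set"
  assumes "connected (closure A)" "A \<noteq> {}" "0 < s"
  shows "connected {x. infdist x A < s}"
proof -
  have eq: "{x. infdist x A < s} = (\<Union>q\<in>closure A. closure A \<union> ball q s)"
  proof (intro set_eqI iffI)
    fix x assume x: "x \<in> {x. infdist x A < s}"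
    obtain q where "q \<in> closure A" "infdist x (closure A) = dist x q"
      using infdist_attains_inf[of "closure A" x] assms(2) by auto
    then show "x \<in> (\<Union>q\<in>closure A. closure A \<union> ball q s)" using x by (auto simp: infdist_closure dist_commute)
  next
    fix x assume "x \<in> (\<Union>q\<in>closure A. closure A \<union> ball q s)"
    then obtain q where "q \<in> closure A" "x \<in> closure A \<union> ball q s" by (rule UN_E)
    then have q: "q \<in> closure A" "x \<in> closure A \<or> dist x q < s" by (simp_all add: dist_commute)
    have "infdist x (closure A) < s"
    proof (cases "x \<in> closure A")
      case True then show ?thesis using assms(3) by simp
    next
      case False
      then show ?thesis using infdist_le[OF q(1), of x] q(2) by simp
    qed
    then show "x \<in> {x. infdist x A < s}" by (simp add: infdist_closure)
  qed
  have "connected (closure A \<union> ball q s)" if "q \<in> closure A" for q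
    using that assms by (intro connected_Un) auto
  then show ?thesis unfolding eq using assms(2) by (intro connected_Union) auto
qed

section \<open>The integer lattice, its cells and the periodic perforation\<close>

lemma countable_int_lattice: "countable (int_lattice :: (real^'n) set)"
proof -
  have "(int_lattice :: (real^'n) set) \<subseteq> (\<lambda>f. \<chi> i. real_of_int (f i)) ` (UNIV :: ('n \<Rightarrow> int) set)"
  proof
    fix z :: "real^'n" assume "z \<in> int_lattice"
    then have "\<forall>i. \<exists>k::int. z $ i = real_of_int k" unfolding int_lattice_def Ints_def by auto
    from choice[OF this] obtain f where "\<And>i. z $ i = real_of_int (f i)" by blast
    then have "z = (\<chi> i. real_of_int (f i))" by (simp add: vec_eq_iff)
    then show "z \<in> (\<lambda>f. \<chi> i. real_of_int (f i)) ` UNIV" by auto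
  qed
  moreover have "countable (UNIV :: ('n \<Rightarrow> int) set)"
    using countable_PiE[of "UNIV :: 'n set" "\<lambda>_. UNIV :: int set"] by simp
  ultimately show ?thesis by (meson countable_image countable_subset)
qed

lemma closed_int_lattice: "closed (int_lattice :: (real^'n) set)"
proof -
  have "closed ((\<lambda>z :: real^'n. z $ i) -` \<int>)" for i
    by (intro continuous_closed_vimage closed_Ints continuous_intros)
  then have "closed (\<Inter>i. (\<lambda>z :: real^'n. z $ i) -` \<int>)" by (intro closed_INT) auto
  moreover have "(\<Inter>i. (\<lambda>z :: real^'n. z $ i) -` \<int>) = int_lattice" by (auto simp: int_lattice_def)
  ultimately show ?thesis by simp
qed

lemma zero_in_int_lattice: "0 \<in> int_lattice"
  by (simp add: int_lattice_def)

lemma bounded_unit_cell: "bounded (unit_cell :: (real^'n) set)"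
proof -
  have "unit_cell \<subseteq> cbox ((\<chi> i. - 1 / 2) :: real^'n) (\<chi> i. 1 / 2)"
    by (auto simp: unit_cell_def mem_box_cart less_imp_le)
  then show ?thesis using bounded_cbox bounded_subset by blast
qed

lemma unit_cell_lattice_unique:
  fixes x :: "real^'n"
  assumes x: "x - y \<in> unit_cell" "x - z \<in> unit_cell" and yz: "y \<in> int_lattice" "z \<in> int_lattice"
  shows "y = z"
proof -
  have "y $ i = z $ i" for i
  proof -
    have "- 1 / 2 < (x - y) $ i \<and> (x - y) $ i < 1 / 2" "- 1 / 2 < (x - z) $ i \<and> (x - z) $ i < 1 / 2"
      using x unfolding unit_cell_def by blast+
    then have 1: "\<bar>y $ i - z $ i\<bar> < 1" unfolding abs_less_iff vector_minus_component by linarith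
    have "y $ i - z $ i \<in> \<int>" using yz by (simp add: int_lattice_def)
    then obtain k where k: "y $ i - z $ i = of_int k" by (rule Ints_cases)
    then have "\<bar>real_of_int k\<bar> < 1" using 1 by (simp only:)
    then have "k = 0" by linarith
    then show ?thesis using k by simp
  qed
  then show ?thesis by (simp add: vec_eq_iff)
qed

lemma perf_set_scale: "0 < \<epsilon> \<Longrightarrow> x \<in> perf_set \<epsilon> T \<longleftrightarrow> (1 / \<epsilon>) *\<^sub>R x \<in> perf_set 1 T"
proof -
  assume e: "0 < \<epsilon>"
  have "x = \<epsilon> *\<^sub>R y \<longleftrightarrow> (1 / \<epsilon>) *\<^sub>R x = y" for y using e by auto
  then show ?thesis by (auto simp: perf_set_def image_iff)
qed

lemma closed_perf_set_1: "compact T \<Longrightarrow> closed (perf_set 1 T)"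
proof -
  assume "compact T"
  then have "closed (\<Union>x\<in>int_lattice. \<Union>y\<in>T. {x + y})" by (intro closed_compact_sums closed_int_lattice)
  moreover have "(\<Union>x\<in>int_lattice. \<Union>y\<in>T. {x + y}) = perf_set 1 T" by (auto simp: perf_set_def)
  ultimately show ?thesis by simp
qed

text \<open>The translated cells are open and miss the hyperplanes through their faces; there are
  countably many of these, and each is a null set.\<close>

lemma AE_in_translated_cell: "AE x in lborel. \<exists>z\<in>int_lattice. x - z \<in> (unit_cell :: (real^'n) set)"
proof -
  have null: "AE x in lborel. (x :: real^'n) $ i \<noteq> c" for i c
  proof -
    have "negligible {x :: real^'n. x \<bullet> axis i 1 = c}"
      by (intro negligible_standard_hyperplane) (auto simp: Basis_vec_def)
    then have "negligible {x :: real^'n. x $ i = c}" by (simp add: inner_axis)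
    then have "AE x in lebesgue. x \<notin> {x :: real^'n. x $ i = c}"
      unfolding negligible_iff_null_sets by (rule AE_not_in)
    then show ?thesis by (simp add: AE_completion_iff)
  qed
  have "AE x in lborel. \<forall>i. \<forall>k::int. (x :: real^'n) $ i \<noteq> real_of_int k - 1 / 2"
  proof -
    have "AE x in lborel. \<forall>k::int. (x :: real^'n) $ i \<noteq> real_of_int k - 1 / 2" for i
      using null by (simp add: AE_all_countable)
    then show ?thesis by (simp add: AE_all_countable)
  qed
  then show ?thesis
  proof eventually_elim
    case (elim x)
    \<comment> \<open>Rounds each coordinate to the nearest integer; \<open>elim\<close> excludes
      ties.\<close>
    define z :: "real^'n" where "z = (\<chi> i. real_of_int \<lfloor>x $ i + 1 / 2\<rfloor>)"
    have "- 1 / 2 < x $ i - z $ i \<and> x $ i - z $ i < 1 / 2" for i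
    proof -
      have "real_of_int \<lfloor>x $ i + 1 / 2\<rfloor> \<noteq> x $ i + 1 / 2" using elim by (metis add_diff_cancel_right')
      then have "real_of_int \<lfloor>x $ i + 1 / 2\<rfloor> < x $ i + 1 / 2" using of_int_floor_le[of "x $ i + 1 / 2"] by linarith
      moreover have "x $ i + 1 / 2 < real_of_int \<lfloor>x $ i + 1 / 2\<rfloor> + 1" by linarith
      ultimately show ?thesis unfolding z_def vec_lambda_beta by linarith
    qed
    then have "x - z \<in> unit_cell" by (simp add: unit_cell_def)
    moreover have "z \<in> int_lattice" by (simp add: z_def int_lattice_def)
    ultimately show ?case by blast
  qed
qed

text \<open>The bound is given on one open cell, with the distance to \<open>T\<close> alone.
  Periodicity moves it to all cells, and the distance to the whole perforation can only be smaller
  than the distance to the holes of one cell. The faces of the cells are the reason for the almost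
  everywhere form.\<close>

lemma weight_lower_bound:
  fixes T :: "(real^'n) set"
  assumes T: "T \<noteq> {}" and per: "\<forall>z\<in>int_lattice. \<forall>y. y \<notin> perf_set 1 T \<longrightarrow> \<phi> (y + z) = \<phi> y"
    and c: "0 < c" and bd: "\<forall>y\<in>unit_cell - T. c * infdist y T \<le> \<phi> y"
  shows "AE x in lborel. x \<notin> perf_set 1 T \<longrightarrow> c * infdist x (perf_set 1 T) \<le> \<phi> x"
  using AE_in_translated_cell
proof eventually_elim
  case (elim x)
  then obtain z where z: "z \<in> int_lattice" "x - z \<in> unit_cell" by blast
  show ?case
  proof
    assume x: "x \<notin> perf_set 1 T"
    have mem: "q + z \<in> perf_set 1 T" if q: "q \<in> perf_set 1 T" for q
    proof -
      from q obtain y t where "y \<in> int_lattice" "t \<in> T" "q = y + t" by (auto simp: perf_set_def)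
      moreover have "y + z \<in> int_lattice" using \<open>y \<in> int_lattice\<close> z(1) by (simp add: int_lattice_def)
      ultimately show ?thesis unfolding perf_set_def
        by (intro UN_I[of "y + z"]) (auto simp: image_iff algebra_simps)
    qed
    have TP: "t + z \<in> perf_set 1 T" if "t \<in> T" for t
      unfolding perf_set_def using that z(1) by (intro UN_I[of z]) (auto simp: image_iff add.commute)
    have xz: "x - z \<notin> perf_set 1 T" using mem[of "x - z"] x by auto
    have xT: "x - z \<notin> T" using TP[of "x - z"] x by auto
    have "infdist x (perf_set 1 T) \<le> dist (x - z) t" if "t \<in> T" for t
      using infdist_le[OF TP[OF that], of x] by (simp add: dist_norm algebra_simps)
    then have "infdist x (perf_set 1 T) \<le> infdist (x - z) T"
      using T by (simp add: infdist_notempty cINF_greatest)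
    then have "c * infdist x (perf_set 1 T) \<le> c * infdist (x - z) T" using c by simp
    also have "\<dots> \<le> \<phi> (x - z)" using bd z(2) xT by blast
    also have "\<dots> = \<phi> x" using per z(1) xz by force
    finally show "c * infdist x (perf_set 1 T) \<le> \<phi> x" .
  qed
qed

lemma collar_nonempty:
  fixes U :: "'a::euclidean_space set"
  assumes U: "open U" "U \<noteq> {}" "bounded U" and sm: "smooth_boundary U" and s: "0 < s"
  obtains x where "x \<in> collar U s"
proof -
  have "frontier U \<noteq> {}" using U not_bounded_UNIV frontier_eq_empty[of U] by auto
  then obtain x0 where x0: "x0 \<in> frontier U" by auto
  obtain z where z: "z \<in> ball x0 s - closure U"
    using exterior_locally_connected[OF U(1) x0 sm s] by metis
  have "infdist z (closure U) \<le> dist z x0" using x0 by (intro infdist_le) (simp add: frontier_def)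
  then have "z \<in> collar U s" using z by (simp add: collar_def infdist_closure dist_commute)
  then show ?thesis by (rule that)
qed

lemma emeasure_lborel_translate:
  fixes z :: "'a::euclidean_space"
  assumes [measurable]: "S \<in> sets borel"
  shows "emeasure lborel {x. x - z \<in> S} = emeasure lborel S"
proof -
  have m: "{x. x - z \<in> S} \<in> sets borel" using measurable_sets[of "\<lambda>y. y - z" borel borel S] by (simp add: vimage_def)
  have "emeasure lborel {x. x - z \<in> S} = (\<integral>\<^sup>+x. indicator {x. x - z \<in> S} x \<partial>lborel)" using m by simp
  also have "\<dots> = (\<integral>\<^sup>+x. indicator {x. x - z \<in> S} (x + z) \<partial>lborel)"
    using m by (intro nn_integral_lborel_translate[symmetric]) simp
  also have "\<dots> = (\<integral>\<^sup>+x. indicator S x \<partial>lborel)" by (intro nn_integral_cong) (simp add: indicator_def)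
  finally show ?thesis by simp
qed

text \<open>Within one cell the assumed distance of the holes applies. For different cells the
  second point lies outside the cell of the first, and the first hole keeps distance
  \<open>c0\<close> from the frontier of its cell.\<close>

lemma hole_separation:
  fixes \<tau> :: "nat \<Rightarrow> (real^'n) set"
  assumes c0: "0 < c0"
    and cell: "\<And>i. i < m \<Longrightarrow> \<tau> i \<subseteq> unit_cell \<and> c0 \<le> setdist (\<tau> i) (frontier unit_cell)"
    and sep: "\<And>i j. i < m \<Longrightarrow> j < m \<Longrightarrow> i \<noteq> j \<Longrightarrow> c0 \<le> setdist (\<tau> i) (\<tau> j)"
    and i: "i < m" "y \<in> int_lattice" "x - y \<in> closure (\<tau> i)" and j: "j < m" "z \<in> int_lattice" "x' - z \<in> closure (\<tau> j)"
    and ne: "(y, i) \<noteq> (z, j)"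
  shows "c0 \<le> dist x x'"
proof (cases "y = z")
  case True
  then have "c0 \<le> setdist (closure (\<tau> i)) (closure (\<tau> j))" using sep[OF i(1) j(1)] ne by simp
  also have "\<dots> \<le> dist (x - y) (x' - z)" by (rule setdist_le_dist[OF i(3) j(3)])
  finally show ?thesis using True by (simp add: dist_norm)
next
  case False
  have "q \<in> unit_cell" if "q \<in> closure (\<tau> k)" "k < m" for q k
    using dist_ge_of_setdist_frontier[of "\<tau> k" unit_cell c0 q q] cell[OF that(2)] c0 that(1) by auto
  then have xz: "x' - z \<in> unit_cell" using j by blast
  have "x' - y \<notin> unit_cell" using unit_cell_lattice_unique[OF _ xz] i(2) j(2) False by blast
  then have "c0 \<le> dist (x - y) (x' - y)"
    using cell[OF i(1)] c0 i(3) by (intro dist_ge_of_setdist_frontier) auto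
  then show ?thesis by (simp add: dist_norm)
qed

text \<open>All constants are chosen for the \<open>m\<close> holes of one cell, where finitely many
  choices have a common value, and are carried to the lattice translates by translation
  invariance.\<close>

lemma periodic_hole_system:
  fixes \<tau> :: "nat \<Rightarrow> (real^'n) set"
  assumes p: "1 < p" and c0: "0 < c0" and m: "1 \<le> m"
    and holes: "\<And>i. i < m \<Longrightarrow> open (\<tau> i) \<and> smooth_boundary (\<tau> i) \<and> connected (frontier (\<tau> i))
      \<and> \<tau> i \<subseteq> unit_cell \<and> c0 \<le> setdist (\<tau> i) (frontier unit_cell)"
    and sep: "\<And>i j. i < m \<Longrightarrow> j < m \<Longrightarrow> i \<noteq> j \<Longrightarrow> c0 \<le> setdist (\<tau> i) (\<tau> j)"
  shows "\<exists>a r \<beta> C0 m0. hole_system p (c0 / 4) (int_lattice \<times> {..<m}) (\<lambda>j. (+) (fst j) ` \<tau> (snd j)) a r \<beta> C0 m0"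
proof -
  \<comment> \<open>A quarter of \<open>c0\<close> gives the required separation 2 * \<rho> and
    matches the margin c0 / 4 by which the extended holes exceed the holes.\<close>
  define \<rho> where "\<rho> = c0 / 4"
  have \<rho>: "0 < \<rho>" using c0 by (simp add: \<rho>_def)
  \<comment> \<open>The distance to an empty set is 0 by convention, so a positive \<open>c0\<close>
    rules out empty holes.\<close>
  have ne: "\<tau> i \<noteq> {}" if "i < m" for i using holes[OF that] c0 by auto
  have bnd: "bounded (\<tau> i)" if "i < m" for i using holes[OF that] bounded_unit_cell bounded_subset by blast
  have "\<forall>i. \<exists>x. i < m \<longrightarrow> x \<in> collar (\<tau> i) (\<rho> / 2)"
    using collar_nonempty[of "\<tau> _" "\<rho> / 2"] holes ne bnd \<rho> by (metis half_gt_zero)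
  from choice[OF this] obtain a where a: "\<And>i. i < m \<Longrightarrow> a i \<in> collar (\<tau> i) (\<rho> / 2)" by blast
  have "\<exists>r>0. \<forall>i<m. cball (a i) r \<subseteq> collar (\<tau> i) (\<rho> / 2)"
  proof (rule finite_choice_down)
    fix i assume "i < m"
    then show "\<exists>r>0. cball (a i) r \<subseteq> collar (\<tau> i) (\<rho> / 2)"
      using a open_collar[of "\<tau> i" "\<rho> / 2"] unfolding open_contains_cball by auto
  next
    fix i and c c' :: real assume "cball (a i) c \<subseteq> collar (\<tau> i) (\<rho> / 2)" "c' \<le> c"
    then show "cball (a i) c' \<subseteq> collar (\<tau> i) (\<rho> / 2)" using subset_cball[of c' c "a i"] by blast
  qed
  then obtain r where r: "0 < r" "\<And>i. i < m \<Longrightarrow> cball (a i) r \<subseteq> collar (\<tau> i) (\<rho> / 2)" by blast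
  have "\<exists>\<beta>>0. \<forall>i<m. \<forall>x\<in>cball (a i) r. \<beta> \<le> infdist x (\<tau> i)"
    by (rule finite_choice_down) (use collar_inner_bound[OF ne r(2)] in \<open>auto intro: order_trans\<close>)
  then obtain \<beta> where \<beta>: "0 < \<beta>" "\<And>i x. i < m \<Longrightarrow> x \<in> cball (a i) r \<Longrightarrow> \<beta> \<le> infdist x (\<tau> i)" by blast
  have "\<exists>M\<ge>0. \<forall>i<m. emeasure lborel (collar (\<tau> i) (\<rho> / 2)) \<le> ennreal M"
  proof (rule finite_choice_up)
    fix i assume "i < m"
    then have "emeasure lborel (collar (\<tau> i) (\<rho> / 2)) < \<infinity>"
      by (intro emeasure_bounded_finite bounded_collar bnd ne)
    then show "\<exists>M\<ge>0. emeasure lborel (collar (\<tau> i) (\<rho> / 2)) \<le> ennreal M"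
      by (cases "emeasure lborel (collar (\<tau> i) (\<rho> / 2))") auto
  qed (auto intro: order_trans ennreal_leI)
  then obtain m0 where m0: "0 \<le> m0" "\<And>i. i < m \<Longrightarrow> emeasure lborel (collar (\<tau> i) (\<rho> / 2)) \<le> ennreal m0" by blast
  let ?Q = "\<lambda>i C. \<forall>u g. upper_gradient (collar (\<tau> i) \<rho>) u g \<longrightarrow> osc p u (collar (\<tau> i) (\<rho> / 2)) (ball (a i) r)
      \<le> ennreal C * (Lp_int p (collar (\<tau> i) \<rho>) (\<lambda>x. infdist x (\<tau> i) * g x))"
  have "\<exists>C\<ge>0. \<forall>i<m. ?Q i C"
  proof (rule finite_choice_up)
    fix i assume i: "i < m"
    have "collar (\<tau> i) (\<rho> / 2) \<subseteq> collar (\<tau> i) \<rho>" using \<rho> by (auto simp: collar_def)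
    then show "\<exists>C\<ge>0. ?Q i C"
      using holes[OF i] r(2)[OF i] by (intro collar_Poincare[OF p _ ne[OF i] bnd[OF i] _ _ \<rho> _ r(1)]) auto
  next
    fix i and c c' :: real assume "?Q i c" "c \<le> c'"
    then show "?Q i c'" using mult_right_mono[OF ennreal_leI[OF \<open>c \<le> c'\<close>]] order_trans by (meson zero_le)
  qed
  then obtain C0 where C0: "0 \<le> C0" "\<And>i. i < m \<Longrightarrow> ?Q i C0" by blast
  let ?V = "\<lambda>j :: (real^'n) \<times> nat. (+) (fst j) ` \<tau> (snd j)" and ?J = "(int_lattice :: (real^'n) set) \<times> {..<m}"
  have "hole_system p \<rho> ?J ?V (\<lambda>j. fst j + a (snd j)) r \<beta> C0 m0"
  proof
    show "1 < p" "0 < \<rho>" "0 < r" "0 < \<beta>" "0 \<le> C0" "0 \<le> m0" by fact+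
    show "countable ?J" using countable_int_lattice by auto
    have "(0, 0) \<in> ?J" using zero_in_int_lattice m by simp
    then show "?J \<noteq> {}" by (metis empty_iff)
    fix j :: "(real^'n) \<times> nat" assume j: "j \<in> ?J"
    show "open (?V j)" using holes[of "snd j"] j by (auto intro: open_translation)
    show "?V j \<noteq> {}" using ne[of "snd j"] j by auto
    show "emeasure lborel (collar (?V j) (\<rho> / 2)) \<le> ennreal m0"
      using m0(2)[of "snd j"] j by (simp add: collar_translate emeasure_lborel_translate mem_Times_iff)
    show "ball (fst j + a (snd j)) r \<subseteq> collar (?V j) (\<rho> / 2)"
    proof
      fix x assume "x \<in> ball (fst j + a (snd j)) r"
      then have "x - fst j \<in> cball (a (snd j)) r" by (simp add: dist_norm algebra_simps)
      moreover have "snd j < m" using j by auto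
      ultimately have "x - fst j \<in> collar (\<tau> (snd j)) (\<rho> / 2)" using r(2) by blast
      then show "x \<in> collar (?V j) (\<rho> / 2)" by (simp add: collar_translate)
    qed
    show "\<beta> \<le> infdist x (?V j)" if "x \<in> ball (fst j + a (snd j)) r" for x
    proof -
      have "x - fst j \<in> cball (a (snd j)) r" using that by (simp add: dist_norm algebra_simps)
      then show ?thesis using \<beta>(2)[of "snd j"] j by (simp add: infdist_translate mem_Times_iff)
    qed
    show "osc p u (collar (?V j) (\<rho> / 2)) (ball (fst j + a (snd j)) r)
      \<le> ennreal C0 * (Lp_int p (collar (?V j) \<rho>) (\<lambda>x. infdist x (?V j) * g x))"
      if "upper_gradient (collar (?V j) \<rho>) u g" for u g
      using C0(2)[of "snd j"] j by (intro collar_Poincare_translate[OF _ that]) auto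
  next
    fix i j :: "(real^'n) \<times> nat" and x y
    assume *: "i \<in> ?J" "j \<in> ?J" "i \<noteq> j" "x \<in> closure (?V i)" "y \<in> closure (?V j)"
    have "c0 \<le> dist x y"
      by (rule hole_separation[of c0 m \<tau> "snd i" "fst i" x "snd j" "fst j" y])
         (use * holes sep c0 in \<open>auto simp: closure_translate_mem prod_eq_iff\<close>)
    then show "2 * \<rho> \<le> dist x y" using c0 by (simp add: \<rho>_def)
  qed
  then show ?thesis unfolding \<rho>_def by blast
qed

lemma nn_integral_scale_set:
  fixes F :: "'a::euclidean_space \<Rightarrow> ennreal"
  assumes [measurable]: "F \<in> borel_measurable borel" "D \<in> sets borel" and \<epsilon>: "0 < \<epsilon>"
  shows "ennreal (\<epsilon> ^ DIM('a)) * (\<integral>\<^sup>+y\<in>{y. \<epsilon> *\<^sub>R y \<in> D}. F (\<epsilon> *\<^sub>R y) \<partial>lborel) = (\<integral>\<^sup>+x\<in>D. F x \<partial>lborel)"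
proof -
  have "(\<integral>\<^sup>+x\<in>D. F x \<partial>lborel) = ennreal (\<epsilon> ^ DIM('a)) * (\<integral>\<^sup>+y. F (0 + \<epsilon> *\<^sub>R y) * indicator D (0 + \<epsilon> *\<^sub>R y) \<partial>lborel)"
    by (rule nn_integral_lborel_affine) (use \<epsilon> in auto)
  also have "(\<integral>\<^sup>+y. F (0 + \<epsilon> *\<^sub>R y) * indicator D (0 + \<epsilon> *\<^sub>R y) \<partial>lborel) = (\<integral>\<^sup>+y\<in>{y. \<epsilon> *\<^sub>R y \<in> D}. F (\<epsilon> *\<^sub>R y) \<partial>lborel)"
    by (intro nn_integral_cong) (simp add: indicator_def)
  finally show ?thesis by simp
qed

section \<open>Dilation of the hole system to period \<epsilon>\<close>

context hole_system
begin

definition holes_at where "holes_at \<epsilon> = {x. (1 / \<epsilon>) *\<^sub>R x \<in> P}"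

text \<open>The form in which the assumption on the extended holes reaches the estimates.\<close>

definition compatible where
  "compatible \<epsilon> S \<longleftrightarrow> (\<forall>j\<in>J. (\<lambda>y. \<epsilon> *\<^sub>R y) ` nbhd j \<rho> \<inter> S \<noteq> {} \<longrightarrow> (\<lambda>y. \<epsilon> *\<^sub>R y) ` nbhd j \<rho> \<subseteq> S)"

lemma holes_at_borel [measurable]: "holes_at \<epsilon> \<in> sets borel"
  unfolding holes_at_def using measurable_sets[of "\<lambda>x. (1 / \<epsilon>) *\<^sub>R x" borel borel P] by (simp add: vimage_def)

lemma scaled_sets:
  assumes \<epsilon>: "0 < \<epsilon>" and [measurable]: "S \<in> sets borel" and comp: "compatible \<epsilon> S"
  shows "{y. \<epsilon> *\<^sub>R y \<in> S - holes_at \<epsilon>} = {y. \<epsilon> *\<^sub>R y \<in> S} - P"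
    "{y. \<epsilon> *\<^sub>R y \<in> S} \<in> sets borel"
    "\<And>j. j \<in> J \<Longrightarrow> nbhd j \<rho> \<inter> {y. \<epsilon> *\<^sub>R y \<in> S} \<noteq> {} \<Longrightarrow> nbhd j \<rho> \<subseteq> {y. \<epsilon> *\<^sub>R y \<in> S}"
proof -
  show "{y. \<epsilon> *\<^sub>R y \<in> S - holes_at \<epsilon>} = {y. \<epsilon> *\<^sub>R y \<in> S} - P" using \<epsilon> by (auto simp: holes_at_def)
  show "{y. \<epsilon> *\<^sub>R y \<in> S} \<in> sets borel"
    using measurable_sets[of "\<lambda>y. \<epsilon> *\<^sub>R y" borel borel S] by (simp add: vimage_def)
  fix j assume "j \<in> J" and ne: "nbhd j \<rho> \<inter> {y. \<epsilon> *\<^sub>R y \<in> S} \<noteq> {}"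
  from ne obtain y where "y \<in> nbhd j \<rho>" "\<epsilon> *\<^sub>R y \<in> S" by auto
  then have "(\<lambda>y. \<epsilon> *\<^sub>R y) ` nbhd j \<rho> \<inter> S \<noteq> {}" by auto
  then have "(\<lambda>y. \<epsilon> *\<^sub>R y) ` nbhd j \<rho> \<subseteq> S" using comp \<open>j \<in> J\<close> unfolding compatible_def by simp
  then show "nbhd j \<rho> \<subseteq> {y. \<epsilon> *\<^sub>R y \<in> S}" by auto
qed

lemma scaled_upper_gradient:
  assumes \<epsilon>: "0 < \<epsilon>" and S: "S \<in> sets borel" and comp: "compatible \<epsilon> S" and ug: "upper_gradient (S - holes_at \<epsilon>) u g"
  shows "upper_gradient ({y. \<epsilon> *\<^sub>R y \<in> S} - P) (\<lambda>y. u (\<epsilon> *\<^sub>R y)) (\<lambda>y. \<epsilon> * g (\<epsilon> *\<^sub>R y))"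
  using upper_gradient_affine[OF ug \<epsilon>, of 0] by (simp only: add_0 scaled_sets(1)[OF \<epsilon> S comp])

text \<open>The factor \<epsilon>^p comes from the chain rule for \<open>g\<close>. The Jacobian
  stays with the integral at period 1, because the other integrals of an estimate carry it
  too.\<close>

lemma scaled_energy:
  assumes \<epsilon>: "0 < \<epsilon>" and S[measurable]: "S \<in> sets borel" and comp: "compatible \<epsilon> S" and ug: "upper_gradient (S - holes_at \<epsilon>) u g"
  shows "ennreal (\<epsilon> ^ DIM('a)) * (\<integral>\<^sup>+y\<in>{y. \<epsilon> *\<^sub>R y \<in> S} - P. ennreal ((w y * (\<epsilon> * g (\<epsilon> *\<^sub>R y))) powr p) \<partial>lborel) =
    ennreal (\<epsilon> powr p) * (Lp_int p (S - holes_at \<epsilon>) (\<lambda>x. w ((1 / \<epsilon>) *\<^sub>R x) * g x))"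
proof -
  have [measurable]: "g \<in> borel_measurable borel" using ug by (simp add: upper_gradient_def)
  let ?F = "\<lambda>x. ennreal (\<epsilon> powr p) * ennreal ((w ((1 / \<epsilon>) *\<^sub>R x) * g x) powr p)"
  have "(\<integral>\<^sup>+y\<in>{y. \<epsilon> *\<^sub>R y \<in> S} - P. ennreal ((w y * (\<epsilon> * g (\<epsilon> *\<^sub>R y))) powr p) \<partial>lborel) =
    (\<integral>\<^sup>+y\<in>{y. \<epsilon> *\<^sub>R y \<in> S - holes_at \<epsilon>}. ?F (\<epsilon> *\<^sub>R y) \<partial>lborel)"
    unfolding scaled_sets(1)[OF \<epsilon> S comp]
    using \<epsilon> by (intro nn_integral_cong) (simp add: ennreal_mult[symmetric] powr_mult mult_ac)
  then have "ennreal (\<epsilon> ^ DIM('a)) * (\<integral>\<^sup>+y\<in>{y. \<epsilon> *\<^sub>R y \<in> S} - P. ennreal ((w y * (\<epsilon> * g (\<epsilon> *\<^sub>R y))) powr p) \<partial>lborel)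
      = (\<integral>\<^sup>+x\<in>S - holes_at \<epsilon>. ?F x \<partial>lborel)"
    using nn_integral_scale_set[of ?F "S - holes_at \<epsilon>" \<epsilon>] \<epsilon> by simp
  also have "\<dots> = ennreal (\<epsilon> powr p) * (Lp_int p (S - holes_at \<epsilon>) (\<lambda>x. w ((1 / \<epsilon>) *\<^sub>R x) * g x))"
    by (subst nn_integral_cmult[symmetric]) (auto simp: mult.assoc)
  finally show ?thesis .
qed

text \<open>The constant is the one at period 1, fixed before \<epsilon>: both sides of that
  estimate are multiplied by the same Jacobian.\<close>

lemma scaled_norm_bound:
  "\<exists>C\<ge>0. \<forall>\<epsilon> S u g. 0 < \<epsilon> \<and> S \<in> sets borel \<and> compatible \<epsilon> S \<and> upper_gradient (S - holes_at \<epsilon>) u g \<longrightarrow>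
    (Lp_int p (S - holes_at \<epsilon>) (\<lambda>x. \<bar>u x\<bar>)) \<le>
      ennreal C * (ennreal (\<epsilon> powr p) * (Lp_int p (S - holes_at \<epsilon>) (\<lambda>x. w ((1 / \<epsilon>) *\<^sub>R x) * g x)) +
        (Lp_int p (S - holes_at \<epsilon>) (\<lambda>x. w ((1 / \<epsilon>) *\<^sub>R x) * \<bar>u x\<bar>)))"
proof -
  obtain C where C: "0 \<le> C" and bound: "\<And>U u g. (\<forall>j\<in>J. nbhd j \<rho> \<inter> U \<noteq> {} \<longrightarrow> nbhd j \<rho> \<subseteq> U) \<and> U \<in> sets borel \<and> upper_gradient (U - P) u g \<Longrightarrow>
    (Lp_int p (U - P) (\<lambda>x. \<bar>u x\<bar>)) \<le>
      ennreal C * ((Lp_int p (U - P) (\<lambda>x. w x * g x)) + (Lp_int p (U - P) (\<lambda>x. w x * \<bar>u x\<bar>)))"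
    using unit_norm_bound by auto
  show ?thesis
  proof (intro exI[of _ C] conjI allI impI C)
    fix \<epsilon> :: real and S :: "'a set" and u g :: "'a \<Rightarrow> real"
    assume A: "0 < \<epsilon> \<and> S \<in> sets borel \<and> compatible \<epsilon> S \<and> upper_gradient (S - holes_at \<epsilon>) u g"
    then have \<epsilon>: "0 < \<epsilon>" and S[measurable]: "S \<in> sets borel" and comp: "compatible \<epsilon> S" and ug: "upper_gradient (S - holes_at \<epsilon>) u g"
      by auto
    have [measurable]: "u \<in> borel_measurable borel" "g \<in> borel_measurable borel"
      using ug by (auto simp: upper_gradient_def)
    let ?U = "{y. \<epsilon> *\<^sub>R y \<in> S}" and ?K = "ennreal (\<epsilon> ^ DIM('a))"
    let ?D = "S - holes_at \<epsilon>"
    have sc: "?K * (\<integral>\<^sup>+y\<in>?U - P. F (\<epsilon> *\<^sub>R y) \<partial>lborel) = (\<integral>\<^sup>+x\<in>?D. F x \<partial>lborel)"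
      if "F \<in> borel_measurable borel" for F
      using nn_integral_scale_set[OF that _ \<epsilon>, of ?D] by (simp add: scaled_sets(1)[OF \<epsilon> S comp, simplified])
    have "Lp_int p (?U - P) (\<lambda>y. \<bar>u (\<epsilon> *\<^sub>R y)\<bar>) \<le>
      ennreal C * ((Lp_int p (?U - P) (\<lambda>y. w y * (\<epsilon> * g (\<epsilon> *\<^sub>R y)))) + (Lp_int p (?U - P) (\<lambda>y. w y * \<bar>u (\<epsilon> *\<^sub>R y)\<bar>)))"
      using scaled_sets(2,3)[OF \<epsilon> S comp] scaled_upper_gradient[OF \<epsilon> S comp ug] by (intro bound) auto
    then have "?K * (Lp_int p (?U - P) (\<lambda>y. \<bar>u (\<epsilon> *\<^sub>R y)\<bar>)) \<le>
      ?K * (ennreal C * ((Lp_int p (?U - P) (\<lambda>y. w y * (\<epsilon> * g (\<epsilon> *\<^sub>R y)))) + (Lp_int p (?U - P) (\<lambda>y. w y * \<bar>u (\<epsilon> *\<^sub>R y)\<bar>))))"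
      by (rule mult_left_mono) simp
    also have "\<dots> = ennreal C * (?K * (Lp_int p (?U - P) (\<lambda>y. w y * (\<epsilon> * g (\<epsilon> *\<^sub>R y)))) + ?K * (Lp_int p (?U - P) (\<lambda>y. w y * \<bar>u (\<epsilon> *\<^sub>R y)\<bar>)))"
      by (simp only: distrib_left mult.assoc mult.left_commute[of ?K])
    also have "?K * (Lp_int p (?U - P) (\<lambda>y. w y * \<bar>u (\<epsilon> *\<^sub>R y)\<bar>)) =
       (Lp_int p ?D (\<lambda>x. w ((1 / \<epsilon>) *\<^sub>R x) * \<bar>u x\<bar>))"
      using sc[of "\<lambda>x. ennreal ((w ((1 / \<epsilon>) *\<^sub>R x) * \<bar>u x\<bar>) powr p)"] \<epsilon> by simp
    also have "?K * (Lp_int p (?U - P) (\<lambda>y. \<bar>u (\<epsilon> *\<^sub>R y)\<bar>)) = (Lp_int p ?D (\<lambda>x. \<bar>u x\<bar>))"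
      by (rule sc) measurable
    finally show "Lp_int p ?D (\<lambda>x. \<bar>u x\<bar>) \<le>
      ennreal C * (ennreal (\<epsilon> powr p) * (Lp_int p ?D (\<lambda>x. w ((1 / \<epsilon>) *\<^sub>R x) * g x)) +
        (Lp_int p ?D (\<lambda>x. w ((1 / \<epsilon>) *\<^sub>R x) * \<bar>u x\<bar>)))"
      unfolding scaled_energy[OF \<epsilon> S comp ug] .
  qed
qed

text \<open>The function is filled at period 1, where a short shift costs at most
  \<open>C2 * E\<close>, and is then dilated back. A shift by h becomes about 8 norm h / (\<rho>
  \<epsilon>) short steps, and the p-th power of this number meets the factor \<epsilon>^p of the
  energy, so the shift hypothesis of the Poincare inequality on \<Omega> holds uniformly in
  \<epsilon>.\<close>

lemma scaled_Poincare:
  assumes \<Omega>: "open \<Omega>" "connected \<Omega>" "bounded \<Omega>" "lipschitz_boundary \<Omega>" "\<Omega> \<noteq> {}"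
  shows "\<exists>C\<ge>0. \<forall>\<epsilon> u g. 0 < \<epsilon> \<and> \<epsilon> < 1 \<and> compatible \<epsilon> \<Omega> \<and> upper_gradient (\<Omega> - holes_at \<epsilon>) u g \<longrightarrow>
    (\<exists>L. (Lp_int p (\<Omega> - holes_at \<epsilon>) (\<lambda>x. \<bar>u x - L\<bar>)) \<le>
      ennreal C * (Lp_int p (\<Omega> - holes_at \<epsilon>) (\<lambda>x. w ((1 / \<epsilon>) *\<^sub>R x) * g x)))"
proof -
  obtain b s where b: "cball b s \<subseteq> \<Omega>" "0 < s" using \<Omega>(1,5) unfolding open_contains_cball by blast
  obtain C1 where C1: "0 \<le> C1" "\<And>v E. v \<in> borel_measurable borel \<and>
    (\<forall>h W. W \<in> sets borel \<and> (\<forall>x\<in>W. \<forall>t\<in>{0..1}. x + t *\<^sub>R h \<in> \<Omega>) \<longrightarrow>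
       (Lp_int p W (\<lambda>x. \<bar>v (x + h) - v x\<bar>)) \<le> ennreal ((1 + norm h) powr p) * E) \<Longrightarrow>
    osc p v \<Omega> (ball b s) \<le> ennreal C1 * E"
    using domain_Poincare[OF p \<Omega>(1-4) b] by auto
  define C2 where "C2 = 1 + 2 * (2 powr p) * (C0 / mB)"
  have C2: "0 \<le> C2" unfolding C2_def using C0 emeasure_hole_ball(2) by simp
  \<comment> \<open>Chosen so that 8 norm h / \<rho> + \<epsilon> is at most c (1 + norm h), which
    uses \<epsilon> < 1.\<close>
  define c where "c = 8 / \<rho> + 1"
  have c: "1 \<le> c" using \<rho> by (simp add: c_def)
  obtain \<mu> where \<mu>: "emeasure lborel (ball b s) = ennreal \<mu>" "0 < \<mu>"
    using emeasure_lborel_ball_finite[of b s] content_ball_pos[OF b(2), of b]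
    by (metis emeasure_eq_ennreal_measure infinity_ennreal_def less_irrefl)
  have \<Omega>m[measurable]: "\<Omega> \<in> sets borel" using \<Omega>(1) by simp
  show ?thesis
  proof (rule exI[of _ "C1 * (c powr p * C2) / \<mu>"], intro conjI allI impI)
    show "0 \<le> C1 * (c powr p * C2) / \<mu>" using C1(1) C2 \<mu>(2) by simp
    fix \<epsilon> :: real and u g :: "'a \<Rightarrow> real"
    assume A: "0 < \<epsilon> \<and> \<epsilon> < 1 \<and> compatible \<epsilon> \<Omega> \<and> upper_gradient (\<Omega> - holes_at \<epsilon>) u g"
    then have \<epsilon>: "0 < \<epsilon>" "\<epsilon> < 1" and comp: "compatible \<epsilon> \<Omega>" and ug: "upper_gradient (\<Omega> - holes_at \<epsilon>) u g" by auto
    let ?U = "{y. \<epsilon> *\<^sub>R y \<in> \<Omega>}" and ?K = "ennreal (\<epsilon> ^ DIM('a))" and ?D = "\<Omega> - holes_at \<epsilon>"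
    define A where "A = (Lp_int p ?D (\<lambda>x. w ((1 / \<epsilon>) *\<^sub>R x) * g x))"
    define E where "E = (Lp_int p (?U - P) (\<lambda>y. w y * (\<epsilon> * g (\<epsilon> *\<^sub>R y))))"
    have KE: "?K * E = ennreal (\<epsilon> powr p) * A" unfolding A_def E_def by (rule scaled_energy[OF \<epsilon>(1) \<Omega>m comp ug])
    obtain v where v[measurable]: "v \<in> borel_measurable borel" and vu: "\<And>y. y \<notin> P \<Longrightarrow> v y = u (\<epsilon> *\<^sub>R y)"
      and short: "\<And>h W. norm h \<le> \<rho> / 8 \<Longrightarrow> W \<in> sets borel \<Longrightarrow> (\<And>x t. x \<in> W \<Longrightarrow> 0 \<le> t \<Longrightarrow> t \<le> 1 \<Longrightarrow> x + t *\<^sub>R h \<in> ?U) \<Longrightarrow>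
      (Lp_int p W (\<lambda>x. \<bar>v (x + h) - v x\<bar>)) \<le> ennreal C2 * E"
      apply (rule filled_short_shift[OF scaled_sets(3)[OF \<epsilon>(1) \<Omega>m comp] scaled_sets(2)[OF \<epsilon>(1) \<Omega>m comp]
          scaled_upper_gradient[OF \<epsilon>(1) \<Omega>m comp ug], folded C2_def E_def])
        apply assumption+
      subgoal premises prems for v by (rule prems(1)[OF prems(2-4)])
      done
    define V' where "V' x = v ((1 / \<epsilon>) *\<^sub>R x)" for x
    have V'm[measurable]: "V' \<in> borel_measurable borel" unfolding V'_def by measurable
    have "osc p V' \<Omega> (ball b s) \<le> ennreal C1 * (ennreal (c powr p * C2) * A)"
    proof (intro C1(2) conjI allI impI V'm)
      fix h :: 'a and W
      assume W: "W \<in> sets borel \<and> (\<forall>x\<in>W. \<forall>t\<in>{0..1}. x + t *\<^sub>R h \<in> \<Omega>)"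
      then have [measurable]: "W \<in> sets borel" by simp
      let ?W = "{y. \<epsilon> *\<^sub>R y \<in> W}" and ?h = "(1 / \<epsilon>) *\<^sub>R h"
      have Wm: "?W \<in> sets borel"
        using measurable_sets[of "\<lambda>y. \<epsilon> *\<^sub>R y" borel borel W] by (simp add: vimage_def)
      have "(Lp_int p W (\<lambda>x. \<bar>V' (x + h) - V' x\<bar>)) =
        ?K * (Lp_int p ?W (\<lambda>y. \<bar>V' (\<epsilon> *\<^sub>R y + h) - V' (\<epsilon> *\<^sub>R y)\<bar>))"
        by (rule nn_integral_scale_set[symmetric, OF _ _ \<epsilon>(1)]) measurable
      also have "(Lp_int p ?W (\<lambda>y. \<bar>V' (\<epsilon> *\<^sub>R y + h) - V' (\<epsilon> *\<^sub>R y)\<bar>)) =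
        (Lp_int p ?W (\<lambda>y. \<bar>v (y + ?h) - v y\<bar>))"
        using \<epsilon>(1) by (simp add: V'_def scaleR_add_right)
      also have "\<dots> \<le> ennreal ((norm ?h / (\<rho> / 8) + 1) powr p) * (ennreal C2 * E)"
      proof (rule iterate_short_shifts[OF p _ v short Wm])
        fix x t assume "x \<in> ?W" "0 \<le> t" "t \<le> (1::real)"
        then have "\<epsilon> *\<^sub>R x + t *\<^sub>R h \<in> \<Omega>" using W by auto
        then show "x + t *\<^sub>R ?h \<in> ?U" using \<epsilon>(1) by (simp add: scaleR_add_right)
      qed (use \<rho> in auto)
      finally have "Lp_int p W (\<lambda>x. \<bar>V' (x + h) - V' x\<bar>) \<le>
         ?K * (ennreal ((norm ?h / (\<rho> / 8) + 1) powr p) * (ennreal C2 * E))"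
        by (simp add: mult_left_mono)
      also have "\<dots> = ennreal ((norm ?h / (\<rho> / 8) + 1) powr p) * (ennreal C2 * (?K * E))"
        by (simp only: mult.left_commute)
      also have "\<dots> = ennreal ((norm ?h / (\<rho> / 8) + 1) powr p * \<epsilon> powr p) * (ennreal C2 * A)"
        unfolding KE by (simp add: ennreal_mult mult_ac)
      also have "(norm ?h / (\<rho> / 8) + 1) powr p * \<epsilon> powr p = ((norm ?h / (\<rho> / 8) + 1) * \<epsilon>) powr p"
        by (rule powr_mult[symmetric])
      also have "ennreal (((norm ?h / (\<rho> / 8) + 1) * \<epsilon>) powr p) * (ennreal C2 * A) \<le> ennreal ((c * (1 + norm h)) powr p) * (ennreal C2 * A)"
      proof (intro mult_right_mono ennreal_leI powr_mono2)
        \<comment> \<open>The bound for the number of steps times \<epsilon>; the summand 1 from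
          rounding up becomes \<epsilon>.\<close>
        have "(norm ?h / (\<rho> / 8) + 1) * \<epsilon> = 8 / \<rho> * norm h + \<epsilon>"
          using \<epsilon>(1) by (simp add: field_simps)
        also have "\<dots> \<le> 8 / \<rho> * (1 + norm h) + (1 + norm h)"
        proof (intro add_mono mult_left_mono)
          show "\<epsilon> \<le> 1 + norm h" using \<epsilon>(2) norm_ge_zero[of h] by linarith
        qed (use \<rho> in auto)
        also have "\<dots> = c * (1 + norm h)" by (simp add: c_def algebra_simps)
        finally show "(norm ?h / (\<rho> / 8) + 1) * \<epsilon> \<le> c * (1 + norm h)" .
      qed (use \<epsilon> \<rho> p in auto)
      also have "\<dots> = ennreal ((1 + norm h) powr p) * (ennreal (c powr p * C2) * A)"
        using C2 by (simp add: powr_mult ennreal_mult mult_ac)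
      finally show "Lp_int p W (\<lambda>x. \<bar>V' (x + h) - V' x\<bar>) \<le>
        ennreal ((1 + norm h) powr p) * (ennreal (c powr p * C2) * A)" .
    qed
    then have "\<exists>y\<in>ball b s. (Lp_int p \<Omega> (\<lambda>x. \<bar>V' x - V' y\<bar>)) \<le>
       ennreal C1 * (ennreal (c powr p * C2) * A) / emeasure lborel (ball b s)"
      using \<mu> by (intro osc_choose_point) auto
    then obtain L where L: "Lp_int p \<Omega> (\<lambda>x. \<bar>V' x - L\<bar>) \<le>
       ennreal C1 * (ennreal (c powr p * C2) * A) / ennreal \<mu>" unfolding \<mu>(1) by blast
    \<comment> \<open>The dilated filling agrees with \<open>u\<close> outside the holes, so
      restricting the estimate from \<Omega> to the perforated domain costs nothing.\<close>
    have "Lp_int p ?D (\<lambda>x. \<bar>u x - L\<bar>) \<le> (Lp_int p \<Omega> (\<lambda>x. \<bar>V' x - L\<bar>))"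
    proof (intro nn_integral_mono)
      fix x
      show "ennreal (\<bar>u x - L\<bar> powr p) * indicator ?D x \<le> ennreal (\<bar>V' x - L\<bar> powr p) * indicator \<Omega> x"
      proof (cases "x \<in> ?D")
        case True
        then have "V' x = u x" using vu[of "(1 / \<epsilon>) *\<^sub>R x"] \<epsilon>(1) by (simp add: V'_def holes_at_def)
        then show ?thesis using True by simp
      qed simp
    qed
    also note L
    also have "ennreal C1 * (ennreal (c powr p * C2) * A) / ennreal \<mu> = ennreal (C1 * (c powr p * C2) / \<mu>) * A"
    proof -
      have "ennreal (C1 * (c powr p * C2) / \<mu>) = ennreal (C1 * (c powr p * C2)) / ennreal \<mu>"
        using C1(1) C2 \<mu>(2) by (simp add: divide_ennreal)
      also have "ennreal (C1 * (c powr p * C2)) = ennreal C1 * ennreal (c powr p * C2)"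
        using C1(1) C2 by (intro ennreal_mult) auto
      finally show ?thesis by (simp add: ennreal_divide_times mult_ac divide_ennreal_def)
    qed
    finally show "\<exists>L. (Lp_int p ?D (\<lambda>x. \<bar>u x - L\<bar>)) \<le> ennreal (C1 * (c powr p * C2) / \<mu>) *
       (Lp_int p ?D (\<lambda>x. w ((1 / \<epsilon>) *\<^sub>R x) * g x))"
      unfolding A_def by blast
  qed
qed

end

section \<open>The theorem for the perforated domain\<close>

lemma nn_integral_lebesgue_on_borel:
  fixes F :: "'a::euclidean_space \<Rightarrow> ennreal"
  assumes [measurable]: "F \<in> borel_measurable borel" "S \<in> sets borel"
    and ae: "AE x in lborel. x \<in> S \<longrightarrow> f x = F x"
  shows "(\<integral>\<^sup>+x. f x \<partial>lebesgue_on S) = (\<integral>\<^sup>+x\<in>S. F x \<partial>lborel)"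
proof -
  have "(\<integral>\<^sup>+x. f x \<partial>lebesgue_on S) = (\<integral>\<^sup>+x. f x * indicator S x \<partial>lebesgue)"
    by (rule nn_integral_restrict_space) simp
  also have "\<dots> = (\<integral>\<^sup>+x. F x * indicator S x \<partial>lebesgue)"
    using AE_completion[OF ae] by (intro nn_integral_cong_AE) (auto elim!: eventually_mono simp: indicator_def)
  also have "\<dots> = (\<integral>\<^sup>+x\<in>S. F x \<partial>lborel)" by (rule nn_integral_completion)
  finally show ?thesis .
qed

lemma AE_lebesgue_on:
  assumes "S \<in> sets borel" "AE x in lborel. x \<in> S \<longrightarrow> Q x"
  shows "AE x in lebesgue_on S. Q x"
  using AE_completion[OF assms(2)] assms(1) by (subst AE_restrict_space_iff) auto

lemma L1loc_measurable:
  assumes "open U" "L1loc U f"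
  shows "f \<in> borel_measurable (lebesgue_on U)"
proof -
  have "(\<lambda>x. indicator U x *\<^sub>R f x) \<in> borel_measurable lebesgue"
    by (rule borel_representative[OF assms])
  then show ?thesis using assms(1) by (subst borel_measurable_restrict_space_iff) auto
qed

lemma Lp_norm_nonneg: "0 \<le> Lp_norm p S f"
  by (simp add: Lp_norm_def)

lemma Lp_norm_powr:
  assumes p: "1 < p" and f: "in_Lp p S f"
  shows "(\<integral>\<^sup>+x. ennreal (norm (f x) powr p) \<partial>lebesgue_on S) = ennreal (Lp_norm p S f powr p)"
proof -
  have i: "integrable (lebesgue_on S) (\<lambda>x. norm (f x) powr p)" using f by (simp add: in_Lp_def)
  have "0 \<le> (\<integral>x. norm (f x) powr p \<partial>lebesgue_on S)" by simp
  then have "Lp_norm p S f powr p = (\<integral>x. norm (f x) powr p \<partial>lebesgue_on S)"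
    using p by (simp add: Lp_norm_def powr_powr)
  then show ?thesis using nn_integral_eq_integral[OF i] by simp
qed

text \<open>\<open>Lp_norm\<close> uses the Bochner integral, which is 0 for non-integrable
  functions, so a bound on it alone would say little. The nonnegative integral is bounded instead,
  which yields membership in L^p together with the norm estimate.\<close>

lemma Lp_norm_leI:
  assumes p: "1 < p" and f: "f \<in> borel_measurable (lebesgue_on S)" and ct: "0 \<le> c" "0 \<le> t"
    and le: "(\<integral>\<^sup>+x. ennreal (norm (f x) powr p) \<partial>lebesgue_on S) \<le> ennreal (c * t powr p)"
  shows "in_Lp p S f" "Lp_norm p S f \<le> c powr (1 / p) * t"
proof -
  have m: "(\<lambda>x. norm (f x) powr p) \<in> borel_measurable (lebesgue_on S)" using f by measurable
  have i: "integrable (lebesgue_on S) (\<lambda>x. norm (f x) powr p)"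
  proof (rule integrableI_bounded[OF m])
    show "(\<integral>\<^sup>+x. ennreal (norm (norm (f x) powr p)) \<partial>lebesgue_on S) < \<infinity>"
      using le by (simp add: le_less_trans[OF _ ennreal_less_top])
  qed
  then show "in_Lp p S f" using f by (simp add: in_Lp_def)
  have "ennreal (\<integral>x. norm (f x) powr p \<partial>lebesgue_on S) \<le> ennreal (c * t powr p)"
    using nn_integral_eq_integral[OF i] le by simp
  then have "(\<integral>x. norm (f x) powr p \<partial>lebesgue_on S) \<le> c * t powr p"
    using ct by (subst (asm) ennreal_le_iff) auto
  then have "Lp_norm p S f \<le> (c * t powr p) powr (1 / p)"
    unfolding Lp_norm_def using p by (intro powr_mono2) auto
  also have "\<dots> = c powr (1 / p) * t" using p ct by (simp add: powr_mult powr_powr)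
  finally show "Lp_norm p S f \<le> c powr (1 / p) * t" .
qed

lemma weighted_integral_le:
  fixes F :: "'a::euclidean_space \<Rightarrow> real"
  assumes p: "1 < p" and [measurable]: "F \<in> borel_measurable borel" "S \<in> sets borel" and k: "0 \<le> k"
    and F: "\<And>x. 0 \<le> F x" and ae: "AE x in lborel. x \<in> S \<longrightarrow> F x \<le> k * norm (f x)" and f: "in_Lp p S f"
  shows "Lp_int p S (\<lambda>x. F x) \<le> ennreal ((k * Lp_norm p S f) powr p)"
proof -
  have m: "f \<in> borel_measurable (lebesgue_on S)" using f by (simp add: in_Lp_def)
  have "(Lp_int p S (\<lambda>x. F x)) = (\<integral>\<^sup>+x. ennreal (F x powr p) \<partial>lebesgue_on S)"
    by (rule nn_integral_lebesgue_on_borel[symmetric]) auto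
  also have "\<dots> \<le> (\<integral>\<^sup>+x. ennreal (k powr p) * ennreal (norm (f x) powr p) \<partial>lebesgue_on S)"
  proof (rule nn_integral_mono_AE)
    have "AE x in lebesgue_on S. F x \<le> k * norm (f x)" by (rule AE_lebesgue_on[OF _ ae]) simp
    then show "AE x in lebesgue_on S. ennreal (F x powr p) \<le> ennreal (k powr p) * ennreal (norm (f x) powr p)"
    proof eventually_elim
      case (elim x)
      then have "F x powr p \<le> (k * norm (f x)) powr p" using F p by (intro powr_mono2) auto
      also have "\<dots> = k powr p * norm (f x) powr p" by (rule powr_mult)
      finally show ?case by (simp add: ennreal_mult[symmetric] ennreal_leI)
    qed
  qed
  also have "\<dots> = ennreal (k powr p) * (\<integral>\<^sup>+x. ennreal (norm (f x) powr p) \<partial>lebesgue_on S)"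
    by (rule nn_integral_cmult) (use m in measurable)
  also have "\<dots> = ennreal ((k * Lp_norm p S f) powr p)"
    unfolding Lp_norm_powr[OF p f] by (simp add: ennreal_mult powr_mult)
  finally show ?thesis .
qed

text \<open>Nonnegativity of the norms supplies the lower bound that an infimum over the reals
  requires.\<close>

lemma Lp_norm_Inf_le:
  fixes f :: "'a::euclidean_space \<Rightarrow> real"
  shows "(INF L::real. Lp_norm p S (\<lambda>x. f x - L)) \<le> Lp_norm p S (\<lambda>x. f x - L)"
  by (rule cINF_lower) (auto intro!: bdd_belowI[of _ 0] simp: Lp_norm_nonneg)

theorem theorem2p5:
  fixes \<Omega> :: "(real^'n) set" and p c0 \<alpha> c\<phi> C\<phi> :: real and m :: nat
    and \<tau> \<tau>' :: "nat \<Rightarrow> (real^'n) set" and \<phi> :: "real^'n \<Rightarrow> real"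
  defines "T \<equiv> (\<Union>i<m. closure (\<tau> i))"
      and "T' \<equiv> (\<Union>i<m. closure (\<tau>' i))"
  assumes \<Omega>: "open \<Omega>" "connected \<Omega>" "bounded \<Omega>" "lipschitz_boundary \<Omega>"
      and p: "1 < p"
      and c0: "0 < c0"
      and m: "1 \<le> m"
      and holes: "\<forall>i<m. open (\<tau> i) \<and> smooth_boundary (\<tau> i) \<and> connected (frontier (\<tau> i))
                     \<and> \<tau> i \<subseteq> unit_cell \<and> setdist (\<tau> i) (frontier unit_cell) \<ge> c0"
      and holes_sep: "\<forall>i<m. \<forall>j<m. i \<noteq> j \<longrightarrow> \<tau> i \<inter> \<tau> j = {} \<and> setdist (\<tau> i) (\<tau> j) \<ge> c0"
      and ext: "\<forall>i<m. open (\<tau>' i) \<and> smooth_boundary (\<tau>' i) \<and> \<tau> i \<subseteq> \<tau>' i \<and> \<tau>' i \<subseteq> unit_cell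
                   \<and> setdist (\<tau>' i) (frontier unit_cell) \<ge> c0 / 4
                   \<and> setdist (frontier (\<tau>' i)) (\<tau> i) \<ge> c0 / 4"
      and ext_sep: "\<forall>i<m. \<forall>j<m. i \<noteq> j \<longrightarrow> setdist (\<tau>' i) (\<tau>' j) \<ge> c0 / 4"
      and \<phi>_pos: "\<forall>y. y \<notin> perf_set 1 T \<longrightarrow> 0 < \<phi> y"
      and \<phi>_per: "\<forall>z\<in>int_lattice. \<forall>y. y \<notin> perf_set 1 T \<longrightarrow> \<phi> (y + z) = \<phi> y"
      and \<phi>_bd: "0 < c\<phi>" "\<forall>y\<in>unit_cell - T. c\<phi> * infdist y T \<le> \<phi> y \<and> \<phi> y \<le> C\<phi> * infdist y T"
      and \<phi>_reg: "0 < \<alpha>" "\<alpha> \<le> 1" "C1_alpha_closure \<alpha> (unit_cell - T) \<phi>"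
  shows "\<exists>C>0. \<forall>\<epsilon>. 0 < \<epsilon> \<and> \<epsilon> < 1
            \<and> setdist (frontier \<Omega>) (frontier (perf_set \<epsilon> T)) \<ge> c0 * \<epsilon>
            \<and> (\<forall>z\<in>int_lattice. (\<lambda>t. \<epsilon> *\<^sub>R (z + t)) ` T' \<inter> frontier \<Omega> = {}) \<longrightarrow>
          (\<forall>u G. weighted_W1p p (\<lambda>x. \<phi> ((1 / \<epsilon>) *\<^sub>R x)) (\<Omega> - perf_set \<epsilon> T) u G \<longrightarrow>
             in_Lp p (\<Omega> - perf_set \<epsilon> T) u
           \<and> Lp_norm p (\<Omega> - perf_set \<epsilon> T) u
               \<le> C * \<epsilon> * Lp_norm p (\<Omega> - perf_set \<epsilon> T) (\<lambda>x. \<phi> ((1 / \<epsilon>) *\<^sub>R x) *\<^sub>R G x)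
                 + C * Lp_norm p (\<Omega> - perf_set \<epsilon> T) (\<lambda>x. \<phi> ((1 / \<epsilon>) *\<^sub>R x) * u x)
           \<and> (INF L::real. Lp_norm p (\<Omega> - perf_set \<epsilon> T) (\<lambda>x. u x - L))
               \<le> C * Lp_norm p (\<Omega> - perf_set \<epsilon> T) (\<lambda>x. \<phi> ((1 / \<epsilon>) *\<^sub>R x) *\<^sub>R G x))"
proof -
  define V where "V j = (+) (fst j) ` \<tau> (snd j)" for j
  have T: "T = (\<Union>i<m. closure (\<tau> i))" and T': "T' = (\<Union>i<m. closure (\<tau>' i))" by (simp_all add: T_def T'_def)
  note holes' = holes[rule_format] and ext' = ext[rule_format]
  have hsep: "c0 \<le> setdist (\<tau> i) (\<tau> j)" if "i < m" "j < m" "i \<noteq> j" for i j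
    using holes_sep that by blast
  have ne: "\<tau> i \<noteq> {}" if "i < m" for i using holes'[OF that] c0 by auto
  have bnd: "bounded (\<tau> i)" if "i < m" for i using holes'[OF that] bounded_unit_cell bounded_subset by blast
  have "\<exists>a r \<beta> C0 m0. hole_system p (c0 / 4) (int_lattice \<times> {..<m}) V a r \<beta> C0 m0"
    unfolding V_def[abs_def] by (rule periodic_hole_system[OF p c0 m]) (use holes' hsep in auto)
  then obtain a r \<beta> C0 m0 where HS: "hole_system p (c0 / 4) (int_lattice \<times> {..<m}) V a r \<beta> C0 m0"
    by auto
  interpret hole_system p "c0 / 4" "int_lattice \<times> {..<m}" V a r \<beta> C0 m0 by (rule HS)
  have P: "P = perf_set 1 T"
  proof (intro set_eqI iffI)
    fix x assume "x \<in> P"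
    then obtain z i where zi: "z \<in> int_lattice" "i < m" "x - z \<in> closure (\<tau> i)"
      by (auto simp: P_def V_def closure_translate_mem)
    then show "x \<in> perf_set 1 T" unfolding perf_set_def T
      by (intro UN_I[of z] image_eqI[of _ _ "x - z"]) auto
  next
    fix x assume "x \<in> perf_set 1 T"
    then obtain z i t where "z \<in> int_lattice" "i < m" "t \<in> closure (\<tau> i)" "x = z + t"
      by (auto simp: perf_set_def T)
    then show "x \<in> P" unfolding P_def
      by (intro UN_I[of "(z, i)"]) (auto simp: V_def closure_translate_mem)
  qed
  have hat: "holes_at \<epsilon> = perf_set \<epsilon> T" if "0 < \<epsilon>" for \<epsilon>
    using perf_set_scale[OF that, of _ T] by (auto simp: holes_at_def P)
  have "compact T" unfolding T using bnd by (intro compact_UN) auto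
  then have closedP: "closed P" unfolding P by (rule closed_perf_set_1)
  have openD: "open (\<Omega> - holes_at \<epsilon>)" for \<epsilon>
  proof -
    have "closed ((\<lambda>x. (1 / \<epsilon>) *\<^sub>R x) -` P)" by (intro continuous_closed_vimage closedP continuous_intros)
    then have "closed (holes_at \<epsilon>)" by (simp add: holes_at_def vimage_def)
    then show ?thesis using \<Omega>(1) by (rule open_Diff[rotated])
  qed
  have "T \<noteq> {}" using ne m unfolding T by force
  then have "AE x in lborel. x \<notin> P \<longrightarrow> c\<phi> * infdist x P \<le> \<phi> x"
    unfolding P using \<phi>_per \<phi>_bd by (intro weight_lower_bound) auto
  from AE_lborel_affine[OF this, of "1 / \<epsilon>" 0 for \<epsilon>]
  have weight: "AE x in lborel. x \<notin> holes_at \<epsilon> \<longrightarrow> c\<phi> * w ((1 / \<epsilon>) *\<^sub>R x) \<le> \<phi> ((1 / \<epsilon>) *\<^sub>R x)" if "0 < \<epsilon>" for \<epsilon>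
    using that by (simp add: holes_at_def)
  \<comment> \<open>The neighbourhood of a hole is connected and contained in the extended hole,
    which avoids the frontier of \<Omega>; so it lies in \<Omega> as soon as it meets it.\<close>
  have comp: "compatible \<epsilon> \<Omega>"
    if \<epsilon>: "0 < \<epsilon>" and disj: "\<forall>z\<in>int_lattice. (\<lambda>t. \<epsilon> *\<^sub>R (z + t)) ` T' \<inter> frontier \<Omega> = {}" for \<epsilon>
    unfolding compatible_def
  proof (intro ballI impI)
    fix j assume j: "j \<in> int_lattice \<times> {..<m}" and meet: "(\<lambda>y. \<epsilon> *\<^sub>R y) ` nbhd j (c0 / 4) \<inter> \<Omega> \<noteq> {}"
    obtain z i where zi: "j = (z, i)" "z \<in> int_lattice" "i < m" using j by auto
    let ?N = "nbhd j (c0 / 4)"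
    have "connected (closure (\<tau> i))"
      using holes'[OF zi(3)] bnd[OF zi(3)] by (intro connected_closure_of_connected_frontier) auto
    then have "connected ((+) z ` closure (\<tau> i))" by (intro connected_continuous_image continuous_intros)
    then have "connected ?N"
      unfolding nbhd_def using ne[OF zi(3)] c0 zi(1)
      by (intro connected_infdist_nbhd) (auto simp: V_def closure_translation)
    then have con: "connected ((\<lambda>y. \<epsilon> *\<^sub>R y) ` ?N)" by (intro connected_continuous_image continuous_intros)
    \<comment> \<open>A point outside the extended hole is at distance at least c0 / 4 from the
      hole, since a segment to it crosses the frontier of the extended hole.\<close>
    have sub: "y - z \<in> \<tau>' i" if "y \<in> ?N" for y
    proof (rule ccontr)
      assume "y - z \<notin> \<tau>' i"
      then have "c0 / 4 \<le> dist q (y - z)" if "q \<in> closure (\<tau> i)" for q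
        using ext'[OF zi(3)] c0 that by (intro dist_ge_of_setdist_frontier[of "\<tau> i" "\<tau>' i"]) (auto simp: setdist_sym)
      moreover obtain q where "q \<in> closure (\<tau> i)" "infdist (y - z) (closure (\<tau> i)) = dist (y - z) q"
        using infdist_attains_inf[of "closure (\<tau> i)" "y - z"] ne[OF zi(3)] by auto
      ultimately have "c0 / 4 \<le> infdist (y - z) (\<tau> i)" by (auto simp: infdist_closure dist_commute)
      then show False using that by (simp add: nbhd_def V_def zi(1) infdist_translate)
    qed
    have "(\<lambda>y. \<epsilon> *\<^sub>R y) ` ?N \<subseteq> (\<lambda>t. \<epsilon> *\<^sub>R (z + t)) ` T'"
    proof (rule image_subsetI)
      fix y assume "y \<in> ?N"
      then have "y - z \<in> T'" using sub zi(3) closure_subset unfolding T' by blast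
      then show "\<epsilon> *\<^sub>R y \<in> (\<lambda>t. \<epsilon> *\<^sub>R (z + t)) ` T'" by (intro image_eqI[of _ _ "y - z"]) auto
    qed
    then have "(\<lambda>y. \<epsilon> *\<^sub>R y) ` ?N \<inter> frontier \<Omega> = {}" using disj zi(2) by blast
    then show "(\<lambda>y. \<epsilon> *\<^sub>R y) ` ?N \<subseteq> \<Omega>" using connected_Int_frontier[OF con meet] by blast
  qed
  obtain C1 where C1: "0 \<le> C1" "\<And>\<epsilon> S u g. 0 < \<epsilon> \<and> S \<in> sets borel \<and> compatible \<epsilon> S \<and> upper_gradient (S - holes_at \<epsilon>) u g \<Longrightarrow>
    (Lp_int p (S - holes_at \<epsilon>) (\<lambda>x. \<bar>u x\<bar>)) \<le>
      ennreal C1 * (ennreal (\<epsilon> powr p) * (Lp_int p (S - holes_at \<epsilon>) (\<lambda>x. w ((1 / \<epsilon>) *\<^sub>R x) * g x)) +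
        (Lp_int p (S - holes_at \<epsilon>) (\<lambda>x. w ((1 / \<epsilon>) *\<^sub>R x) * \<bar>u x\<bar>)))"
    using scaled_norm_bound by auto
  have "\<exists>C\<ge>0. \<forall>\<epsilon> u g. 0 < \<epsilon> \<and> \<epsilon> < 1 \<and> compatible \<epsilon> \<Omega> \<and> upper_gradient (\<Omega> - holes_at \<epsilon>) u g \<longrightarrow>
    (\<exists>L. (Lp_int p (\<Omega> - holes_at \<epsilon>) (\<lambda>x. \<bar>u x - L\<bar>)) \<le>
      ennreal C * (Lp_int p (\<Omega> - holes_at \<epsilon>) (\<lambda>x. w ((1 / \<epsilon>) *\<^sub>R x) * g x)))"
  \<comment> \<open>An empty domain contains no reference ball, but all integrals vanish
    there.\<close>
  proof (cases "\<Omega> = {}")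
    case False
    then show ?thesis using scaled_Poincare[OF \<Omega>] by blast
  qed (auto intro: exI[of _ 0])
  then obtain C2 where C2: "0 \<le> C2" "\<And>\<epsilon> u g. 0 < \<epsilon> \<and> \<epsilon> < 1 \<and> compatible \<epsilon> \<Omega> \<and> upper_gradient (\<Omega> - holes_at \<epsilon>) u g \<Longrightarrow>
    (\<exists>L. (Lp_int p (\<Omega> - holes_at \<epsilon>) (\<lambda>x. \<bar>u x - L\<bar>)) \<le>
      ennreal C2 * (Lp_int p (\<Omega> - holes_at \<epsilon>) (\<lambda>x. w ((1 / \<epsilon>) *\<^sub>R x) * g x)))"
    by auto
  define k where "k = 1 / c\<phi>"
  have k: "0 < k" "k * c\<phi> = 1" using \<phi>_bd(1) by (auto simp: k_def)
  \<comment> \<open>\<open>k\<close> converts the distance weight into \<phi>, and the 2 comes from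
    a^p + b^p \<le> 2 (a + b)^p.\<close>
  define K1 where "K1 = (C1 * (2 * k powr p)) powr (1 / p)"
  define K2 where "K2 = (C2 * k powr p) powr (1 / p)"
  have K: "0 \<le> K1" "0 \<le> K2" by (auto simp: K1_def K2_def)
  show ?thesis
  \<comment> \<open>One constant serves both inequalities; the summand 1 keeps it positive even when
    \<open>K1\<close> and \<open>K2\<close> vanish.\<close>
  proof (rule exI[of _ "K1 + K2 + 1"], intro conjI allI impI)
    show "0 < K1 + K2 + 1" using K by simp
    fix \<epsilon> u G
    assume \<epsilon>': "0 < \<epsilon> \<and> \<epsilon> < 1 \<and> setdist (frontier \<Omega>) (frontier (perf_set \<epsilon> T)) \<ge> c0 * \<epsilon>
            \<and> (\<forall>z\<in>int_lattice. (\<lambda>t. \<epsilon> *\<^sub>R (z + t)) ` T' \<inter> frontier \<Omega> = {})"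
    let ?D = "\<Omega> - perf_set \<epsilon> T"
    assume W: "weighted_W1p p (\<lambda>x. \<phi> ((1 / \<epsilon>) *\<^sub>R x)) ?D u G"
    have \<epsilon>: "0 < \<epsilon>" "\<epsilon> < 1" and cmp: "compatible \<epsilon> \<Omega>" using \<epsilon>' comp by auto
    note h = hat[OF \<epsilon>(1)]
    have D: "open ?D" using openD[of \<epsilon>] unfolding h .
    have Dm[measurable]: "?D \<in> sets borel" using D by (rule borel_open)
    have \<Omega>m: "\<Omega> \<in> sets borel" using \<Omega>(1) by simp
    have u: "L1loc ?D u" and wg: "weak_grad ?D u G" and fu: "in_Lp p ?D (\<lambda>x. \<phi> ((1 / \<epsilon>) *\<^sub>R x) * u x)"
      and fG: "in_Lp p ?D (\<lambda>x. \<phi> ((1 / \<epsilon>) *\<^sub>R x) *\<^sub>R G x)" using W by (auto simp: weighted_W1p_def)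
    \<comment> \<open>\<open>u\<close> and the norm of \<open>G\<close> are replaced by Borel
      versions; the estimates concern these, and the norms of the statement see only almost
      everywhere values.\<close>
    obtain u0 g where ug: "upper_gradient ?D u0 g" and rep: "AE x in lborel. x \<in> ?D \<longrightarrow> u x = u0 x \<and> norm (G x) = g x"
      by (rule weak_grad_upper_gradient[OF D u wg])
    have [measurable]: "u0 \<in> borel_measurable borel" "g \<in> borel_measurable borel" and g: "\<And>x. 0 \<le> g x"
      using ug by (auto simp: upper_gradient_def)
    let ?\<alpha> = "Lp_norm p ?D (\<lambda>x. \<phi> ((1 / \<epsilon>) *\<^sub>R x) *\<^sub>R G x)" and ?\<beta> = "Lp_norm p ?D (\<lambda>x. \<phi> ((1 / \<epsilon>) *\<^sub>R x) * u x)"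
    have nn: "0 \<le> ?\<alpha>" "0 \<le> ?\<beta>" by (rule Lp_norm_nonneg)+
    have A: "Lp_int p ?D (\<lambda>x. w ((1 / \<epsilon>) *\<^sub>R x) * g x) \<le> ennreal ((k * ?\<alpha>) powr p)"
    proof (rule weighted_integral_le[OF p _ Dm _ _ _ fG])
      show "AE x in lborel. x \<in> ?D \<longrightarrow> w ((1 / \<epsilon>) *\<^sub>R x) * g x \<le> k * norm (\<phi> ((1 / \<epsilon>) *\<^sub>R x) *\<^sub>R G x)"
        using weight[OF \<epsilon>(1)] rep
      proof eventually_elim
        case (elim x)
        show ?case
        proof
          assume x: "x \<in> ?D"
          then have "w ((1 / \<epsilon>) *\<^sub>R x) \<le> k * \<bar>\<phi> ((1 / \<epsilon>) *\<^sub>R x)\<bar>"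
            using elim(1) \<phi>_bd(1) by (auto simp: h k_def field_simps)
          then have "w ((1 / \<epsilon>) *\<^sub>R x) * g x \<le> (k * \<bar>\<phi> ((1 / \<epsilon>) *\<^sub>R x)\<bar>) * g x" using g by (rule mult_right_mono)
          then show "w ((1 / \<epsilon>) *\<^sub>R x) * g x \<le> k * norm (\<phi> ((1 / \<epsilon>) *\<^sub>R x) *\<^sub>R G x)" using elim(2) x by (simp add: mult.assoc)
        qed
      qed
    qed (use k g in \<open>auto intro!: mult_nonneg_nonneg infdist_nonneg\<close>)
    have B: "Lp_int p ?D (\<lambda>x. w ((1 / \<epsilon>) *\<^sub>R x) * \<bar>u0 x\<bar>) \<le> ennreal ((k * ?\<beta>) powr p)"
    proof (rule weighted_integral_le[OF p _ Dm _ _ _ fu])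
      show "AE x in lborel. x \<in> ?D \<longrightarrow> w ((1 / \<epsilon>) *\<^sub>R x) * \<bar>u0 x\<bar> \<le> k * norm (\<phi> ((1 / \<epsilon>) *\<^sub>R x) * u x)"
        using weight[OF \<epsilon>(1)] rep
      proof eventually_elim
        case (elim x)
        show ?case
        proof
          assume x: "x \<in> ?D"
          then have "w ((1 / \<epsilon>) *\<^sub>R x) \<le> k * \<bar>\<phi> ((1 / \<epsilon>) *\<^sub>R x)\<bar>"
            using elim(1) \<phi>_bd(1) by (auto simp: h k_def field_simps)
          then have "w ((1 / \<epsilon>) *\<^sub>R x) * \<bar>u0 x\<bar> \<le> (k * \<bar>\<phi> ((1 / \<epsilon>) *\<^sub>R x)\<bar>) * \<bar>u0 x\<bar>" by (rule mult_right_mono) simp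
          then show "w ((1 / \<epsilon>) *\<^sub>R x) * \<bar>u0 x\<bar> \<le> k * norm (\<phi> ((1 / \<epsilon>) *\<^sub>R x) * u x)" using elim(2) x by (simp add: abs_mult mult.assoc)
        qed
      qed
    qed (use k in \<open>auto intro!: mult_nonneg_nonneg infdist_nonneg\<close>)
    have um: "u \<in> borel_measurable (lebesgue_on ?D)" by (rule L1loc_measurable[OF D u])
    let ?t = "\<epsilon> * ?\<alpha> + ?\<beta>"
    have "(\<integral>\<^sup>+x. ennreal (norm (u x) powr p) \<partial>lebesgue_on ?D) = (Lp_int p ?D (\<lambda>x. \<bar>u0 x\<bar>))"
      by (rule nn_integral_lebesgue_on_borel) (use rep in \<open>auto elim!: eventually_mono\<close>)
    also have "\<dots> \<le> ennreal C1 * (ennreal (\<epsilon> powr p) * (Lp_int p ?D (\<lambda>x. w ((1 / \<epsilon>) *\<^sub>R x) * g x)) +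
        (Lp_int p ?D (\<lambda>x. w ((1 / \<epsilon>) *\<^sub>R x) * \<bar>u0 x\<bar>)))"
      using C1(2)[of \<epsilon> \<Omega> u0 g] \<epsilon> \<Omega>m cmp ug unfolding h by blast
    also have "\<dots> \<le> ennreal C1 * (ennreal (\<epsilon> powr p) * ennreal ((k * ?\<alpha>) powr p) + ennreal ((k * ?\<beta>) powr p))"
      by (intro mult_left_mono add_mono A B) auto
    also have "\<dots> = ennreal (C1 * (k powr p * ((\<epsilon> * ?\<alpha>) powr p + ?\<beta> powr p)))"
      using C1(1) by (simp add: ennreal_mult[symmetric] ennreal_plus[symmetric] powr_mult algebra_simps del: ennreal_plus)
    also have "\<dots> \<le> ennreal (C1 * (2 * k powr p) * ?t powr p)"
    proof (rule ennreal_leI)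
      have "(\<epsilon> * ?\<alpha>) powr p \<le> ?t powr p" "?\<beta> powr p \<le> ?t powr p"
        using nn \<epsilon> p by (auto intro!: powr_mono2)
      then have "(\<epsilon> * ?\<alpha>) powr p + ?\<beta> powr p \<le> 2 * ?t powr p" by simp
      then have "C1 * (k powr p * ((\<epsilon> * ?\<alpha>) powr p + ?\<beta> powr p)) \<le> C1 * (k powr p * (2 * ?t powr p))"
        using C1(1) by (intro mult_left_mono) auto
      then show "C1 * (k powr p * ((\<epsilon> * ?\<alpha>) powr p + ?\<beta> powr p)) \<le> C1 * (2 * k powr p) * ?t powr p"
        by (simp add: mult_ac)
    qed
    finally have N: "(\<integral>\<^sup>+x. ennreal (norm (u x) powr p) \<partial>lebesgue_on ?D) \<le> ennreal (C1 * (2 * k powr p) * ?t powr p)" .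
    have c1: "0 \<le> C1 * (2 * k powr p)" and t0: "0 \<le> ?t" using C1(1) nn \<epsilon>(1) by auto
    show "in_Lp p ?D u" by (rule Lp_norm_leI(1)[OF p um c1 t0 N])
    have "Lp_norm p ?D u \<le> K1 * ?t" unfolding K1_def by (rule Lp_norm_leI(2)[OF p um c1 t0 N])
    also have "\<dots> \<le> (K1 + K2 + 1) * ?t" using K t0 by (intro mult_right_mono) auto
    finally show "Lp_norm p ?D u \<le> (K1 + K2 + 1) * \<epsilon> * ?\<alpha> + (K1 + K2 + 1) * ?\<beta>" by (simp add: distrib_left mult.assoc)
    obtain L where L: "Lp_int p ?D (\<lambda>x. \<bar>u0 x - L\<bar>) \<le>
      ennreal C2 * (Lp_int p ?D (\<lambda>x. w ((1 / \<epsilon>) *\<^sub>R x) * g x))"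
      using C2(2)[of \<epsilon> u0 g] \<epsilon> cmp ug unfolding h by blast
    have "(\<integral>\<^sup>+x. ennreal (norm (u x - L) powr p) \<partial>lebesgue_on ?D) = (Lp_int p ?D (\<lambda>x. \<bar>u0 x - L\<bar>))"
      by (rule nn_integral_lebesgue_on_borel) (use rep in \<open>auto elim!: eventually_mono\<close>)
    also note L
    also have "ennreal C2 * (Lp_int p ?D (\<lambda>x. w ((1 / \<epsilon>) *\<^sub>R x) * g x)) \<le> ennreal C2 * ennreal ((k * ?\<alpha>) powr p)"
      by (intro mult_left_mono A) simp
    also have "\<dots> = ennreal (C2 * k powr p * ?\<alpha> powr p)"
      using C2(1) by (simp add: ennreal_mult[symmetric] powr_mult mult.assoc)
    finally have M: "(\<integral>\<^sup>+x. ennreal (norm (u x - L) powr p) \<partial>lebesgue_on ?D) \<le> ennreal (C2 * k powr p * ?\<alpha> powr p)" .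
    have "(INF L::real. Lp_norm p ?D (\<lambda>x. u x - L)) \<le> Lp_norm p ?D (\<lambda>x. u x - L)" by (rule Lp_norm_Inf_le)
    also have "\<dots> \<le> K2 * ?\<alpha>" unfolding K2_def
      by (rule Lp_norm_leI(2)[OF p _ _ nn(1) M]) (use um C2(1) in auto)
    also have "\<dots> \<le> (K1 + K2 + 1) * ?\<alpha>" using K nn by (intro mult_right_mono) auto
    finally show "(INF L::real. Lp_norm p ?D (\<lambda>x. u x - L)) \<le> (K1 + K2 + 1) * ?\<alpha>" .
  qed
qed

end
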